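(* Let $n\ge1$ and $r,s\in\mathbb{Z}_{\ge0}$ with $r+s>0$. The linear map $\Psi_{r,s}:\overrightarrow B_{r,s}\to\operatorname{End}_{\mathfrak q(n)}(\mathbf V^{\otimes r}\otimes\mathbf W^{\otimes s})$ is surjective. Moreover, when $n\ge r+s$, $\Psi_{r,s}$ is a bijection.
   Context: Ground field $\mathbb{C}$. $I=\{1,\dots,n,\overline1,\dots,\overline n\}$ with $\overline{\overline i}=i$; $|i|=0$ for $i\in\{1,\dots,n\}$, $|i|=1$ for $i\in\{\overline1,\dots,\overline n\}$. $\mathbf V=\mathbb C^{n|n}$ has homogeneous basis $v_i$ ($i\in I$), $|v_i|=|i|$; $\mathbf W=\mathbf V^*$ has the dual basis $w_i$, $w_i(v_j)=\delta_{i,j}$. $P$ is the odd operator $P(v_i)=(-1)^{|i|+1}v_{\overline i}$ on $\mathbf V$, and $\mathfrak q(n)=\{f\in\operatorname{End}_{\mathbb C}(\mathbf V)\mid[f,P]=0\}$ where $[f,g]=fg-(-1)^{|f||g|}gf$. $\mathfrak q(n)$ acts on $\mathbf W$ by $(gw)(v)=-(-1)^{|g||w|}w(gv)$, and on $\mathbf V^{\otimes r}\otimes\mathbf W^{\otimes s}$ via $\Delta(g)=g\otimes1+1\otimes g$, i.e. $g(x_1\otimes\cdots\otimes x_{r+s})=\sum_k(-1)^{|g|(|x_1|+\cdots+|x_{k-1}|)}x_1\otimes\cdots\otimes gx_k\otimes\cdots\otimes x_{r+s}$; this action is denoted $\rho$. $\operatorname{End}_{\mathfrak q(n)}(\mathbf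 V^{\otimes r}\otimes\mathbf W^{\otimes s})$ is the span of homogeneous linear $f$ with $\rho(g)f=(-1)^{|g||f|}f\rho(g)$ for all homogeneous $g\in\mathfrak q(n)$. **$(r,s)$-superdiagrams.** An $(r,s)$-superdiagram has $r+s$ vertices in a top row and $r+s$ vertices in a bottom row (each numbered $1,\dots,r+s$ from left to right), and a vertical wall separating the $r$-th and $(r+1)$-th vertices in each row. Each vertex is connected to exactly one other vertex by an edge; each edge is marked or normal. Vertical edges (joining a top vertex to a bottom vertex) do not cross the wall, and horizontal edges (joining two vertices of the same row) must cross the wall. $\overrightarrow B_{r,s}$ is the superspace with basis the $(r,s)$-superdiagrams, with parity the number of marked edges mod 2. **The map $\Psi_{r,s}$.** For $\mathbf i=(i_1,\dots,i_{r+s}),\mathbf j=(j_1,\dots,j_{r+s})\in I^{r+s}$ write $\mathbf i^L=(i_1,\dots,i_r)$, $\mathbf i^R=(i_{r+1},\dots,i_{r+s})$, $v_{\mathbf i^L}=v_{i_1}\otimes\cdots\otimes v_{i_r}$, $w_{\mathbf i^R}=w_{i_{r+1}}\otimes\cdots\otimes w_{i_{r+s}}$, and similarly for $\mathbf j$. Label the bottom vertices of $d$ by $i_1,\dots,i_{r+s}$ and the top vertices by $j_1,\dots,j_{r+s}$ from left to right. The weight of this labeled diagram is $$\operatorname{wt}({}_{\mathbf i}d_{\mathbf j})=\prod_e\delta_e\prod_h(-1)^{|h|}\prod_c(-1)^{|c|}\prod_{e_i,\widetilde e_i}(-1)^{m(e_i)+m(\widetilde e_i)},$$ where: (1) $e$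 runs over all edges; $\delta_e=\delta_{i,j}$ for a normal edge with end labels $i,j$; $\delta_e=\delta_{\overline i,j}$ for a marked vertical edge with bottom label $i$, top label $j$, or a marked horizontal edge with left label $i$, right label $j$. (2) $h$ runs over all (normal or marked) horizontal edges on the bottom row; $|h|=|j|$ where $j$ is the label of the right vertex. (3) $c$ runs over all crossings of two different edges $e_1,e_2$ (edges drawn inside the rectangle so that two edges cross at most once, i.e. they cross iff their endpoints interlace on the boundary of the rectangle); $|c|=|e_1||e_2|$, where $|e|=|i_m|$ for a vertical edge with bottom label $i_m$ or a horizontal edge with right label $i_m$. (4) (i) If $a_1<\cdots<a_p$ are the left vertices of the marked horizontal edges $e_1,\dots,e_p$ on the bottom row, then $m(e_1)=|i_1|+\cdots+|i_{a_1}|+1$ and $m(e_i)=m(e_{i-1})+|i_{a_{i-1}+1}|+\cdots+|i_{a_i}|+1$. (ii) If $b_1<\cdots<b_q$ are the top vertices of the marked vertical edges together with the left vertices of the marked horizontal edges on the top row, with corresponding edges $\widetilde e_1,\dots,\widetilde e_q$, then $m(\widetilde e_i)=|j_1|+\cdots+|j_{b_i}|$ if $b_i\le r$, and $m(\widetilde e_i)=|j_1|+\cdots+|j_{b_i-1}|$ if $b_i>r$. Then $\Psi_{r,s}$ is the linear map with $\Psi_{r,s}(d)(v_{\mathbf i^L}\otimes w_{\mathbf i^R})=\sum_{\mathbf j\in I^{r+s}}\operatorname{wt}({}_{\mathbf i}d_{\mathbf j})\,v_{\mathbf j^L}\otimes w_{\mathbf j^R}$; its image lies in $\operatorname{End}_{\mathfrak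 q(n)}(\mathbf V^{\otimes r}\otimes\mathbf W^{\otimes s})$. *)

theory Defs
  imports Complex_Main "HOL-Library.FuncSet" "HOL-Library.Function_Algebras"
begin

section \<open>Vector spaces with a distinguished basis\<close>

text \<open>
  The complex vector space with basis a (finite) set \<open>B\<close> is the space of coordinate functions
  vanishing off \<open>B\<close>.  A linear map out of such a space is extended by \<open>0\<close> to the rest of the type,
  so that equality of HOL functions is equality of linear maps and pointwise operations are the
  vector space operations.
\<close>

definition fspace :: "'b set \<Rightarrow> ('b \<Rightarrow> complex) set" where
  "fspace B = {x. \<forall>b. b \<notin> B \<longrightarrow> x b = 0}"

definition bvec :: "'b \<Rightarrow> 'b \<Rightarrow> complex" where
  "bvec b = (\<lambda>c. if c = b then 1 else 0)"

definition vscale :: "complex \<Rightarrow> ('b \<Rightarrow> complex) \<Rightarrow> 'b \<Rightarrow> complex" where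
  "vscale c x = (\<lambda>b. c * x b)"

definition endos :: "'b set \<Rightarrow> (('b \<Rightarrow> complex) \<Rightarrow> 'b \<Rightarrow> complex) set" where
  "endos B = {f.
     (\<forall>x \<in> fspace B. f x \<in> fspace B) \<and>
     (\<forall>x \<in> fspace B. \<forall>y \<in> fspace B. f (x + y) = f x + f y) \<and>
     (\<forall>c. \<forall>x \<in> fspace B. f (vscale c x) = vscale c (f x)) \<and>
     (\<forall>x. x \<notin> fspace B \<longrightarrow> f x = 0)}"

definition lin_ext :: "'b set \<Rightarrow> ('b \<Rightarrow> 'c \<Rightarrow> complex) \<Rightarrow> ('b \<Rightarrow> complex) \<Rightarrow> 'c \<Rightarrow> complex" where
  "lin_ext B h = (\<lambda>x. if x \<in> fspace B then (\<Sum>b\<in>B. vscale (x b) (h b)) else 0)"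

definition mscale :: "complex \<Rightarrow> ('a \<Rightarrow> 'b \<Rightarrow> complex) \<Rightarrow> 'a \<Rightarrow> 'b \<Rightarrow> complex" where
  "mscale c f = (\<lambda>x. vscale c (f x))"

interpretation maps: vector_space mscale
  by standard (simp_all add: mscale_def vscale_def fun_eq_iff algebra_simps)


section \<open>Superspaces\<close>

text \<open>
  The \<open>\<int>/2\<close>-grading is given by a parity function on the basis; parities are the naturals \<open>0\<close>
  and \<open>1\<close>.
\<close>

definition hproj :: "('b \<Rightarrow> nat) \<Rightarrow> nat \<Rightarrow> ('b \<Rightarrow> complex) \<Rightarrow> 'b \<Rightarrow> complex" where
  "hproj par q x = (\<lambda>b. if par b = q then x b else 0)"

definition homogeneous ::
  "'b set \<Rightarrow> ('b \<Rightarrow> nat) \<Rightarrow> nat \<Rightarrow> (('b \<Rightarrow> complex) \<Rightarrow> 'b \<Rightarrow> complex) \<Rightarrow> bool" where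
  "homogeneous B par p f \<longleftrightarrow>
     (\<forall>q \<in> {0, 1}. \<forall>x \<in> fspace B.
        hproj par q x = x \<longrightarrow> hproj par ((p + q) mod 2) (f x) = f x)"

definition hcomp ::
  "'b set \<Rightarrow> ('b \<Rightarrow> nat) \<Rightarrow> nat \<Rightarrow> (('b \<Rightarrow> complex) \<Rightarrow> 'b \<Rightarrow> complex)
     \<Rightarrow> ('b \<Rightarrow> complex) \<Rightarrow> 'b \<Rightarrow> complex" where
  "hcomp B par p f = (\<lambda>x. if x \<in> fspace B
     then (\<Sum>q\<in>{0, 1}. hproj par ((p + q) mod 2) (f (hproj par q x))) else 0)"

text \<open>
  The bracket \<open>fg - (-1)\<^bsup>|f||g|\<^esup> gf\<close>, extended bilinearly through the homogeneous components.
\<close>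

definition superbracket ::
  "'b set \<Rightarrow> ('b \<Rightarrow> nat) \<Rightarrow> (('b \<Rightarrow> complex) \<Rightarrow> 'b \<Rightarrow> complex)
     \<Rightarrow> (('b \<Rightarrow> complex) \<Rightarrow> 'b \<Rightarrow> complex) \<Rightarrow> ('b \<Rightarrow> complex) \<Rightarrow> 'b \<Rightarrow> complex" where
  "superbracket B par f g = (\<lambda>x. \<Sum>p\<in>{0, 1}. \<Sum>q\<in>{0, 1}.
     hcomp B par p f (hcomp B par q g x)
       - vscale ((-1) ^ (p * q)) (hcomp B par q g (hcomp B par p f x)))"


section \<open>The queer Lie superalgebra\<close>

text \<open>\<open>Pl k\<close> is the index \<open>k\<close> and \<open>Ov k\<close> the overlined index \<open>k\<close>.\<close>

datatype idx = Pl nat | Ov nat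

definition idxs :: "nat \<Rightarrow> idx set" where
  "idxs n = Pl ` {1..n} \<union> Ov ` {1..n}"

fun bar :: "idx \<Rightarrow> idx" where
  "bar (Pl k) = Ov k"
| "bar (Ov k) = Pl k"

fun par :: "idx \<Rightarrow> nat" where
  "par (Pl k) = 0"
| "par (Ov k) = 1"

type_synonym vec = "idx \<Rightarrow> complex"

definition Pop :: "nat \<Rightarrow> vec \<Rightarrow> vec" where
  "Pop n = lin_ext (idxs n) (\<lambda>i. vscale ((-1) ^ (par i + 1)) (bvec (bar i)))"

definition queer :: "nat \<Rightarrow> (vec \<Rightarrow> vec) set" where
  "queer n = {f \<in> endos (idxs n). superbracket (idxs n) par f (Pop n) = 0}"

text \<open>
  Elements of the dual space \<open>W\<close> are functionals on \<open>V\<close>; \<open>w_i\<close> has parity \<open>|i|\<close>.  In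
  \<open>dual_act p q g w\<close>, \<open>p\<close> is the parity of \<open>g\<close> and \<open>q\<close> that of \<open>w\<close>.
\<close>

definition wvec :: "idx \<Rightarrow> vec \<Rightarrow> complex" where
  "wvec i = (\<lambda>v. v i)"

definition dual_act :: "nat \<Rightarrow> nat \<Rightarrow> (vec \<Rightarrow> vec) \<Rightarrow> (vec \<Rightarrow> complex) \<Rightarrow> vec \<Rightarrow> complex" where
  "dual_act p q g w = (\<lambda>v. - ((-1) ^ (p * q)) * w (g v))"


section \<open>The mixed tensor space\<close>

text \<open>
  \<open>V\<^bsup>\<otimes>r\<^esup> \<otimes> W\<^bsup>\<otimes>s\<^esup>\<close> is \<open>fspace (multi n (r + s))\<close>: the basis element \<open>bvec i\<close> stands for
  \<open>v_(i 1) \<otimes> \<dots> \<otimes> v_(i r) \<otimes> w_(i (r + 1)) \<otimes> \<dots> \<otimes> w_(i (r + s))\<close>.  Positions are numbered from \<open>1\<close>.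
\<close>

type_synonym midx = "nat \<Rightarrow> idx"
type_synonym tens = "midx \<Rightarrow> complex"

definition multi :: "nat \<Rightarrow> nat \<Rightarrow> midx set" where
  "multi n m = {1..m} \<rightarrow>\<^sub>E idxs n"

definition mpar :: "nat \<Rightarrow> midx \<Rightarrow> nat" where
  "mpar m i = (\<Sum>l=1..m. par (i l)) mod 2"

text \<open>
  The pure tensor whose \<open>l\<close>-th factor has coordinate vector \<open>x l\<close>, with respect to the \<open>v_i\<close> if
  \<open>l \<le> r\<close> and to the \<open>w_i\<close> if \<open>l > r\<close>.
\<close>

definition pure :: "nat \<Rightarrow> nat \<Rightarrow> (nat \<Rightarrow> vec) \<Rightarrow> tens" where
  "pure n m x = (\<lambda>j. if j \<in> multi n m then \<Prod>l=1..m. x l (j l) else 0)"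

text \<open>
  Coordinates of \<open>g v_i\<close> if \<open>k \<le> r\<close>, and of \<open>g w_i\<close> if \<open>k > r\<close>; the coordinates of a functional
  with respect to the \<open>w_y\<close> are its values on the \<open>v_y\<close>.
\<close>

definition factor_act :: "nat \<Rightarrow> nat \<Rightarrow> (vec \<Rightarrow> vec) \<Rightarrow> nat \<Rightarrow> idx \<Rightarrow> vec" where
  "factor_act r p g k i =
     (if k \<le> r then g (bvec i) else (\<lambda>y. dual_act p (par i) g (wvec i) (bvec y)))"

text \<open>The action of a homogeneous \<open>g\<close> of parity \<open>p\<close>.\<close>

definition rho :: "nat \<Rightarrow> nat \<Rightarrow> nat \<Rightarrow> nat \<Rightarrow> (vec \<Rightarrow> vec) \<Rightarrow> tens \<Rightarrow> tens" where
  "rho n r s p g = lin_ext (multi n (r + s)) (\<lambda>i. \<Sum>k=1..r + s.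
     vscale ((-1) ^ (p * (\<Sum>l=1..<k. par (i l))))
       (pure n (r + s) (\<lambda>l. if l = k then factor_act r p g k (i k) else bvec (i l))))"

definition End_queer :: "nat \<Rightarrow> nat \<Rightarrow> nat \<Rightarrow> (tens \<Rightarrow> tens) set" where
  "End_queer n r s = maps.span {f \<in> endos (multi n (r + s)).
     \<exists>q \<in> {0, 1}. homogeneous (multi n (r + s)) (mpar (r + s)) q f \<and>
       (\<forall>p \<in> {0, 1}. \<forall>g \<in> queer n. homogeneous (idxs n) par p g \<longrightarrow>
          rho n r s p g \<circ> f = mscale ((-1) ^ (p * q)) (f \<circ> rho n r s p g))}"


section \<open>Superdiagrams\<close>

text \<open>
  An edge is one of: \<open>Vert b t\<close> from the bottom vertex \<open>b\<close> to the top vertex \<open>t\<close>; \<open>HBot a c\<close> resp.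
  \<open>HTop a c\<close> on the bottom resp. top row with left vertex \<open>a\<close> and right vertex \<open>c\<close>.
\<close>

datatype vertex = Bot nat | Top nat

datatype edge = Vert nat nat | HBot nat nat | HTop nat nat

fun ends :: "edge \<Rightarrow> vertex set" where
  "ends (Vert b t) = {Bot b, Top t}"
| "ends (HBot a c) = {Bot a, Bot c}"
| "ends (HTop a c) = {Top a, Top c}"

definition vertices :: "nat \<Rightarrow> vertex set" where
  "vertices m = Bot ` {1..m} \<union> Top ` {1..m}"

fun wall_ok :: "nat \<Rightarrow> edge \<Rightarrow> bool" where
  "wall_ok r (Vert b t) \<longleftrightarrow> (b \<le> r \<longleftrightarrow> t \<le> r)"
| "wall_ok r (HBot a c) \<longleftrightarrow> a \<le> r \<and> r < c"
| "wall_ok r (HTop a c) \<longleftrightarrow> a \<le> r \<and> r < c"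

text \<open>A superdiagram is the pair of its set of edges and its set of marked edges.\<close>

type_synonym diagram = "edge set \<times> edge set"

definition superdiagrams :: "nat \<Rightarrow> nat \<Rightarrow> diagram set" where
  "superdiagrams r s = {(E, M).
     (\<forall>e \<in> E. ends e \<subseteq> vertices (r + s) \<and> wall_ok r e) \<and>
     (\<forall>v \<in> vertices (r + s). \<exists>!e. e \<in> E \<and> v \<in> ends e) \<and>
     M \<subseteq> E}"

definition superdiagram_space :: "nat \<Rightarrow> nat \<Rightarrow> (diagram \<Rightarrow> complex) set" where
  "superdiagram_space r s = fspace (superdiagrams r s)"


section \<open>The weight of a labeled diagram\<close>

text \<open>Throughout, \<open>i\<close> labels the bottom row and \<open>j\<close> the top row.\<close>

fun edge_delta :: "midx \<Rightarrow> midx \<Rightarrow> bool \<Rightarrow> edge \<Rightarrow> complex" where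
  "edge_delta i j marked (Vert b t) =
     (if (if marked then bar (i b) else i b) = j t then 1 else 0)"
| "edge_delta i j marked (HBot a c) =
     (if (if marked then bar (i a) else i a) = i c then 1 else 0)"
| "edge_delta i j marked (HTop a c) =
     (if (if marked then bar (j a) else j a) = j c then 1 else 0)"

fun edge_par :: "midx \<Rightarrow> midx \<Rightarrow> edge \<Rightarrow> nat" where
  "edge_par i j (Vert b t) = par (i b)"
| "edge_par i j (HBot a c) = par (i c)"
| "edge_par i j (HTop a c) = par (j c)"

fun is_bottom :: "edge \<Rightarrow> bool" where
  "is_bottom (HBot a c) = True"
| "is_bottom (Vert b t) = False"
| "is_bottom (HTop a c) = False"

text \<open>The left vertex of a horizontal edge, the top vertex of a vertical one.\<close>

fun anchor :: "edge \<Rightarrow> nat" where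
  "anchor (Vert b t) = t"
| "anchor (HBot a c) = a"
| "anchor (HTop a c) = a"

text \<open>
  Position of a vertex on the boundary of the rectangle, read counterclockwise from the bottom left
  corner.  If two edges cross, \<open>interlace\<close> holds in exactly one of the two orders (the first edge is
  the one containing the first of the four end points), so that a product over interlacing ordered
  pairs runs once over every crossing.
\<close>

fun bpos :: "nat \<Rightarrow> vertex \<Rightarrow> nat" where
  "bpos m (Bot k) = k"
| "bpos m (Top k) = 2 * m + 1 - k"

definition interlace :: "nat \<Rightarrow> edge \<Rightarrow> edge \<Rightarrow> bool" where
  "interlace m e e' \<longleftrightarrow> (\<exists>u v u' v'. ends e = {u, v} \<and> ends e' = {u', v'} \<and>
     bpos m u < bpos m u' \<and> bpos m u' < bpos m v \<and> bpos m v < bpos m v')"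

text \<open>
  For the marked bottom edge with the \<open>k\<close>-th smallest left vertex \<open>a_k\<close>, the recursion
  \<open>m(e_1) = |i_1| + \<dots> + |i_(a_1)| + 1\<close>,
  \<open>m(e_k) = m(e_(k-1)) + |i_(a_(k-1) + 1)| + \<dots> + |i_(a_k)| + 1\<close> telescopes to
  \<open>|i_1| + \<dots> + |i_(a_k)| + k\<close>.
\<close>

definition m_bottom :: "midx \<Rightarrow> edge set \<Rightarrow> edge \<Rightarrow> nat" where
  "m_bottom i M e =
     (\<Sum>l=1..anchor e. par (i l)) + card {e' \<in> M. is_bottom e' \<and> anchor e' \<le> anchor e}"

definition m_other :: "nat \<Rightarrow> midx \<Rightarrow> edge \<Rightarrow> nat" where
  "m_other r j e =
     (if anchor e \<le> r then \<Sum>l=1..anchor e. par (j l) else \<Sum>l=1..<anchor e. par (j l))"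

fun wt :: "nat \<Rightarrow> nat \<Rightarrow> diagram \<Rightarrow> midx \<Rightarrow> midx \<Rightarrow> complex" where
  "wt r s (E, M) i j =
     (\<Prod>e\<in>E. edge_delta i j (e \<in> M) e) *
     (\<Prod>e\<in>{e \<in> E. is_bottom e}. (-1) ^ edge_par i j e) *
     (\<Prod>(e, e')\<in>{(e, e'). e \<in> E \<and> e' \<in> E \<and> interlace (r + s) e e'}.
        (-1) ^ (edge_par i j e * edge_par i j e')) *
     (\<Prod>e\<in>{e \<in> M. is_bottom e}. (-1) ^ m_bottom i M e) *
     (\<Prod>e\<in>{e \<in> M. \<not> is_bottom e}. (-1) ^ m_other r j e)"

definition Psi_diagram :: "nat \<Rightarrow> nat \<Rightarrow> nat \<Rightarrow> diagram \<Rightarrow> tens \<Rightarrow> tens" where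
  "Psi_diagram n r s d = lin_ext (multi n (r + s))
     (\<lambda>i. \<Sum>j\<in>multi n (r + s). vscale (wt r s d i j) (bvec j))"

definition Psi :: "nat \<Rightarrow> nat \<Rightarrow> nat \<Rightarrow> (diagram \<Rightarrow> complex) \<Rightarrow> tens \<Rightarrow> tens" where
  "Psi n r s x = (\<Sum>d\<in>superdiagrams r s. mscale (x d) (Psi_diagram n r s d))"

end

theory Submission
  imports Defs "HOL-Combinatorics.Permutations"
begin

text \<open>
  Transposing the tensor factors \<open>r + 1, \<dots>, r + s\<close>, with a sign quadratic in the parities of the
  labels, turns a superdiagram into a marked permutation of \<open>m = r + s\<close> points and an operator
  supercommuting with the queer superalgebra into an operator on the \<open>m\<close>-th tensor power of \<open>V\<close> that
  commutes with it in the ordinary sense.  The weight of a diagram is determined up to a global sign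
  by how it changes when both labels of one edge are barred; crossings and marks account precisely
  for the parities of the labels to the left of the two ends.  Hence the marked permutations act by
  signed permutation matrices \<open>\<Phi>\<^sub>h\<close> that commute with the queer superalgebra and form a group up to
  signs.

  Surjectivity is a double centralizer argument.  If \<open>f\<close> commutes with the queer superalgebra, then it
  commutes with every average \<open>\<Sum>\<^sub>h \<Phi>\<^sub>h X \<Phi>\<^sub>h\<^sup>-\<^sup>1\<close>: by induction on \<open>d\<close>, one places an element
  \<open>E\<^sub>x\<^sub>y + E\<^sub>x\<^sub>'\<^sub>y\<^sub>'\<close> of the superalgebra (primes are bars) in position \<open>d + 1\<close> by acting with it on an \<open>X\<close>
  supported on the first \<open>d\<close> positions.  Contracting these commutation relations with a functional
  \<open>\<phi>\<close> such that \<open>\<Sum>\<^sub>h \<phi>(\<Phi>\<^sub>h) \<Phi>\<^sub>h = 1\<close> expresses \<open>f\<close> as a combination of the \<open>\<Phi>\<^sub>h\<close>.  If \<open>n \<ge> m\<close>, labelling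
  all edges differently isolates a single diagram, whence injectivity.
\<close>

text \<open>Right of the wall the dual action exchanges the roles of input and output, so after
  transposing these factors the supersigns would be read off prefix sums of the wrong labels. The
  correcting sign must change, under a single label change, by the parity of the number of odd
  labels behind the wall; a binomial coefficient \<open>N choose 2\<close> has this increment.
  Composing an odd operator with the parity operator removes the remaining supersign
  \<open>(-1) ^ (p * q)\<close>, and from there on only plain matrices occur.

  The signs of products of the matrices \<Phi> are never computed. Admissibility prescribes how a
  sign changes along single label changes, which fixes it up to a constant, and a constant cancels
  under conjugation. The matrices are real, so positivity of a sum of squares supplies the
  functional \<phi> without any theory of modules. Surjectivity comes from commutation with averaged
  matrix units and not from a dimension count, hence linear dependence of the \<Phi> for small
  \<open>n\<close> causes no trouble.\<close>

lemma minus_one_power_cong: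
  assumes "even (a + b)"
  shows "(-1 :: 'a :: ring_1) ^ a = (-1) ^ b"
  using assms by (simp add: minus_one_power_iff)

section \<open>Bars, parities and multi-indices\<close>

lemma bar_bar [simp]: "bar (bar x) = x"
  by (cases x) auto

lemma bar_eq_iff [simp]: "bar x = bar y \<longleftrightarrow> x = y"
  by (metis bar_bar)

lemma bar_neq [simp]: "bar x \<noteq> x" "x \<noteq> bar x"
  by (cases x; simp)+

lemma even_par_bar [simp]: "even (par (bar x)) \<longleftrightarrow> odd (par x)"
  by (cases x) auto

lemma par_le_1: "par x \<le> 1"
  by (cases x) auto

lemma bar_in_idxs [simp]: "bar x \<in> idxs n \<longleftrightarrow> x \<in> idxs n"
  by (cases x) (auto simp: idxs_def)

lemma finite_idxs [simp]: "finite (idxs n)"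
  by (simp add: idxs_def)

lemma finite_multi [simp]: "finite (multi n m)"
  by (simp add: multi_def finite_PiE)

lemma multi_upd [intro]: "i \<in> multi n m \<Longrightarrow> k \<in> {1..m} \<Longrightarrow> z \<in> idxs n \<Longrightarrow> i(k := z) \<in> multi n m"
  by (auto simp: multi_def PiE_def Pi_def extensional_def)

lemma multi_in: "i \<in> multi n m \<Longrightarrow> k \<in> {1..m} \<Longrightarrow> i k \<in> idxs n"
  by (auto simp: multi_def)

lemma multi_eqI:
  assumes "i \<in> multi n m" "j \<in> multi n m" "\<And>k. k \<in> {1..m} \<Longrightarrow> i k = j k"
  shows "i = j"
  using assms unfolding multi_def by (rule PiE_ext)

text \<open>Orthogonal projection of \<open>c\<close> to the span of the possibly dependent rows
  \<open>G q\<close>, by Gram-Schmidt: the new row is replaced by its component \<open>w\<close>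
  orthogonal to the earlier ones. The scalars are real so that a vector of norm zero
  vanishes.\<close>

lemma orthogonal_projection_exists:
  fixes G :: "'q \<Rightarrow> 'h \<Rightarrow> real"
  assumes "finite Q" "finite H"
  shows "\<exists>\<phi>. \<forall>q\<in>Q. (\<Sum>h\<in>H. G q h * (\<Sum>q'\<in>Q. \<phi> q' * G q' h)) = (\<Sum>h\<in>H. G q h * c h)"
  using assms(1)
proof (induction Q arbitrary: c rule: finite_induct)
  case empty
  then show ?case by simp
next
  case (insert a Q)
  define ip :: "('h \<Rightarrow> real) \<Rightarrow> ('h \<Rightarrow> real) \<Rightarrow> real" where "ip u v = (\<Sum>h\<in>H. u h * v h)" for u v
  have ip_add: "ip u (\<lambda>h. v h + v' h) = ip u v + ip u v'" for u v v'
    by (simp add: ip_def distrib_left sum.distrib)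
  have ip_scale: "ip u (\<lambda>h. x * v h) = x * ip u v" for u v x
    by (simp add: ip_def sum_distrib_left mult_ac)
  have ip_diff: "ip u (\<lambda>h. v h - v' h) = ip u v - ip u v'" for u v v'
    by (simp add: ip_def right_diff_distrib sum_subtractf)
  have ip_sym: "ip u v = ip v u" for u v
    by (simp add: ip_def mult_ac)
  obtain \<phi> where \<phi>: "\<forall>q\<in>Q. ip (G q) (\<lambda>h. \<Sum>q'\<in>Q. \<phi> q' * G q' h) = ip (G q) c"
    using insert.IH[of c] unfolding ip_def by blast
  obtain \<psi> where \<psi>: "\<forall>q\<in>Q. ip (G q) (\<lambda>h. \<Sum>q'\<in>Q. \<psi> q' * G q' h) = ip (G q) (G a)"
    using insert.IH[of "G a"] unfolding ip_def by blast
  define v where "v = (\<lambda>h. \<Sum>q'\<in>Q. \<phi> q' * G q' h)"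
  define u where "u = (\<lambda>h. \<Sum>q'\<in>Q. \<psi> q' * G q' h)"
  define w where "w = (\<lambda>h. G a h - u h)"
  \<comment> \<open>If the new row depends on the others, then \<open>w\<close> vanishes on
    \<open>H\<close> and division by zero gives \<open>x = 0\<close>, which is a correct coefficient
    as well.\<close>
  define x where "x = ip w (\<lambda>h. c h - v h) / ip w w"
  have wq: "ip (G q) w = 0" if "q \<in> Q" for q
    using \<psi> that unfolding w_def u_def by (subst ip_diff) auto
  have vq: "ip (G q) v = ip (G q) c" if "q \<in> Q" for q
    using \<phi> that unfolding v_def by auto
  have u_ip: "ip u y = (\<Sum>q\<in>Q. \<psi> q * ip (G q) y)" for y
    unfolding ip_def u_def sum_distrib_right sum_distrib_left
    by (subst sum.swap) (simp add: mult_ac)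
  have Ga: "ip (G a) y = ip w y + ip u y" for y
    by (simp add: ip_def w_def left_diff_distrib sum_subtractf)
  have uw: "ip u w = 0" and uv: "ip u v = ip u c"
    by (simp_all add: u_ip wq vq)
  have xw: "x * ip w w = ip w c - ip w v"
  proof (cases "ip w w = 0")
    case True
    have "\<forall>h\<in>H. w h * w h = 0"
      using True unfolding ip_def
      by (subst (asm) sum_nonneg_eq_0_iff) (auto simp: assms(2))
    then have "ip w y = 0" for y
      by (auto simp: ip_def intro!: sum.neutral)
    then show ?thesis by simp
  next
    case False
    then show ?thesis by (simp add: x_def ip_diff)
  qed
  define \<chi> where "\<chi> = (\<lambda>q. if q = a then x else \<phi> q - x * \<psi> q)"
  have \<chi>: "(\<Sum>q'\<in>insert a Q. \<chi> q' * G q' h) = v h + x * w h" for h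
  proof -
    have "(\<Sum>q'\<in>Q. \<chi> q' * G q' h) = (\<Sum>q'\<in>Q. \<phi> q' * G q' h - x * (\<psi> q' * G q' h))"
      using insert.hyps by (intro sum.cong) (auto simp: \<chi>_def algebra_simps)
    then show "(\<Sum>q'\<in>insert a Q. \<chi> q' * G q' h) = v h + x * w h"
      using insert.hyps by (simp add: \<chi>_def v_def w_def u_def sum_subtractf sum_distrib_left algebra_simps)
  qed
  have "\<forall>q\<in>insert a Q. ip (G q) (\<lambda>h. v h + x * w h) = ip (G q) c"
    using wq vq uw uv xw by (auto simp: ip_add ip_scale Ga[of v] Ga[of w] Ga[of c])
  then show ?case
    unfolding ip_def by (intro exI[of _ \<chi>]) (simp only: \<chi>)
qed

section \<open>Marked permutations and their signs\<close>

definition pre :: "midx \<Rightarrow> nat \<Rightarrow> nat" where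
  "pre i k = (\<Sum>l=1..<k. par (i l))"

type_synonym mperm = "(nat \<Rightarrow> nat) \<times> nat set"

definition mperms :: "nat \<Rightarrow> mperm set" where
  "mperms m = {\<pi>. \<pi> permutes {1..m}} \<times> Pow {1..m}"

definition mact :: "mperm \<Rightarrow> midx \<Rightarrow> midx" where
  "mact h i = (\<lambda>t. if t \<in> snd h then bar (i (fst h t)) else i (fst h t))"

text \<open>
  \<open>(-1) ^ w i\<close> is the sign that makes \<open>v_i \<mapsto> \<plusminus> v_(h i)\<close> commute with the Jordan-Wigner form of
  every element of the queer superalgebra, one tensor position at a time.
\<close>

definition admissible :: "nat \<Rightarrow> nat \<Rightarrow> mperm \<Rightarrow> (midx \<Rightarrow> nat) \<Rightarrow> bool" where
  "admissible n m h w \<longleftrightarrow> (\<forall>i\<in>multi n m. \<forall>t\<in>{1..m}. \<forall>z\<in>idxs n.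
     even (w (i(fst h t := z)) + w i +
       (par (i (fst h t)) + par z) * (pre i (fst h t) + pre (mact h i) t)))"

text \<open>The permutations compose in reversed order because \<open>mact\<close> pulls labels back
  along \<open>fst h\<close>; two marks met on the same path cancel because \<open>bar\<close> is an
  involution.\<close>

definition mcomp :: "mperm \<Rightarrow> mperm \<Rightarrow> mperm" where
  "mcomp g h = (fst h \<circ> fst g, {t. t \<in> snd g \<longleftrightarrow> fst g t \<notin> snd h})"

lemma mact_mcomp: "mact (mcomp g h) i = mact g (mact h i)"
  by (auto simp: mact_def mcomp_def fun_eq_iff)

lemma finite_mperms [simp]: "finite (mperms m)"
  by (simp add: mperms_def finite_permutations)

lemma mperms_fst: "h \<in> mperms m \<Longrightarrow> fst h permutes {1..m}"
  by (auto simp: mperms_def)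

lemma mperms_snd: "h \<in> mperms m \<Longrightarrow> snd h \<subseteq> {1..m}"
  by (auto simp: mperms_def)

lemma mperms_in: "h \<in> mperms m \<Longrightarrow> fst h t \<in> {1..m} \<longleftrightarrow> t \<in> {1..m}"
  using mperms_fst permutes_in_image by metis

lemma mact_in_multi:
  assumes "h \<in> mperms m" "i \<in> multi n m"
  shows "mact h i \<in> multi n m"
proof -
  have "mact h i t \<in> idxs n" if "t \<in> {1..m}" for t
    using multi_in[OF assms(2), of "fst h t"] mperms_in[OF assms(1), of t] that by (auto simp: mact_def)
  moreover have "mact h i t = undefined" if "t \<notin> {1..m}" for t
  proof -
    have "fst h t \<notin> {1..m}" using mperms_in[OF assms(1), of t] that by auto
    moreover have "t \<notin> snd h" using mperms_snd[OF assms(1)] that by auto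
    ultimately show ?thesis using assms(2) by (auto simp: mact_def multi_def PiE_def extensional_def)
  qed
  ultimately show ?thesis by (auto simp: multi_def PiE_def Pi_def extensional_def)
qed

lemma mact_inj:
  assumes "h \<in> mperms m" "mact h i = mact h j"
  shows "i = j"
proof
  fix k
  obtain t where "k = fst h t"
    using permutes_surj[OF mperms_fst[OF assms(1)]] by (metis surjD)
  then show "i k = j k"
    using fun_cong[OF assms(2), of t] by (auto simp: mact_def split: if_splits)
qed

lemma mact_upd:
  assumes "h \<in> mperms m"
  shows "mact h (i(fst h t := z)) = (mact h i)(t := (if t \<in> snd h then bar z else z))"
  using permutes_inj[OF mperms_fst[OF assms]] by (auto simp: mact_def fun_eq_iff inj_eq)

lemma mcomp_in_mperms:
  assumes "g \<in> mperms m" "h \<in> mperms m"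
  shows "mcomp g h \<in> mperms m"
proof -
  have "fst h \<circ> fst g permutes {1..m}"
    using assms by (intro permutes_compose mperms_fst)
  moreover have "{t. t \<in> snd g \<longleftrightarrow> fst g t \<notin> snd h} \<subseteq> {1..m}"
    using mperms_in[OF assms(1)] mperms_snd[OF assms(1)] mperms_snd[OF assms(2)] by blast
  ultimately show ?thesis by (simp add: mcomp_def mperms_def)
qed

lemma bij_mcomp:
  assumes "g \<in> mperms m"
  shows "bij_betw (mcomp g) (mperms m) (mperms m)"
proof -
  have inj: "inj_on (mcomp g) (mperms m)"
  proof (rule inj_onI)
    fix h h' assume h: "h \<in> mperms m" "h' \<in> mperms m" and eq: "mcomp g h = mcomp g h'"
    have sur: "\<exists>t. k = fst g t" for k
      using permutes_surj[OF mperms_fst[OF assms]] by (metis surjD)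
    have 1: "fst h (fst g t) = fst h' (fst g t)" for t
      using eq by (auto simp: mcomp_def fun_eq_iff)
    have 2: "fst g t \<in> snd h \<longleftrightarrow> fst g t \<in> snd h'" for t
      using eq by (auto simp: mcomp_def set_eq_iff)
    have "fst h k = fst h' k" "k \<in> snd h \<longleftrightarrow> k \<in> snd h'" for k
      using sur[of k] 1 2 by auto
    then show "h = h'" by (intro prod_eqI) (auto simp: fun_eq_iff)
  qed
  moreover have "mcomp g ` mperms m \<subseteq> mperms m"
    using mcomp_in_mperms[OF assms] by auto
  ultimately show ?thesis
    unfolding bij_betw_def using endo_inj_surj[OF finite_mperms] by auto
qed

lemma pre_upd [simp]: "k \<le> t \<Longrightarrow> pre (i(t := z)) k = pre i k"
  unfolding pre_def by (intro sum.cong) auto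

text \<open>Multi-indices that agree off \<open>K\<close> are joined by a chain of single label
  changes inside \<open>multi n m\<close>, so invariance under one change is enough.\<close>

lemma multi_change_invariant:
  assumes "i \<in> multi n m" "j \<in> multi n m" "K \<subseteq> {1..m}" "\<And>k. k \<in> {1..m} - K \<Longrightarrow> i k = j k"
    and inv: "\<And>i k z. i \<in> multi n m \<Longrightarrow> k \<in> K \<Longrightarrow> z \<in> idxs n \<Longrightarrow> P (i(k := z)) = P i"
  shows "P i = P j"
proof -
  have "finite K" using assms(3) finite_subset by blast
  then have "\<And>i. i \<in> multi n m \<Longrightarrow> (\<And>k. k \<in> {1..m} - K \<Longrightarrow> i k = j k) \<Longrightarrow> P i = P j"
    using assms(3) inv
  proof (induction K rule: finite_induct)
    case empty
    then have "i = j" using assms(2) by (intro multi_eqI) auto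
    then show ?case by simp
  next
    case (insert a K)
    have a: "a \<in> {1..m}" and K: "K \<subseteq> {1..m}" using insert.prems by auto
    have ja: "j a \<in> idxs n" using multi_in[OF assms(2) a] .
    have "P (i(a := j a)) = P j"
    proof (rule insert.IH)
      show "i(a := j a) \<in> multi n m" using insert.prems(1) a ja by auto
      show "(i(a := j a)) k = j k" if "k \<in> {1..m} - K" for k
        using insert.prems(2)[of k] that by auto
    qed (use insert.prems(4) K in auto)
    moreover have "P (i(a := j a)) = P i"
      using insert.prems(4)[OF insert.prems(1) insertI1 ja] by (simp only:)
    ultimately show ?case by simp
  qed
  then show ?thesis using assms by blast
qed

text \<open>A label change travels through \<open>h\<close> and then through \<open>g\<close>. The
  prefix sum at the intermediate vertex enters both increments and cancels modulo 2, leaving those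
  at the two outer ends.\<close>

lemma admissible_mcomp:
  assumes g: "g \<in> mperms m" "admissible n m g v" and h: "h \<in> mperms m" "admissible n m h w"
  shows "admissible n m (mcomp g h) (\<lambda>i. w i + v (mact h i))"
  unfolding admissible_def
proof (intro ballI)
  fix i t z assume i: "i \<in> multi n m" and t: "t \<in> {1..m}" and z: "z \<in> idxs n"
  define b where "b = fst h (fst g t)"
  define z' where "z' = (if fst g t \<in> snd h then bar z else z)"
  have gt: "fst g t \<in> {1..m}" using mperms_in[OF g(1)] t by auto
  have z': "z' \<in> idxs n" using z by (simp add: z'_def)
  have 1: "even (w (i(b := z)) + w i + (par (i b) + par z) * (pre i b + pre (mact h i) (fst g t)))"
    using h(2) i gt z unfolding admissible_def b_def by blast
  have 2: "even (v ((mact h i)(fst g t := z')) + v (mact h i) +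
      (par (mact h i (fst g t)) + par z') * (pre (mact h i) (fst g t) + pre (mact g (mact h i)) t))"
    using g(2) mact_in_multi[OF h(1) i] t z' unfolding admissible_def by blast
  have 3: "mact h (i(b := z)) = (mact h i)(fst g t := z')"
    unfolding b_def z'_def by (rule mact_upd[OF h(1)])
  have 4: "even (par (mact h i (fst g t)) + par z') \<longleftrightarrow> even (par (i b) + par z)"
    by (auto simp: mact_def z'_def b_def)
  have 5: "fst (mcomp g h) t = b" by (simp add: mcomp_def b_def)
  \<comment> \<open>Here and below, \<open>even_add\<close> and \<open>even_mult_iff\<close> turn a
    congruence modulo 2 into a propositional formula in the parities of its atoms, which
    \<open>argo\<close> decides.\<close>
  show "even (w (i(fst (mcomp g h) t := z)) + v (mact h (i(fst (mcomp g h) t := z))) + (w i + v (mact h i)) +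
        (par (i (fst (mcomp g h) t)) + par z) * (pre i (fst (mcomp g h) t) + pre (mact (mcomp g h) i) t))"
    unfolding mact_mcomp 5 3 using 1 2 4
    by (simp only: even_add even_mult_iff) argo
qed

text \<open>Both exponents have the same increment along every single label change, so their
  difference is constant modulo 2: admissible signs are unique up to one global sign.\<close>

lemma admissible_unique:
  assumes h: "h \<in> mperms m" and "admissible n m h v" "admissible n m h w"
    and "i \<in> multi n m" "j \<in> multi n m"
  shows "even (v i + w i) \<longleftrightarrow> even (v j + w j)"
proof (rule multi_change_invariant[where K = "{1..m}" and P = "\<lambda>i. even (v i + w i)" and n = n and m = m])
  fix i k z assume i: "i \<in> multi n m" and k: "k \<in> {1..m}" and z: "z \<in> idxs n"
  obtain t where t: "k = fst h t"
    using permutes_surj[OF mperms_fst[OF h]] by (metis surjD)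
  then have "t \<in> {1..m}" using k mperms_in[OF h] by auto
  then have "even (v (i(k := z)) + v i + (par (i k) + par z) * (pre i k + pre (mact h i) t))"
    "even (w (i(k := z)) + w i + (par (i k) + par z) * (pre i k + pre (mact h i) t))"
    using assms(2,3) i z unfolding admissible_def t by blast+
  then show "even (v (i(k := z)) + w (i(k := z))) = even (v i + w i)"
    by (simp only: even_add) argo
qed (use assms in auto)

text \<open>On the first \<open>d\<close> positions the prefix sums before and after
  \<open>h\<close> coincide, so the increment is even. A mark at \<open>d\<close> itself is allowed
  because \<open>pre\<close> looks strictly to the left; this case is used for barring the last
  position of a matrix unit.\<close>

lemma admissible_fixing:
  assumes h: "h \<in> mperms m" "admissible n m h w"
    and fx: "\<And>k. k \<in> {1..d} \<Longrightarrow> fst h k = k" "\<And>k. k \<in> {1..<d} \<Longrightarrow> k \<notin> snd h" and d: "d \<le> m"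
    and "i \<in> multi n m" "j \<in> multi n m" and ij: "\<And>k. k \<in> {1..m} - {1..d} \<Longrightarrow> i k = j k"
  shows "even (w i) \<longleftrightarrow> even (w j)"
proof (rule multi_change_invariant[where K = "{1..d}" and P = "\<lambda>i. even (w i)" and n = n and m = m])
  fix i k z assume i: "i \<in> multi n m" and k: "k \<in> {1..d}" and z: "z \<in> idxs n"
  have "pre (mact h i) k = pre i k"
    unfolding pre_def by (intro sum.cong) (use k fx in \<open>auto simp: mact_def\<close>)
  moreover have "even (w (i(k := z)) + w i + (par (i k) + par z) * (pre i k + pre (mact h i) k))"
    using h(2)[unfolded admissible_def, rule_format, of i k z] i k z d fx(1)[of k] by simp
  ultimately show "even (w (i(k := z))) = even (w i)" by simp
qed (use assms in auto)

section \<open>The sign of a labeled diagram\<close>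

lemma even_sum_change:
  fixes f g :: "'a \<Rightarrow> nat"
  assumes "finite A" "odd (f a + g a)" "\<And>t. t \<in> A \<Longrightarrow> t \<noteq> a \<Longrightarrow> g t = f t"
  shows "even (sum g A) \<longleftrightarrow> (even (sum f A) \<longleftrightarrow> a \<notin> A)"
proof (cases "a \<in> A")
  case True
  have "sum g (A - {a}) = sum f (A - {a})" using assms(3) by (intro sum.cong) auto
  then show ?thesis using assms(1,2) True by (simp add: sum.remove[of A a])
next
  case False
  then have "sum g A = sum f A" using assms(3) by (intro sum.cong) auto
  then show ?thesis using False by simp
qed

text \<open>
  Vertices are renamed by a partial transposition: \<open>b\<close> stands for the bottom vertex \<open>b\<close> if \<open>b \<le> r\<close> and
  for the top vertex \<open>b\<close> if \<open>b > r\<close>, and \<open>t\<close> for the opposite vertex.  Every edge of a diagram then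
  joins some \<open>b\<close> to some \<open>t\<close>, so that diagrams become marked permutations.
\<close>

definition merge :: "nat \<Rightarrow> midx \<Rightarrow> midx \<Rightarrow> midx" where
  "merge r i j = (\<lambda>k. if k \<le> r then i k else j k)"

definition medge :: "nat \<Rightarrow> nat \<Rightarrow> nat \<Rightarrow> edge" where
  "medge r b t = (if b \<le> r then if t \<le> r then Vert b t else HBot b t
     else if t \<le> r then HTop t b else Vert t b)"

definition pos_b :: "nat \<Rightarrow> nat \<Rightarrow> nat \<Rightarrow> nat" where
  "pos_b r m b = (if b \<le> r then b else 2 * m + 1 - b)"

definition pos_t :: "nat \<Rightarrow> nat \<Rightarrow> nat \<Rightarrow> nat" where
  "pos_t r m t = (if t \<le> r then 2 * m + 1 - t else t)"

definition crossing :: "nat \<Rightarrow> nat \<Rightarrow> (nat \<Rightarrow> nat) \<Rightarrow> nat \<Rightarrow> nat \<Rightarrow> bool" where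
  "crossing r m \<pi> t t' \<longleftrightarrow> interlace m (medge r (\<pi> t) t) (medge r (\<pi> t') t')"

lemma ends_medge:
  "\<exists>u v. ends (medge r b t) = {u, v} \<and> bpos m u = pos_b r m b \<and> bpos m v = pos_t r m t"
proof -
  have "ends (medge r b t) = {if b \<le> r then Bot b else Top b, if t \<le> r then Top t else Bot t}"
    by (auto simp: medge_def)
  moreover have "bpos m (if b \<le> r then Bot b else Top b) = pos_b r m b"
    "bpos m (if t \<le> r then Top t else Bot t) = pos_t r m t"
    by (auto simp: pos_b_def pos_t_def)
  ultimately show ?thesis by blast
qed

text \<open>Each edge may be entered from either of its ends, whence four alternatives.\<close>

lemma interlace_medge:
  fixes r m b t b' t' :: nat
  defines "p \<equiv> pos_b r m b" and "q \<equiv> pos_t r m t" and "p' \<equiv> pos_b r m b'" and "q' \<equiv> pos_t r m t'"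
  shows "interlace m (medge r b t) (medge r b' t') \<longleftrightarrow>
    p < p' \<and> p' < q \<and> q < q' \<or> p < q' \<and> q' < q \<and> q < p' \<or>
    q < p' \<and> p' < p \<and> p < q' \<or> q < q' \<and> q' < p \<and> p < p'"
proof -
  obtain u v where u: "ends (medge r b t) = {u, v}" "bpos m u = p" "bpos m v = q"
    using ends_medge unfolding p_def q_def by metis
  obtain u' v' where u': "ends (medge r b' t') = {u', v'}" "bpos m u' = p'" "bpos m v' = q'"
    using ends_medge unfolding p'_def q'_def by metis
  show ?thesis
    unfolding interlace_def u(1) u'(1) doubleton_eq_iff u(2,3)[symmetric] u'(2,3)[symmetric]
    by (rule iffI, (elim exE conjE disjE; simp), blast)
qed

text \<open>The label that carries the parity of an edge is the bottom one of a vertical and the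
  right one of a horizontal edge; after the renaming only the side of \<open>t\<close> decides which
  end this is.\<close>

definition medge_par :: "nat \<Rightarrow> (nat \<Rightarrow> nat) \<Rightarrow> (nat \<Rightarrow> nat) \<Rightarrow> (nat \<Rightarrow> nat) \<Rightarrow> nat \<Rightarrow> nat" where
  "medge_par r \<pi> X Y t = (if t \<le> r then X (\<pi> t) else Y t)"

text \<open>The cases are: left vertical or top horizontal edges; bottom horizontal edges; right
  vertical edges. In the last case the prefix runs along the top row through the wall, where the top
  labels change from \<open>Y\<close> to \<open>X\<close>, and it excludes the anchor.\<close>

definition mark_exp :: "nat \<Rightarrow> (nat \<Rightarrow> nat) \<Rightarrow> (nat \<Rightarrow> nat) \<Rightarrow> (nat \<Rightarrow> nat) \<Rightarrow> nat \<Rightarrow> nat" where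
  "mark_exp r \<pi> X Y t = (if t \<le> r then \<Sum>l=1..t. Y l
     else if \<pi> t \<le> r then \<Sum>l=1..\<pi> t. X l
     else (\<Sum>l=1..r. Y l) + (\<Sum>l=Suc r..<\<pi> t. X l))"

text \<open>
  The exponent of \<open>-1\<close> in the weight, up to a summand independent of the labels, in terms of the
  parities \<open>X\<close>, \<open>Y\<close> of the labels of the renamed vertices.
\<close>

definition wt_exp :: "nat \<Rightarrow> nat \<Rightarrow> (nat \<Rightarrow> nat) \<Rightarrow> nat set \<Rightarrow> (nat \<Rightarrow> nat) \<Rightarrow> (nat \<Rightarrow> nat) \<Rightarrow> nat" where
  "wt_exp r m \<pi> \<mu> X Y =
     (\<Sum>t=1..m. of_bool (\<pi> t \<le> r \<and> r < t) * medge_par r \<pi> X Y t) +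
     (\<Sum>t=1..m. \<Sum>t'=1..m. of_bool (crossing r m \<pi> t t') * (medge_par r \<pi> X Y t * medge_par r \<pi> X Y t')) +
     (\<Sum>t=1..m. of_bool (t \<in> \<mu>) * mark_exp r \<pi> X Y t)"

definition tail_sum :: "nat \<Rightarrow> nat \<Rightarrow> (nat \<Rightarrow> nat) \<Rightarrow> nat" where
  "tail_sum r m X = (\<Sum>l=Suc r..m. X l)"

text \<open>
  \<open>twist_exp\<close> is the exponent of the sign by which the partial transposition intertwines the
  two actions.
\<close>

definition twist_exp :: "nat \<Rightarrow> nat \<Rightarrow> (nat \<Rightarrow> nat) \<Rightarrow> (nat \<Rightarrow> nat) \<Rightarrow> nat" where
  "twist_exp r m X Y = (tail_sum r m X + tail_sum r m Y choose 2) + tail_sum r m Y"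

text \<open>The increment of a quadratic form modulo 2 in one variable is the sum of the variables
  coupled to it. The assumptions on \<open>C\<close> say that every crossing is counted in one order
  only and that no edge crosses itself.\<close>

lemma even_quadratic_change:
  fixes P Q :: "'a \<Rightarrow> nat"
  assumes "finite S" "a \<in> S" "odd (P a + Q a)" "\<And>t. t \<in> S \<Longrightarrow> t \<noteq> a \<Longrightarrow> Q t = P t"
    and C: "\<not> C a a" "\<And>t. \<not> (C a t \<and> C t a)"
  shows "even ((\<Sum>t\<in>S. \<Sum>t'\<in>S. of_bool (C t t') * (Q t * Q t')) +
    (\<Sum>t\<in>S. \<Sum>t'\<in>S. of_bool (C t t') * (P t * P t')) +
    (\<Sum>t\<in>S. of_bool (t \<noteq> a \<and> (C a t \<or> C t a)) * P t))"
proof -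
  define T where "T = S - {a}"
  have S: "S = insert a T" "finite T" "a \<notin> T" using assms(1,2) by (auto simp: T_def)
  have QP: "Q t = P t" if "t \<in> T" for t using assms(4) that by (auto simp: T_def)
  define R where "R = (\<Sum>t\<in>T. of_bool (C a t \<or> C t a) * P t)"
  define B where "B = (\<Sum>t\<in>T. \<Sum>t'\<in>T. of_bool (C t t') * (P t * P t'))"
  have split: "(\<Sum>t\<in>S. \<Sum>t'\<in>S. of_bool (C t t') * (Z t * Z t')) = B + Z a * R"
    if Z: "\<And>t. t \<in> T \<Longrightarrow> Z t = P t" for Z :: "'a \<Rightarrow> nat"
  proof -
    have "(\<Sum>t\<in>S. \<Sum>t'\<in>S. of_bool (C t t') * (Z t * Z t')) =
        (\<Sum>t'\<in>T. of_bool (C a t') * (Z a * Z t')) +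
        (\<Sum>t\<in>T. of_bool (C t a) * (Z t * Z a) + (\<Sum>t'\<in>T. of_bool (C t t') * (Z t * Z t')))"
      using S C(1) by (simp del: sum_of_bool_mult_eq sum_mult_of_bool_eq)
    also have "\<dots> = B + ((\<Sum>t\<in>T. of_bool (C a t) * (Z a * P t)) + (\<Sum>t\<in>T. of_bool (C t a) * (P t * Z a)))"
      by (simp add: sum.distrib B_def Z cong: sum.cong)
    also have "(\<Sum>t\<in>T. of_bool (C a t) * (Z a * P t)) + (\<Sum>t\<in>T. of_bool (C t a) * (P t * Z a)) = Z a * R"
      unfolding R_def sum_distrib_left sum.distrib[symmetric]
      using C(2) by (intro sum.cong) (auto simp: of_bool_def)
    finally show ?thesis .
  qed
  have "(\<Sum>t\<in>S. of_bool (t \<noteq> a \<and> (C a t \<or> C t a)) * P t) = R"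
    unfolding R_def S(1) using S(2,3) by (auto intro!: sum.cong simp: of_bool_def)
  then show ?thesis using assms(3) by (auto simp: split QP)
qed

section \<open>Increments of the twist, of the crossings and of the mark exponents\<close>

lemma choose_two_Suc: "Suc N choose 2 = (N choose 2) + N"
  by (simp add: numeral_2_eq_2)

lemma tail_sum_change:
  assumes "k \<in> {1..m}" "X k \<le> 1" "X' k \<le> 1" "odd (X k + X' k)" "\<And>l. l \<noteq> k \<Longrightarrow> X' l = X l" "r < k"
  shows "tail_sum r m X' + X k = tail_sum r m X + X' k"
proof -
  have k: "k \<in> {Suc r..m}" using assms by auto
  have "(\<Sum>l\<in>{Suc r..m} - {k}. X' l) = (\<Sum>l\<in>{Suc r..m} - {k}. X l)"
    using assms(5) by (intro sum.cong) auto
  then show ?thesis unfolding tail_sum_def using sum.remove[OF _ k, of X] sum.remove[OF _ k, of X'] by simp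
qed

lemma tail_sum_same:
  assumes "\<And>l. l \<noteq> k \<Longrightarrow> X' l = X l" "k \<le> r"
  shows "tail_sum r m X' = tail_sum r m X"
  unfolding tail_sum_def using assms by (intro sum.cong) auto

text \<open>With \<open>N\<close> odd labels behind the wall, \<open>N choose 2\<close> grows by
  \<open>N\<close> when one more label becomes odd and drops by \<open>N - 1\<close> when one
  becomes even; the summand \<open>X k\<close> distinguishes the two cases.\<close>

lemma twist_exp_change_fst:
  assumes k: "k \<in> {1..m}" "r < k" "X k \<le> 1" "X' k \<le> 1" "odd (X k + X' k)" "\<And>l. l \<noteq> k \<Longrightarrow> X' l = X l"
  shows "even (twist_exp r m X' Y + twist_exp r m X Y + X k + tail_sum r m X + tail_sum r m Y)"
proof -
  have 1: "tail_sum r m X' + X k = tail_sum r m X + X' k"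
    using tail_sum_change[of k m X X' r] k by blast
  have "X k = 0 \<and> X' k = 1 \<or> X k = 1 \<and> X' k = 0" using k by presburger
  then show ?thesis
  proof
    assume "X k = 0 \<and> X' k = 1"
    then show ?thesis using 1 by (simp add: twist_exp_def choose_two_Suc) argo
  next
    assume a: "X k = 1 \<and> X' k = 0"
    then have "tail_sum r m X = Suc (tail_sum r m X')" using 1 by simp
    then show ?thesis using a by (simp add: twist_exp_def choose_two_Suc) argo
  qed
qed

text \<open>The extra 1, compared with a change in \<open>X\<close>, comes from the linear summand
  \<open>tail_sum r m Y\<close> of the twist.\<close>

lemma twist_exp_change_snd:
  assumes k: "k \<in> {1..m}" "r < k" "Y k \<le> 1" "Y' k \<le> 1" "odd (Y k + Y' k)" "\<And>l. l \<noteq> k \<Longrightarrow> Y' l = Y l"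
  shows "even (twist_exp r m X Y' + twist_exp r m X Y + Y k + tail_sum r m X + tail_sum r m Y + 1)"
proof -
  have 1: "tail_sum r m Y' + Y k = tail_sum r m Y + Y' k"
    using tail_sum_change[of k m Y Y' r] k by blast
  have "Y k = 0 \<and> Y' k = 1 \<or> Y k = 1 \<and> Y' k = 0" using k by presburger
  then show ?thesis
  proof
    assume "Y k = 0 \<and> Y' k = 1"
    then show ?thesis using 1 by (simp add: twist_exp_def choose_two_Suc) argo
  next
    assume a: "Y k = 1 \<and> Y' k = 0"
    then have "tail_sum r m Y = Suc (tail_sum r m Y')" using 1 by simp
    then show ?thesis using a by (simp add: twist_exp_def choose_two_Suc) argo
  qed
qed

text \<open>There are sixteen combinations of edge types. In each of them interlacing on the
  boundary reduces to comparing \<open>b\<close> with \<open>b0\<close> and \<open>t\<close> with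
  \<open>t0\<close>.\<close>

lemma crossing_medge_iff:
  fixes r m b t b0 t0 :: nat
  assumes "b \<in> {1..m}" "t \<in> {1..m}" "b0 \<in> {1..m}" "t0 \<in> {1..m}" "b \<noteq> b0" "t \<noteq> t0"
  shows "interlace m (medge r b0 t0) (medge r b t) \<or> interlace m (medge r b t) (medge r b0 t0) \<longleftrightarrow>
    (if b0 \<le> r then
       if t0 \<le> r then
         if b \<le> r then if t \<le> r then b < b0 \<longleftrightarrow> t0 < t else b < b0
         else t \<le> r \<and> t < t0
       else
         if b \<le> r then if t \<le> r then b0 < b else b < b0 \<longleftrightarrow> t < t0
         else r < t \<and> t < t0
     else
       if t0 \<le> r then
         if b \<le> r then t \<le> r \<and> t0 < t
         else if t \<le> r then b < b0 \<longleftrightarrow> t < t0 else b < b0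
       else
         if b \<le> r then r < t \<and> t0 < t
         else if t \<le> r then b0 < b else b < b0 \<longleftrightarrow> t0 < t)"
proof -
  have m: "b \<le> m" "t \<le> m" "b0 \<le> m" "t0 \<le> m" using assms by auto
  \<comment> \<open>The truncated subtraction is harmless because all vertices are at most
    \<open>m\<close>; top vertices come after all bottom ones and in reversed order.\<close>
  have 1: "k < 2 * m + 1 - l" "\<not> 2 * m + 1 - l < k" "2 * m + 1 - k < 2 * m + 1 - l \<longleftrightarrow> l < k"
    if "k \<le> m" "l \<le> m" for k l
    using that by linarith+
  have ne: "b < b0 \<or> b0 < b" "t < t0 \<or> t0 < t" using assms(5,6) by auto
  show ?thesis
    unfolding interlace_medge pos_b_def pos_t_def
    by (cases "b0 \<le> r"; cases "t0 \<le> r"; cases "b \<le> r"; cases "t \<le> r";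
        simp only: if_True if_False 1 m simp_thms; use ne in auto)
qed

text \<open>The local heart of the sign computation. When both labels of the edge
  \<open>(b0, t0)\<close> flip parity, another edge \<open>(b, t)\<close> contributes to the total
  exponent through their crossing, through its own mark exponent, through the factor counting all
  marks, and through the tails in the twist. Together this equals its share in the two prefix sums
  at \<open>b0\<close> and \<open>t0\<close>.\<close>

lemma crossing_pair_parity:
  fixes r m b t b0 t0 :: nat
  assumes "b \<in> {1..m}" "t \<in> {1..m}" "b0 \<in> {1..m}" "t0 \<in> {1..m}" "b \<noteq> b0" "t \<noteq> t0"
    and y: "even y \<longleftrightarrow> (even x \<longleftrightarrow> \<not> mk)"
  shows "even (of_bool (interlace m (medge r b0 t0) (medge r b t) \<or> interlace m (medge r b t) (medge r b0 t0))
        * (if t \<le> r then x else y)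
    + of_bool mk * (if t \<le> r then of_bool (t0 \<le> t)
        else if b \<le> r then of_bool (b0 \<le> b) else of_bool (t0 \<le> r) + of_bool (r < b0 \<and> b0 < b))
    + of_bool mk + of_bool (b < b0) * x + of_bool (t < t0) * y
    + (of_bool (r < b0) + of_bool (r < t0)) * (of_bool (r < b) * x + of_bool (r < t) * y) :: nat)"
  unfolding crossing_medge_iff[OF assms(1-6)] using assms(5,6) y
  by (cases "b0 \<le> r"; cases "t0 \<le> r"; cases "b \<le> r"; cases "t \<le> r"; cases "b < b0"; cases "t < t0"; cases mk)
    (auto simp: not_le not_less)

lemma not_crossing_both: "\<not> (crossing r m \<pi> t t' \<and> crossing r m \<pi> t' t)"
  unfolding crossing_def interlace_medge by (auto; linarith)

lemma not_crossing_self: "\<not> crossing r m \<pi> t t"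
  using not_crossing_both by blast

lemma mark_exp_change:
  assumes b0: "b0 \<in> {1..m}" and t0: "t0 \<in> {1..m}"
    and X: "odd (X b0 + X' b0)" "\<And>l. l \<noteq> b0 \<Longrightarrow> X' l = X l"
    and Y: "odd (Y t0 + Y' t0)" "\<And>l. l \<noteq> t0 \<Longrightarrow> Y' l = Y l"
  shows "even (mark_exp r \<pi> X' Y' t + mark_exp r \<pi> X Y t +
    (if t \<le> r then of_bool (t0 \<le> t)
     else if \<pi> t \<le> r then of_bool (b0 \<le> \<pi> t) else of_bool (t0 \<le> r) + of_bool (r < b0 \<and> b0 < \<pi> t)))"
proof -
  have X': "even (sum X' A) \<longleftrightarrow> (even (sum X A) \<longleftrightarrow> b0 \<notin> A)" if "finite A" for A
    by (rule even_sum_change) (use that X in auto)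
  have Y': "even (sum Y' A) \<longleftrightarrow> (even (sum Y A) \<longleftrightarrow> t0 \<notin> A)" if "finite A" for A
    by (rule even_sum_change) (use that Y in auto)
  have "Suc 0 \<le> b0" "Suc 0 \<le> t0" using b0 t0 by auto
  then show ?thesis
    unfolding mark_exp_def by (auto simp: X' Y' Suc_le_eq)
qed

text \<open>The labels are flipped one after the other, \<open>X\<close> before \<open>Y\<close>.
  The second increment sees a tail already altered by the first, which accounts for
  \<open>of_bool (r < b0)\<close> in the last summand.\<close>

lemma twist_exp_change:
  fixes r m :: nat and X Y :: "nat \<Rightarrow> nat"
  assumes b0: "b0 \<in> {1..m}" and t0: "t0 \<in> {1..m}"
    and X: "X b0 \<le> 1" "X' b0 \<le> 1" "odd (X b0 + X' b0)" "\<And>l. l \<noteq> b0 \<Longrightarrow> X' l = X l"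
    and Y: "Y t0 \<le> 1" "Y' t0 \<le> 1" "odd (Y t0 + Y' t0)" "\<And>l. l \<noteq> t0 \<Longrightarrow> Y' l = Y l"
  defines "N \<equiv> tail_sum r m X + tail_sum r m Y"
  shows "even (twist_exp r m X' Y' + twist_exp r m X Y + of_bool (r < b0) * (X b0 + N) +
    of_bool (r < t0) * (Y t0 + N + of_bool (r < b0) + 1))"
proof -
  have 1: "even (twist_exp r m X' Y + twist_exp r m X Y + of_bool (r < b0) * (X b0 + N))"
  proof (cases "r < b0")
    case True
    then show ?thesis
      using twist_exp_change_fst[of b0 m r X X' Y] b0 X by (simp add: N_def add.assoc)
  next
    case False
    then show ?thesis using tail_sum_same[of b0 X' X r m] X(4) by (simp add: twist_exp_def)
  qed
  have tX: "even (tail_sum r m X') \<longleftrightarrow> (even (tail_sum r m X) \<longleftrightarrow> \<not> r < b0)"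
    unfolding tail_sum_def
    by (subst even_sum_change[of _ X b0 X']) (use X b0 in \<open>auto simp: Suc_le_eq\<close>)
  have 2: "even (twist_exp r m X' Y' + twist_exp r m X' Y + of_bool (r < t0) * (Y t0 + N + of_bool (r < b0) + 1))"
  proof (cases "r < t0")
    case True
    then show ?thesis
      using twist_exp_change_snd[of t0 m r Y Y' X'] t0 Y tX
      by (simp only: N_def of_bool_eq mult_1 even_add even_mult_iff odd_one) (auto simp: of_bool_def)
  next
    case False
    then show ?thesis using tail_sum_same[of t0 Y' Y r m] Y(4) by (simp add: twist_exp_def)
  qed
  show ?thesis using 1 2 by (simp only: even_add) argo
qed

text \<open>All increments are rewritten as sums over the edges and compared edge by edge:
  \<open>crossing_pair_parity\<close> settles every edge except the flipped one, whose terms are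
  checked directly. The summand with \<open>card \<mu>\<close> reflects the parity operator attached
  to an odd diagram.\<close>

lemma total_exp_change:
  fixes r m :: nat
  assumes \<pi>: "\<pi> permutes {1..m}" and \<mu>: "\<mu> \<subseteq> {1..m}" and t0: "t0 \<in> {1..m}" and b0: "b0 = \<pi> t0"
    and X: "X b0 \<le> 1" "X' b0 \<le> 1" "odd (X b0 + X' b0)" "\<And>l. l \<noteq> b0 \<Longrightarrow> X' l = X l"
    and Y: "Y t0 \<le> 1" "Y' t0 \<le> 1" "odd (Y t0 + Y' t0)" "\<And>l. l \<noteq> t0 \<Longrightarrow> Y' l = Y l"
    and XY: "\<And>t. t \<in> {1..m} \<Longrightarrow> even (Y t) \<longleftrightarrow> (even (X (\<pi> t)) \<longleftrightarrow> t \<notin> \<mu>)"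
  shows "even (wt_exp r m \<pi> \<mu> X' Y' + wt_exp r m \<pi> \<mu> X Y + (twist_exp r m X' Y' + twist_exp r m X Y) +
    card \<mu> * ((\<Sum>l=1..m. X' l) + (\<Sum>l=1..m. X l)) + ((\<Sum>l=1..<b0. X l) + (\<Sum>l=1..<t0. Y l)))"
proof -
  let ?S = "{1..m}"
  define P where "P = medge_par r \<pi> X Y"
  define P' where "P' = medge_par r \<pi> X' Y'"
  define bot where "bot = (\<lambda>t. \<pi> t \<le> r \<and> r < t)"
  define dm where "dm = (\<lambda>t. if t \<le> r then of_bool (t0 \<le> t)
     else if \<pi> t \<le> r then of_bool (b0 \<le> \<pi> t) else of_bool (t0 \<le> r) + of_bool (r < b0 \<and> b0 < \<pi> t) :: nat)"
  define cr where "cr = (\<lambda>t. t \<noteq> t0 \<and> (crossing r m \<pi> t0 t \<or> crossing r m \<pi> t t0))"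
  define N where "N = tail_sum r m X + tail_sum r m Y"
  have even_of_bool: "even (of_bool Q :: nat) \<longleftrightarrow> \<not> Q" for Q by simp
  have b0S: "b0 \<in> ?S" unfolding b0 using permutes_in_image[OF \<pi>] t0 by blast
  have \<pi>ne: "\<pi> t \<noteq> b0" if "t \<noteq> t0" for t
    using that permutes_inj[OF \<pi>] by (auto simp: b0 inj_eq)
  have \<pi>S: "\<pi> t \<in> ?S" if "t \<in> ?S" for t
    using that permutes_in_image[OF \<pi>] by blast
  have PP: "P' t = P t" if "t \<noteq> t0" for t
    using X(4) Y(4) \<pi>ne that by (simp add: P_def P'_def medge_par_def)
  have Podd: "odd (P t0 + P' t0)"
    using X(3) Y(3) by (simp add: P_def P'_def medge_par_def b0)
  \<comment> \<open>Every edge has exactly one end on either side of the renaming, so a sum over the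
    ends \<open>\<pi> t\<close> is a sum over edges.\<close>
  have permS: "(\<Sum>t\<in>?S. f (\<pi> t)) = (\<Sum>l\<in>?S. f l)" for f :: "nat \<Rightarrow> nat"
    using sum.permute[OF \<pi>, of f] by (simp add: o_def)
  have "even ((\<Sum>t\<in>?S. of_bool (bot t) * P' t) + (\<Sum>t\<in>?S. of_bool (bot t) * P t) + of_bool (bot t0))"
  proof (cases "bot t0")
    case True
    have "even (\<Sum>t\<in>?S. of_bool (bot t) * P' t) \<longleftrightarrow> (even (\<Sum>t\<in>?S. of_bool (bot t) * P t) \<longleftrightarrow> t0 \<notin> ?S)"
      by (rule even_sum_change) (use True Podd PP in auto)
    then show ?thesis using True t0 by (auto simp del: sum_of_bool_mult_eq sum_mult_of_bool_eq)
  next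
    case False
    have "(\<Sum>t\<in>?S. of_bool (bot t) * P' t) = (\<Sum>t\<in>?S. of_bool (bot t) * P t)"
      using PP False by (intro sum.cong refl) (metis mult_zero_left of_bool_eq(1))
    then show ?thesis using False by (simp del: sum_of_bool_mult_eq sum_mult_of_bool_eq)
  qed
  note d1 = this
  have d2: "even ((\<Sum>t\<in>?S. \<Sum>t'\<in>?S. of_bool (crossing r m \<pi> t t') * (P' t * P' t')) +
    (\<Sum>t\<in>?S. \<Sum>t'\<in>?S. of_bool (crossing r m \<pi> t t') * (P t * P t')) + (\<Sum>t\<in>?S. of_bool (cr t) * P t))"
    unfolding cr_def
    by (rule even_quadratic_change) (use t0 Podd PP not_crossing_self not_crossing_both in auto)
  have "even (\<Sum>t\<in>?S. of_bool (t \<in> \<mu>) * (mark_exp r \<pi> X' Y' t + mark_exp r \<pi> X Y t + dm t))"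
    unfolding dm_def
    by (intro dvd_sum dvd_mult mark_exp_change[of b0 m t0 X X' Y Y']) (use b0S t0 X Y in auto)
  then have d3: "even ((\<Sum>t\<in>?S. of_bool (t \<in> \<mu>) * mark_exp r \<pi> X' Y' t) +
      (\<Sum>t\<in>?S. of_bool (t \<in> \<mu>) * mark_exp r \<pi> X Y t) + (\<Sum>t\<in>?S. of_bool (t \<in> \<mu>) * dm t))"
    by (simp only: distrib_left sum.distrib)
  have d4: "even (twist_exp r m X' Y' + twist_exp r m X Y + of_bool (r < b0) * (X b0 + N) +
      of_bool (r < t0) * (Y t0 + N + of_bool (r < b0) + 1))"
    unfolding N_def by (rule twist_exp_change) (use b0S t0 X Y in auto)
  have "even (sum X' ?S) \<longleftrightarrow> (even (sum X ?S) \<longleftrightarrow> b0 \<notin> ?S)"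
    by (rule even_sum_change) (use X in auto)
  then have d5: "odd ((\<Sum>l\<in>?S. X' l) + (\<Sum>l\<in>?S. X l))"
    using b0S by auto
  have card: "card \<mu> = (\<Sum>t\<in>?S. of_bool (t \<in> \<mu>))"
    using \<mu> by (simp add: Int_absorb1)
  have pX: "(\<Sum>l=1..<b0. X l) = (\<Sum>t\<in>?S. of_bool (\<pi> t < b0) * X (\<pi> t))"
  proof -
    have "(\<Sum>l=1..<b0. X l) = (\<Sum>l\<in>?S. of_bool (l < b0) * X l)"
      using b0S by (intro sum.mono_neutral_cong_left) auto
    then show ?thesis using permS[of "\<lambda>l. of_bool (l < b0) * X l"] by simp
  qed
  have pY: "(\<Sum>l=1..<t0. Y l) = (\<Sum>t\<in>?S. of_bool (t < t0) * Y t)"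
    using t0 by (intro sum.mono_neutral_cong_left) auto
  have N: "N = (\<Sum>t\<in>?S. of_bool (r < \<pi> t) * X (\<pi> t) + of_bool (r < t) * Y t)"
  proof -
    have "tail_sum r m Z = (\<Sum>l\<in>?S. of_bool (r < l) * Z l)" for Z
      unfolding tail_sum_def by (intro sum.mono_neutral_cong_left) auto
    then show ?thesis using permS[of "\<lambda>l. of_bool (r < l) * X l"] by (simp only: N_def sum.distrib)
  qed
  \<comment> \<open>The share of the edge \<open>t\<close> in the total increment and in the prefix
    sums.\<close>
  define g where "g = (\<lambda>t. of_bool (cr t) * P t + of_bool (t \<in> \<mu>) * dm t + of_bool (t \<in> \<mu>)
    + of_bool (\<pi> t < b0) * X (\<pi> t) + of_bool (t < t0) * Y t
    + (of_bool (r < b0) + of_bool (r < t0)) * (of_bool (r < \<pi> t) * X (\<pi> t) + of_bool (r < t) * Y t))"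
  have sum_g: "(\<Sum>t\<in>?S. g t) = (\<Sum>t\<in>?S. of_bool (cr t) * P t) + (\<Sum>t\<in>?S. of_bool (t \<in> \<mu>) * dm t) + card \<mu>
    + (\<Sum>l=1..<b0. X l) + (\<Sum>l=1..<t0. Y l) + (of_bool (r < b0) + of_bool (r < t0)) * N"
    unfolding g_def card pX pY N by (simp only: sum.distrib sum_distrib_left[symmetric])
  have "even (g t)" if "t \<in> ?S" "t \<noteq> t0" for t
    using crossing_pair_parity[OF \<pi>S[OF that(1)] that(1) b0S t0 \<pi>ne[OF that(2)] that(2) XY[OF that(1)], of r]
      that(2)
    unfolding g_def cr_def crossing_def P_def medge_par_def dm_def b0[symmetric] by simp
  then have "even (\<Sum>t\<in>?S - {t0}. g t)" by (intro dvd_sum) auto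
  then have "even ((\<Sum>t\<in>?S. g t) + g t0)"
    using sum.remove[OF finite_atLeastAtMost t0, of g] by simp
  \<comment> \<open>The flipped edge does not cross itself; its bottom sign, its own mark and its
    own labels in the tails cancel.\<close>
  moreover have "even (g t0 + of_bool (bot t0) + of_bool (r < b0) * X b0 + of_bool (r < t0) * (Y t0 + of_bool (r < b0) + 1))"
    using XY[OF t0] unfolding g_def cr_def bot_def dm_def b0[symmetric]
    by (auto simp: of_bool_def)
  ultimately show ?thesis
    using d1 d2 d3 d4 d5
    unfolding sum_g wt_exp_def bot_def P_def[symmetric] P'_def[symmetric]
    by (simp only: even_add even_mult_iff odd_one even_of_bool) argo
qed

section \<open>The weight of the diagram of a marked permutation\<close>

definition dgm :: "nat \<Rightarrow> nat \<Rightarrow> mperm \<Rightarrow> diagram" where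
  "dgm r m h = ((\<lambda>t. medge r (fst h t) t) ` {1..m}, (\<lambda>t. medge r (fst h t) t) ` snd h)"

text \<open>The part of the mark exponents that counts marked bottom edges. It does not involve the
  labels, so it only affects the global sign of the diagram.\<close>

definition dgm_const :: "nat \<Rightarrow> nat \<Rightarrow> mperm \<Rightarrow> nat" where
  "dgm_const r m h = (\<Sum>t=1..m. of_bool (t \<in> snd h) * (of_bool (fst h t \<le> r \<and> r < t) *
     card {e \<in> snd (dgm r m h). is_bottom e \<and> anchor e \<le> fst h t}))"

lemma medge_eq_iff [simp]: "medge r b t = medge r b' t' \<longleftrightarrow> b = b' \<and> t = t'"
  by (auto simp: medge_def)

lemma is_bottom_medge [simp]: "is_bottom (medge r b t) \<longleftrightarrow> b \<le> r \<and> r < t"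
  by (auto simp: medge_def)

lemma anchor_medge [simp]: "anchor (medge r b t) = (if t \<le> r then t else b)"
  by (auto simp: medge_def)

lemma edge_par_medge:
  "edge_par (merge r x y) (merge r y x) (medge r (\<pi> t) t) = medge_par r \<pi> (par \<circ> x) (par \<circ> y) t"
  by (auto simp: medge_def medge_par_def merge_def)

text \<open>For top horizontal and right vertical edges the definition bars the other end; this is
  the same condition because \<open>bar\<close> is an involution.\<close>

lemma edge_delta_medge:
  "edge_delta (merge r x y) (merge r y x) mk (medge r b t) = of_bool ((if mk then bar (x b) else x b) = y t)"
  by (auto simp: medge_def merge_def) (metis bar_bar)+

lemma prod_image_filter_minus_one:
  assumes "inj_on f A" "finite A"
  shows "(\<Prod>e\<in>{e \<in> f ` A. Q e}. (-1 :: complex) ^ k e) = (-1) ^ (\<Sum>t\<in>A. of_bool (Q (f t)) * k (f t))"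
proof -
  have "{e \<in> f ` A. Q e} = f ` {t \<in> A. Q (f t)}" by auto
  moreover have "inj_on f {t \<in> A. Q (f t)}" using assms(1) by (rule inj_on_subset) auto
  ultimately have "(\<Prod>e\<in>{e \<in> f ` A. Q e}. (-1 :: complex) ^ k e) = (\<Prod>t\<in>{t \<in> A. Q (f t)}. (-1) ^ k (f t))"
    by (simp add: prod.reindex)
  also have "\<dots> = (-1) ^ (\<Sum>t\<in>{t \<in> A. Q (f t)}. k (f t))"
    by (simp add: power_sum)
  also have "(\<Sum>t\<in>{t \<in> A. Q (f t)}. k (f t)) = (\<Sum>t\<in>A. of_bool (Q (f t)) * k (f t))"
    using assms(2) by (intro sum.mono_neutral_cong_left) auto
  finally show ?thesis .
qed

lemma prod_of_bool: "finite A \<Longrightarrow> (\<Prod>t\<in>A. of_bool (Q t) :: complex) = of_bool (\<forall>t\<in>A. Q t)"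
  by (induction A rule: finite_induct) auto

lemma mark_exp_eq_m_bottom:
  assumes "\<pi> t \<le> r" "r < t"
  shows "m_bottom (merge r x y) M (medge r (\<pi> t) t) = mark_exp r \<pi> (par \<circ> x) (par \<circ> y) t +
    card {e \<in> M. is_bottom e \<and> anchor e \<le> \<pi> t}"
proof -
  have "(\<Sum>l=1..\<pi> t. par (merge r x y l)) = (\<Sum>l=1..\<pi> t. par (x l))"
    using assms by (intro sum.cong) (auto simp: merge_def)
  then show ?thesis using assms by (simp add: m_bottom_def mark_exp_def)
qed

lemma mark_exp_eq_m_other:
  assumes "\<not> (\<pi> t \<le> r \<and> r < t)"
  shows "m_other r (merge r y x) (medge r (\<pi> t) t) = mark_exp r \<pi> (par \<circ> x) (par \<circ> y) t"
proof (cases "t \<le> r")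
  case True
  then have "(\<Sum>l=1..t. par (merge r y x l)) = (\<Sum>l=1..t. par (y l))"
    by (intro sum.cong) (auto simp: merge_def)
  then show ?thesis using True by (simp add: m_other_def mark_exp_def)
next
  case False
  then have r: "r < \<pi> t" using assms by auto
  then have "{1..<\<pi> t} = {1..r} \<union> {Suc r..<\<pi> t}" "{1..r} \<inter> {Suc r..<\<pi> t} = {}" by auto
  then have "(\<Sum>l=1..<\<pi> t. par (merge r y x l)) =
      (\<Sum>l=1..r. par (merge r y x l)) + (\<Sum>l=Suc r..<\<pi> t. par (merge r y x l))"
    by (simp add: sum.union_disjoint)
  also have "\<dots> = (\<Sum>l=1..r. par (y l)) + (\<Sum>l=Suc r..<\<pi> t. par (x l))"
    by (intro arg_cong2[where f = "(+)"] sum.cong) (auto simp: merge_def)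
  finally show ?thesis using False r by (simp add: m_other_def mark_exp_def)
qed

text \<open>In the renamed labels every edge compares one label of \<open>x\<close> with one of
  \<open>y\<close>, so the product of the deltas is an incidence condition, and the four sign
  products merge into a single exponent. Thus a diagram is a signed permutation matrix.\<close>

lemma wt_dgm:
  assumes h: "h \<in> mperms (r + s)" and x: "x \<in> multi n (r + s)" and y: "y \<in> multi n (r + s)"
  shows "wt r s (dgm r (r + s) h) (merge r x y) (merge r y x) = (if mact h x = y
    then (-1) ^ (wt_exp r (r + s) (fst h) (snd h) (par \<circ> x) (par \<circ> y) + dgm_const r (r + s) h) else 0)"
proof -
  let ?m = "r + s" and ?i = "merge r x y" and ?j = "merge r y x"
  let ?S = "{1..?m}"
  obtain \<pi> \<mu> where h_eq: "h = (\<pi>, \<mu>)" by force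
  have \<mu>: "\<mu> \<subseteq> ?S" using h by (auto simp: h_eq mperms_def)
  then have fin: "finite \<mu>" by (rule finite_subset) simp
  define f where "f = (\<lambda>t. medge r (\<pi> t) t)"
  have inj: "inj_on f A" for A by (auto simp: f_def inj_on_def)
  have f_in: "f t \<in> f ` \<mu> \<longleftrightarrow> t \<in> \<mu>" for t by (auto simp: f_def)
  have E: "dgm r ?m h = (f ` ?S, f ` \<mu>)" by (simp add: dgm_def f_def h_eq)
  let ?P = "medge_par r \<pi> (par \<circ> x) (par \<circ> y)"
  have par_f: "edge_par ?i ?j (f t) = ?P t" for t
    unfolding f_def by (rule edge_par_medge)
  have bot_f: "is_bottom (f t) \<longleftrightarrow> \<pi> t \<le> r \<and> r < t" for t
    by (simp add: f_def)
  have "(\<Prod>e\<in>f ` ?S. edge_delta ?i ?j (e \<in> f ` \<mu>) e) = (\<Prod>t\<in>?S. of_bool (mact h x t = y t))"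
    unfolding prod.reindex[OF inj] o_def f_in mact_def h_eq fst_conv snd_conv
    by (simp add: f_def edge_delta_medge)
  also have "\<dots> = of_bool (\<forall>t\<in>?S. mact h x t = y t)"
    by (rule prod_of_bool) simp
  also have "(\<forall>t\<in>?S. mact h x t = y t) \<longleftrightarrow> mact h x = y"
    using multi_eqI[OF mact_in_multi[OF h x] y] by auto
  finally have 1: "(\<Prod>e\<in>f ` ?S. edge_delta ?i ?j (e \<in> f ` \<mu>) e) = of_bool (mact h x = y)" .
  have 2: "(\<Prod>e\<in>{e \<in> f ` ?S. is_bottom e}. (-1 :: complex) ^ edge_par ?i ?j e) =
      (-1) ^ (\<Sum>t=1..?m. of_bool (\<pi> t \<le> r \<and> r < t) * ?P t)"
    unfolding prod_image_filter_minus_one[OF inj finite_atLeastAtMost] par_f bot_f ..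
  have "{(e, e'). e \<in> f ` ?S \<and> e' \<in> f ` ?S \<and> interlace ?m e e'} =
      {p \<in> map_prod f f ` (?S \<times> ?S). interlace ?m (fst p) (snd p)}"
    by (auto simp: map_prod_def image_iff)
  moreover have "(\<lambda>(e, e'). (-1 :: complex) ^ (edge_par ?i ?j e * edge_par ?i ?j e')) =
      (\<lambda>p. (-1) ^ (edge_par ?i ?j (fst p) * edge_par ?i ?j (snd p)))"
    by auto
  moreover have "inj_on (map_prod f f) (?S \<times> ?S)"
    using inj by (simp add: map_prod_inj_on)
  ultimately have 3: "(\<Prod>(e, e')\<in>{(e, e'). e \<in> f ` ?S \<and> e' \<in> f ` ?S \<and> interlace ?m e e'}.
        (-1 :: complex) ^ (edge_par ?i ?j e * edge_par ?i ?j e')) =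
      (-1) ^ (\<Sum>t=1..?m. \<Sum>t'=1..?m. of_bool (crossing r ?m \<pi> t t') * (?P t * ?P t'))"
    by (simp add: prod_image_filter_minus_one sum.cartesian_product par_f crossing_def case_prod_beta
        del: sum_of_bool_mult_eq sum_mult_of_bool_eq) (simp add: f_def)
  have 4: "(\<Prod>e\<in>{e \<in> f ` \<mu>. is_bottom e}. (-1 :: complex) ^ m_bottom ?i (f ` \<mu>) e) =
      (-1) ^ (\<Sum>t\<in>\<mu>. of_bool (\<pi> t \<le> r \<and> r < t) * m_bottom ?i (f ` \<mu>) (f t))"
    unfolding prod_image_filter_minus_one[OF inj fin] bot_f ..
  have 5: "(\<Prod>e\<in>{e \<in> f ` \<mu>. \<not> is_bottom e}. (-1 :: complex) ^ m_other r ?j e) =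
      (-1) ^ (\<Sum>t\<in>\<mu>. of_bool (\<not> (\<pi> t \<le> r \<and> r < t)) * m_other r ?j (f t))"
    unfolding prod_image_filter_minus_one[OF inj fin] bot_f ..
  \<comment> \<open>\<open>mark_exp\<close> covers both rules for marked edges at once; only the
    count of marked bottom edges is left over.\<close>
  have "(\<Sum>t\<in>\<mu>. of_bool (\<pi> t \<le> r \<and> r < t) * m_bottom ?i (f ` \<mu>) (f t)) +
      (\<Sum>t\<in>\<mu>. of_bool (\<not> (\<pi> t \<le> r \<and> r < t)) * m_other r ?j (f t)) =
      (\<Sum>t\<in>\<mu>. mark_exp r \<pi> (par \<circ> x) (par \<circ> y) t + of_bool (\<pi> t \<le> r \<and> r < t) *
        card {e \<in> f ` \<mu>. is_bottom e \<and> anchor e \<le> \<pi> t})"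
    unfolding sum.distrib[symmetric]
  proof (intro sum.cong refl)
    fix t
    show "of_bool (\<pi> t \<le> r \<and> r < t) * m_bottom ?i (f ` \<mu>) (f t) + of_bool (\<not> (\<pi> t \<le> r \<and> r < t)) * m_other r ?j (f t) =
        mark_exp r \<pi> (par \<circ> x) (par \<circ> y) t + of_bool (\<pi> t \<le> r \<and> r < t) *
          card {e \<in> f ` \<mu>. is_bottom e \<and> anchor e \<le> \<pi> t}"
      using mark_exp_eq_m_bottom[of \<pi> t r x y "f ` \<mu>"] mark_exp_eq_m_other[of \<pi> t r y x]
      unfolding f_def by (cases "\<pi> t \<le> r \<and> r < t") auto
  qed
  also have "\<dots> = (\<Sum>t=1..?m. of_bool (t \<in> \<mu>) * (mark_exp r \<pi> (par \<circ> x) (par \<circ> y) t +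
      of_bool (\<pi> t \<le> r \<and> r < t) * card {e \<in> f ` \<mu>. is_bottom e \<and> anchor e \<le> \<pi> t}))"
    using \<mu> by (intro sum.mono_neutral_cong_left) auto
  also have "\<dots> = (\<Sum>t=1..?m. of_bool (t \<in> \<mu>) * mark_exp r \<pi> (par \<circ> x) (par \<circ> y) t) + dgm_const r ?m h"
    unfolding dgm_const_def E by (simp only: distrib_left sum.distrib h_eq fst_conv snd_conv)
  finally have 6: "(\<Sum>t\<in>\<mu>. of_bool (\<pi> t \<le> r \<and> r < t) * m_bottom ?i (f ` \<mu>) (f t)) +
      (\<Sum>t\<in>\<mu>. of_bool (\<not> (\<pi> t \<le> r \<and> r < t)) * m_other r ?j (f t)) =
      (\<Sum>t=1..?m. of_bool (t \<in> \<mu>) * mark_exp r \<pi> (par \<circ> x) (par \<circ> y) t) + dgm_const r ?m h" .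
  have "wt r s (dgm r ?m h) ?i ?j = of_bool (mact h x = y) *
      (-1) ^ (wt_exp r ?m \<pi> \<mu> (par \<circ> x) (par \<circ> y) + dgm_const r ?m h)"
    unfolding E wt.simps 1 2 3 4 5 wt_exp_def mult.assoc power_add[symmetric] 6 add.assoc ..
  then show ?thesis by (simp add: h_eq)
qed

text \<open>The exponent of the sign of a diagram after the partial transposition.\<close>

definition dgm_exp :: "nat \<Rightarrow> nat \<Rightarrow> mperm \<Rightarrow> midx \<Rightarrow> nat" where
  "dgm_exp r m h x = wt_exp r m (fst h) (snd h) (par \<circ> x) (par \<circ> mact h x) + dgm_const r m h +
     twist_exp r m (par \<circ> x) (par \<circ> mact h x) + card (snd h) * (\<Sum>l=1..m. par (x l))"

text \<open>The combinatorial weight meets the algebra here: the increment found in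
  \<open>total_exp_change\<close> is the one that commutation with the Jordan-Wigner operators
  requires.\<close>

lemma admissible_dgm_exp:
  assumes h: "h \<in> mperms m"
  shows "admissible n m h (dgm_exp r m h)"
  unfolding admissible_def
proof (intro ballI)
  fix x t z assume x: "x \<in> multi n m" and t: "t \<in> {1..m}" and z: "z \<in> idxs n"
  define b where "b = fst h t"
  define x' where "x' = x(b := z)"
  define y where "y = mact h x"
  define y' where "y' = mact h x'"
  have y'_eq: "y' = y(t := (if t \<in> snd h then bar z else z))"
    unfolding y_def y'_def x'_def b_def by (rule mact_upd[OF h])
  have yt: "y t = (if t \<in> snd h then bar (x b) else x b)"
    by (simp add: y_def mact_def b_def)
  have "even (dgm_exp r m h x' + dgm_exp r m h x + (par (x b) + par z) * (pre x b + pre y t))"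
  \<comment> \<open>The exponent depends on labels only through their parities, so replacing a label
    by one of equal parity changes nothing.\<close>
  proof (cases "even (par (x b) + par z)")
    case True
    then have "par z = par (x b)" using par_le_1[of z] par_le_1[of "x b"] by presburger
    then have x'p: "par (x' k) = par (x k)" for k by (simp add: x'_def)
    have y'y: "even (par (y' k) + par (y k))" for k
      using True by (auto simp: y'_eq yt)
    have y'p: "par (y' k) = par (y k)" for k
      using y'y[of k] par_le_1[of "y' k"] par_le_1[of "y k"] by presburger
    have "par \<circ> x' = par \<circ> x" "par \<circ> y' = par \<circ> y" using x'p y'p by auto
    then show ?thesis using True by (simp add: dgm_exp_def y_def y'_def x'p)
  next
    case False
    have "even (wt_exp r m (fst h) (snd h) (par \<circ> x') (par \<circ> y') + wt_exp r m (fst h) (snd h) (par \<circ> x) (par \<circ> y) +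
        (twist_exp r m (par \<circ> x') (par \<circ> y') + twist_exp r m (par \<circ> x) (par \<circ> y)) +
        card (snd h) * ((\<Sum>l=1..m. (par \<circ> x') l) + (\<Sum>l=1..m. (par \<circ> x) l)) +
        ((\<Sum>l=1..<b. (par \<circ> x) l) + (\<Sum>l=1..<t. (par \<circ> y) l)))"
    proof (rule total_exp_change[OF mperms_fst[OF h] mperms_snd[OF h] t b_def])
      show "odd ((par \<circ> x) b + (par \<circ> x') b)" using False by (simp add: x'_def)
      show "odd ((par \<circ> y) t + (par \<circ> y') t)" using False by (auto simp: y'_eq yt)
      show "even ((par \<circ> y) k) \<longleftrightarrow> (even ((par \<circ> x) (fst h k)) \<longleftrightarrow> k \<notin> snd h)" for k
        by (simp add: y_def mact_def)
    qed (auto simp: x'_def y'_eq par_le_1[unfolded One_nat_def])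
    then show ?thesis
      using False unfolding dgm_exp_def pre_def y_def[symmetric] y'_def[symmetric] comp_def
      by (simp only: even_add even_mult_iff) argo
  qed
  then show "even (dgm_exp r m h (x(fst h t := z)) + dgm_exp r m h x +
      (par (x (fst h t)) + par z) * (pre x (fst h t) + pre (mact h x) t))"
    by (simp only: b_def x'_def y_def)
qed

section \<open>The double centralizer\<close>

text \<open>The matrix of a homogeneous element of parity \<open>p\<close>. Even and odd elements
  satisfy the same symmetry under bars, because the signs in the odd operator \<open>P\<close>
  absorb those of the superbracket.\<close>

definition queer_matrix :: "nat \<Rightarrow> nat \<Rightarrow> (idx \<Rightarrow> idx \<Rightarrow> complex) \<Rightarrow> bool" where
  "queer_matrix n p G \<longleftrightarrow> (\<forall>x\<in>idxs n. \<forall>y\<in>idxs n.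
     G (bar x) (bar y) = G x y \<and> (G x y \<noteq> 0 \<longrightarrow> even (par x + par y + p)))"

text \<open>
  \<open>act_out\<close> and \<open>act_in\<close> compose a matrix with the operator \<open>S^p \<otimes> \<dots> \<otimes> S^p \<otimes> g \<otimes> 1 \<otimes> \<dots> \<otimes> 1\<close> with
  \<open>g\<close> in position \<open>t\<close> (\<open>S\<close> the parity operator), on the output and the input side, respectively.
\<close>

definition act_out ::
  "nat \<Rightarrow> (idx \<Rightarrow> idx \<Rightarrow> complex) \<Rightarrow> nat \<Rightarrow> nat \<Rightarrow> (midx \<Rightarrow> midx \<Rightarrow> complex) \<Rightarrow> midx \<Rightarrow> midx \<Rightarrow> complex" where
  "act_out n G p t X i j = (\<Sum>z\<in>idxs n. G (j t) z * (-1) ^ (p * pre j t) * X i (j(t := z)))"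

definition act_in ::
  "nat \<Rightarrow> (idx \<Rightarrow> idx \<Rightarrow> complex) \<Rightarrow> nat \<Rightarrow> nat \<Rightarrow> (midx \<Rightarrow> midx \<Rightarrow> complex) \<Rightarrow> midx \<Rightarrow> midx \<Rightarrow> complex" where
  "act_in n G p t X i j = (\<Sum>z\<in>idxs n. G z (i t) * (-1) ^ (p * pre i t) * X (i(t := z)) j)"

definition jw_commutes ::
  "nat \<Rightarrow> nat \<Rightarrow> (idx \<Rightarrow> idx \<Rightarrow> complex) \<Rightarrow> nat \<Rightarrow> (midx \<Rightarrow> midx \<Rightarrow> complex) \<Rightarrow> bool" where
  "jw_commutes n m G p F \<longleftrightarrow> (\<forall>i\<in>multi n m. \<forall>j\<in>multi n m.
     (\<Sum>t=1..m. act_out n G p t F i j) = (\<Sum>t=1..m. act_in n G p t F i j))"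

text \<open>Conjugation by a signed permutation matrix; changing its global sign does not affect the
  sum \<open>w i + w j\<close> modulo 2.\<close>

definition conj_mperm ::
  "(midx \<Rightarrow> nat) \<Rightarrow> mperm \<Rightarrow> (midx \<Rightarrow> midx \<Rightarrow> complex) \<Rightarrow> midx \<Rightarrow> midx \<Rightarrow> complex" where
  "conj_mperm w h X i j = (-1) ^ (w i + w j) * X (mact h i) (mact h j)"

lemma act_out_cong:
  assumes "\<And>i j. i \<in> multi n m \<Longrightarrow> j \<in> multi n m \<Longrightarrow> X i j = Y i j"
    and "t \<in> {1..m}" "i \<in> multi n m" "j \<in> multi n m"
  shows "act_out n G p t X i j = act_out n G p t Y i j"
  unfolding act_out_def using assms by (intro sum.cong) (auto simp: multi_upd)

lemma sum_idxs_bar: "(\<Sum>z\<in>idxs n. f (if c then bar z else z)) = (\<Sum>z\<in>idxs n. f z)"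
  by (rule sum.reindex_bij_witness[where i = "\<lambda>z. if c then bar z else z"
        and j = "\<lambda>z. if c then bar z else z"]) auto

text \<open>Conjugation carries position \<open>t\<close> to position \<open>fst h t\<close>. A mark
  on the way bars both indices of \<open>G\<close>, to which \<open>G\<close> is insensitive, and
  admissibility converts the prefix sign at \<open>t\<close> into the one at
  \<open>fst h t\<close>.\<close>

lemma conj_mperm_act_out:
  assumes h: "h \<in> mperms m" "admissible n m h w" and G: "queer_matrix n p G"
    and i: "i \<in> multi n m" and j: "j \<in> multi n m" and t: "t \<in> {1..m}"
  shows "conj_mperm w h (act_out n G p t X) i j = act_out n G p (fst h t) (conj_mperm w h X) i j"
proof -
  define b where "b = fst h t"
  define \<beta> where "\<beta> = (\<lambda>z. if t \<in> snd h then bar z else z)"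
  have b: "b \<in> {1..m}" using mperms_in[OF h(1)] t by (simp add: b_def)
  have jb: "j b \<in> idxs n" using multi_in[OF j b] .
  have hj: "mact h j t = \<beta> (j b)" by (simp add: mact_def \<beta>_def b_def)
  have "conj_mperm w h (act_out n G p t X) i j =
      (\<Sum>z\<in>idxs n. (-1) ^ (w i + w j) * (G (\<beta> (j b)) z * (-1) ^ (p * pre (mact h j) t)
        * X (mact h i) ((mact h j)(t := z))))"
    by (simp add: conj_mperm_def act_out_def sum_distrib_left hj)
  also have "\<dots> = (\<Sum>z\<in>idxs n. (-1) ^ (w i + w j) * (G (\<beta> (j b)) (\<beta> z) * (-1) ^ (p * pre (mact h j) t)
        * X (mact h i) ((mact h j)(t := \<beta> z))))"
    unfolding \<beta>_def by (rule sum_idxs_bar[symmetric])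
  also have "\<dots> = (\<Sum>z\<in>idxs n. G (j b) z * (-1) ^ (p * pre j b) *
        ((-1) ^ (w i + w (j(b := z))) * X (mact h i) (mact h (j(b := z)))))"
  proof (rule sum.cong[OF refl])
    fix z assume z: "z \<in> idxs n"
    have G': "G (\<beta> (j b)) (\<beta> z) = G (j b) z"
      using G jb z by (auto simp: queer_matrix_def \<beta>_def)
    have upd: "(mact h j)(t := \<beta> z) = mact h (j(b := z))"
      unfolding \<beta>_def b_def by (rule mact_upd[OF h(1), symmetric])
    \<comment> \<open>Signs need to agree only at nonzero entries of \<open>G\<close>, where the
      label change has parity \<open>p\<close>.\<close>
    have "(-1) ^ (w i + w j) * (-1) ^ (p * pre (mact h j) t) =
        (-1 :: complex) ^ (p * pre j b) * (-1) ^ (w i + w (j(b := z)))" if "G (j b) z \<noteq> 0"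
    proof -
      have "even (par (j b) + par z + p)" using G jb z that by (auto simp: queer_matrix_def)
      moreover have "even (w (j(b := z)) + w j + (par (j b) + par z) * (pre j b + pre (mact h j) t))"
        using h(2) j t z unfolding admissible_def b_def by blast
      ultimately show ?thesis
        unfolding power_add[symmetric]
        by (intro minus_one_power_cong) (simp only: even_add even_mult_iff; argo)
    qed
    then show "(-1) ^ (w i + w j) * (G (\<beta> (j b)) (\<beta> z) * (-1) ^ (p * pre (mact h j) t)
        * X (mact h i) ((mact h j)(t := \<beta> z))) = G (j b) z * (-1) ^ (p * pre j b) *
        ((-1) ^ (w i + w (j(b := z))) * X (mact h i) (mact h (j(b := z))))"
      unfolding G' upd by (cases "G (j b) z = 0") (simp_all add: mult_ac)
  qed
  finally show ?thesis by (simp add: act_out_def conj_mperm_def b_def)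
qed

text \<open>Associativity of the matrix product: the operator at position \<open>b\<close> stands
  between \<open>A\<close> and \<open>F\<close> and may be absorbed by either. The reindexing
  exchanges the old and the new label at \<open>b\<close>.\<close>

lemma sum_by_parts:
  assumes b: "b \<in> {1..m}"
  shows "(\<Sum>k\<in>multi n m. A i k * act_in n G p b F k j) = (\<Sum>k\<in>multi n m. act_out n G p b A i k * F k j)"
proof -
  have "(\<Sum>k\<in>multi n m. A i k * act_in n G p b F k j) =
      (\<Sum>(k, z)\<in>multi n m \<times> idxs n. A i k * (G z (k b) * (-1) ^ (p * pre k b) * F (k(b := z)) j))"
    by (simp add: act_in_def sum_distrib_left sum.cartesian_product)
  also have "\<dots> = (\<Sum>(k, z)\<in>multi n m \<times> idxs n. G (k b) z * (-1) ^ (p * pre k b) * A i (k(b := z)) * F k j)"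
    by (rule sum.reindex_bij_witness[where i = "\<lambda>(k, z). (k(b := z), k b)"
          and j = "\<lambda>(k, z). (k(b := z), k b)"])
      (use b in \<open>auto simp: multi_upd multi_in\<close>)
  also have "\<dots> = (\<Sum>k\<in>multi n m. act_out n G p b A i k * F k j)"
    by (simp add: act_out_def sum_distrib_right sum.cartesian_product)
  finally show ?thesis .
qed

text \<open>The matrix unit \<open>(a, b)\<close> in the first \<open>d\<close> positions, tensored with the identity.\<close>

definition lead :: "nat \<Rightarrow> nat \<Rightarrow> midx \<Rightarrow> midx \<Rightarrow> midx \<Rightarrow> midx \<Rightarrow> complex" where
  "lead m d a b i j = (if (\<forall>k\<in>{1..d}. i k = a k \<and> j k = b k) \<and> (\<forall>k\<in>{1..m} - {1..d}. i k = j k)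
     then 1 else 0)"

text \<open>On a position already occupied by a matrix unit, the action alters only its output
  label, so no further position is occupied.\<close>

lemma act_out_lead_le:
  assumes t: "t \<in> {1..d}" and d: "d \<le> m" and j: "j \<in> multi n m" and bt: "b t \<in> idxs n"
  shows "act_out n G p t (lead m d a b) i j =
    (\<Sum>z\<in>idxs n. G z (b t) * (-1) ^ (p * pre b t) * lead m d a (b(t := z)) i j)"
proof -
  define C where "C \<longleftrightarrow> (\<forall>k\<in>{1..d}. i k = a k) \<and> (\<forall>k\<in>{1..d} - {t}. j k = b k) \<and>
    (\<forall>k\<in>{1..m} - {1..d}. i k = j k)"
  have jt: "j t \<in> idxs n" using multi_in[OF j] t d by auto
  have 1: "lead m d a b i (j(t := z)) = (if C \<and> z = b t then 1 else 0)" for z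
    using t by (auto simp: lead_def C_def)
  have 2: "lead m d a (b(t := z)) i j = (if C \<and> z = j t then 1 else 0)" for z
    using t by (auto simp: lead_def C_def)
  have pre: "pre j t = pre b t" if C
    unfolding pre_def by (intro sum.cong) (use that t in \<open>auto simp: C_def\<close>)
  show ?thesis
    unfolding act_out_def 1 2 using bt jt pre
    by (cases C) (simp_all add: if_distrib cong: if_cong)
qed

text \<open>On the first free position the identity factor is replaced by the acting element itself.
  The prefix sign is constant on the support because the output labels before it are those of
  \<open>b\<close>.\<close>

lemma act_out_lead_Suc:
  assumes d: "Suc d \<le> m" and i: "i \<in> multi n m" and j: "j \<in> multi n m"
  shows "act_out n (\<lambda>u v. if u = x \<and> v = y \<or> u = bar x \<and> v = bar y then 1 else 0) p (Suc d) (lead m d a b) i j =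
    (-1) ^ (p * pre b (Suc d)) *
      (lead m (Suc d) (a(Suc d := y)) (b(Suc d := x)) i j +
       lead m (Suc d) (a(Suc d := bar y)) (b(Suc d := bar x)) i j)"
proof -
  define C where "C \<longleftrightarrow> (\<forall>k\<in>{1..d}. i k = a k \<and> j k = b k) \<and> (\<forall>k\<in>{1..m} - {1..Suc d}. i k = j k)"
  have id: "i (Suc d) \<in> idxs n" using multi_in[OF i] d by auto
  have "{1..m} - {1..d} = insert (Suc d) ({1..m} - {1..Suc d})" using d by auto
  then have 1: "lead m d a b i (j(Suc d := z)) = (if C \<and> z = i (Suc d) then 1 else 0)" for z
    by (auto simp: lead_def C_def)
  have "{1..Suc d} = insert (Suc d) {1..d}" by auto
  then have 2: "lead m (Suc d) (a(Suc d := u)) (b(Suc d := v)) i j =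
      (if C \<and> i (Suc d) = u \<and> j (Suc d) = v then 1 else 0)" for u v
    by (auto simp: lead_def C_def)
  have pre: "pre j (Suc d) = pre b (Suc d)" if C
    unfolding pre_def by (intro sum.cong) (use that in \<open>auto simp: C_def\<close>)
  show ?thesis
    unfolding act_out_def 1 2 using id pre
    by (cases C) (auto simp: if_distrib cong: if_cong)
qed

lemma sum_swap_scaled:
  fixes f :: "'a \<Rightarrow> complex"
  shows "(\<Sum>k\<in>K. f k * (\<Sum>t\<in>T. \<Sum>z\<in>Z. g t z * A k t z)) =
    (\<Sum>t\<in>T. \<Sum>z\<in>Z. g t z * (\<Sum>k\<in>K. f k * A k t z))"
proof -
  have "(\<Sum>k\<in>K. f k * (\<Sum>t\<in>T. \<Sum>z\<in>Z. g t z * A k t z)) =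
      (\<Sum>k\<in>K. \<Sum>t\<in>T. \<Sum>z\<in>Z. g t z * (f k * A k t z))"
    by (simp add: sum_distrib_left mult_ac)
  also have "\<dots> = (\<Sum>t\<in>T. \<Sum>k\<in>K. \<Sum>z\<in>Z. g t z * (f k * A k t z))"
    by (rule sum.swap)
  also have "\<dots> = (\<Sum>t\<in>T. \<Sum>z\<in>Z. \<Sum>k\<in>K. g t z * (f k * A k t z))"
    by (intro sum.cong refl sum.swap)
  finally show ?thesis by (simp add: sum_distrib_left)
qed

section \<open>Averages over the signed marked permutations\<close>

locale sign_system =
  fixes n m :: nat and w :: "mperm \<Rightarrow> midx \<Rightarrow> nat"
  assumes adm: "h \<in> mperms m \<Longrightarrow> admissible n m h (w h)"
begin

definition avg :: "(midx \<Rightarrow> midx \<Rightarrow> complex) \<Rightarrow> midx \<Rightarrow> midx \<Rightarrow> complex" where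
  "avg X i j = (\<Sum>h\<in>mperms m. conj_mperm (w h) h X i j)"

definition central :: "(midx \<Rightarrow> midx \<Rightarrow> complex) \<Rightarrow> (midx \<Rightarrow> midx \<Rightarrow> complex) \<Rightarrow> bool" where
  "central F X \<longleftrightarrow> (\<forall>i\<in>multi n m. \<forall>j\<in>multi n m.
     (\<Sum>k\<in>multi n m. F i k * avg X k j) = (\<Sum>k\<in>multi n m. avg X i k * F k j))"

lemma avg_cong:
  assumes "\<And>i j. i \<in> multi n m \<Longrightarrow> j \<in> multi n m \<Longrightarrow> X i j = Y i j"
    and "i \<in> multi n m" "j \<in> multi n m"
  shows "avg X i j = avg Y i j"
  unfolding avg_def conj_mperm_def using assms by (intro sum.cong) (auto simp: mact_in_multi)

lemma central_avg_cong:
  assumes "\<And>i j. i \<in> multi n m \<Longrightarrow> j \<in> multi n m \<Longrightarrow> avg X i j = avg Y i j"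
    and "central F X"
  shows "central F Y"
  using assms by (auto simp: central_def cong: sum.cong)

lemma avg_add: "avg (\<lambda>i j. X i j + Y i j) i j = avg X i j + avg Y i j"
  by (simp add: avg_def conj_mperm_def distrib_left sum.distrib)

lemma avg_scale: "avg (\<lambda>i j. c * X i j) i j = c * avg X i j"
  by (simp add: avg_def conj_mperm_def sum_distrib_left mult_ac)

lemma avg_sum: "avg (\<lambda>i j. \<Sum>a\<in>S. X a i j) i j = (\<Sum>a\<in>S. avg (X a) i j)"
  unfolding avg_def conj_mperm_def sum_distrib_left by (rule sum.swap)

lemma central_scale: "central F X \<Longrightarrow> central F (\<lambda>i j. c * X i j)"
  by (simp add: central_def avg_scale mult.assoc mult.left_commute[of _ c] flip: sum_distrib_left)

lemma central_add: "central F X \<Longrightarrow> central F Y \<Longrightarrow> central F (\<lambda>i j. X i j + Y i j)"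
  by (simp add: central_def avg_add distrib_left distrib_right sum.distrib)

lemma central_sum: "(\<And>a. a \<in> S \<Longrightarrow> central F (X a)) \<Longrightarrow> central F (\<lambda>i j. \<Sum>a\<in>S. X a i j)"
proof (induction S rule: infinite_finite_induct)
  case (insert a S)
  then show ?case by (simp add: central_add)
qed (simp_all add: central_def avg_def conj_mperm_def)

text \<open>Conjugating by \<open>g\<close> and then by \<open>h\<close> is conjugating by
  \<open>mcomp g h\<close>: the composed sign is admissible, hence agrees with the chosen one up to
  a constant, which conjugation cancels. Left translation permutes the marked permutations.\<close>

lemma avg_conj_mperm:
  assumes g: "g \<in> mperms m" and i: "i \<in> multi n m" and j: "j \<in> multi n m"
  shows "avg (conj_mperm (w g) g X) i j = avg X i j"
proof -
  have "conj_mperm (w h) h (conj_mperm (w g) g X) i j = conj_mperm (w (mcomp g h)) (mcomp g h) X i j"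
    if h: "h \<in> mperms m" for h
  proof -
    have gh: "mcomp g h \<in> mperms m" using mcomp_in_mperms[OF g h] .
    have "admissible n m (mcomp g h) (\<lambda>i. w h i + w g (mact h i))"
      using admissible_mcomp g h adm by blast
    then have "even (w h i + w g (mact h i) + w (mcomp g h) i) \<longleftrightarrow>
        even (w h j + w g (mact h j) + w (mcomp g h) j)"
      using admissible_unique[OF gh _ adm[OF gh] i j] by blast
    then have "(-1 :: complex) ^ (w h i + w h j + (w g (mact h i) + w g (mact h j))) =
        (-1) ^ (w (mcomp g h) i + w (mcomp g h) j)"
      by (intro minus_one_power_cong) (simp only: even_add; argo)
    then show ?thesis
      unfolding conj_mperm_def mact_mcomp mult.assoc[symmetric] power_add[symmetric] by (simp only:)
  qed
  then have "avg (conj_mperm (w g) g X) i j =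
      (\<Sum>h\<in>mperms m. conj_mperm (w (mcomp g h)) (mcomp g h) X i j)"
    by (simp add: avg_def)
  also have "\<dots> = avg X i j"
    unfolding avg_def using sum.reindex_bij_betw[OF bij_mcomp[OF g]] .
  finally show ?thesis .
qed

text \<open>Each conjugation permutes the tensor positions, so the sum over all positions commutes
  with averaging although its single terms do not.\<close>

lemma avg_act_out:
  assumes G: "queer_matrix n p G" and i: "i \<in> multi n m" and j: "j \<in> multi n m"
  shows "(\<Sum>t=1..m. avg (act_out n G p t X) i j) = (\<Sum>t=1..m. act_out n G p t (avg X) i j)"
proof -
  have "(\<Sum>t=1..m. avg (act_out n G p t X) i j) =
      (\<Sum>h\<in>mperms m. \<Sum>t=1..m. act_out n G p (fst h t) (conj_mperm (w h) h X) i j)"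
    unfolding avg_def
    by (subst sum.swap) (auto intro!: sum.cong conj_mperm_act_out adm G i j)
  also have "\<dots> = (\<Sum>h\<in>mperms m. \<Sum>t=1..m. act_out n G p t (conj_mperm (w h) h X) i j)"
  proof (rule sum.cong[OF refl])
    fix h assume "h \<in> mperms m"
    then show "(\<Sum>t=1..m. act_out n G p (fst h t) (conj_mperm (w h) h X) i j) =
        (\<Sum>t=1..m. act_out n G p t (conj_mperm (w h) h X) i j)"
      using sum.permute[OF mperms_fst, of h m "\<lambda>t. act_out n G p t (conj_mperm (w h) h X) i j"]
      by (simp add: o_def)
  qed
  also have "\<dots> = (\<Sum>t=1..m. \<Sum>h\<in>mperms m. act_out n G p t (conj_mperm (w h) h X) i j)"
    by (rule sum.swap)
  also have "\<dots> = (\<Sum>t=1..m. act_out n G p t (avg X) i j)"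
    unfolding act_out_def avg_def sum_distrib_left by (intro sum.cong refl sum.swap)
  finally show ?thesis .
qed

text \<open>If \<open>F\<close> commutes with the average of \<open>X\<close> and with the
  superalgebra element, it commutes with their product, and by \<open>avg_act_out\<close> this
  product is again an average.\<close>

lemma central_act_out:
  assumes G: "queer_matrix n p G" and F: "jw_commutes n m G p F" and X: "central F X"
  shows "central F (\<lambda>i j. \<Sum>t=1..m. act_out n G p t X i j)"
  unfolding central_def
proof (intro ballI)
  fix i j assume i: "i \<in> multi n m" and j: "j \<in> multi n m"
  let ?J = "multi n m"
  have "(\<Sum>k\<in>?J. F i k * avg (\<lambda>i j. \<Sum>t=1..m. act_out n G p t X i j) k j) =
      (\<Sum>k\<in>?J. F i k * (\<Sum>t=1..m. act_out n G p t (avg X) k j))"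
    using avg_act_out[OF G _ j] by (intro sum.cong refl) (simp add: avg_sum)
  also have "\<dots> = (\<Sum>t=1..m. \<Sum>z\<in>idxs n. G (j t) z * (-1) ^ (p * pre j t) *
      (\<Sum>k\<in>?J. F i k * avg X k (j(t := z))))"
    unfolding act_out_def by (rule sum_swap_scaled)
  also have "\<dots> = (\<Sum>t=1..m. \<Sum>z\<in>idxs n. G (j t) z * (-1) ^ (p * pre j t) *
      (\<Sum>k\<in>?J. avg X i k * F k (j(t := z))))"
    using X i multi_upd[OF j] by (intro sum.cong refl) (auto simp: central_def)
  also have "\<dots> = (\<Sum>k\<in>?J. avg X i k * (\<Sum>t=1..m. act_out n G p t F k j))"
    unfolding act_out_def by (rule sum_swap_scaled[symmetric])
  also have "\<dots> = (\<Sum>k\<in>?J. avg X i k * (\<Sum>t=1..m. act_in n G p t F k j))"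
    using F j by (intro sum.cong refl) (auto simp: jw_commutes_def)
  also have "\<dots> = (\<Sum>t=1..m. \<Sum>k\<in>?J. avg X i k * act_in n G p t F k j)"
    unfolding sum_distrib_left by (rule sum.swap)
  also have "\<dots> = (\<Sum>t=1..m. \<Sum>k\<in>?J. act_out n G p t (avg X) i k * F k j)"
    by (intro sum.cong refl sum_by_parts) auto
  also have "\<dots> = (\<Sum>k\<in>?J. (\<Sum>t=1..m. act_out n G p t (avg X) i k) * F k j)"
    unfolding sum_distrib_right by (rule sum.swap)
  also have "\<dots> = (\<Sum>k\<in>?J. avg (\<lambda>i j. \<Sum>t=1..m. act_out n G p t X i j) i k * F k j)"
    using avg_act_out[OF G i] by (intro sum.cong refl) (simp add: avg_sum)
  finally show "(\<Sum>k\<in>?J. F i k * avg (\<lambda>i j. \<Sum>t=1..m. act_out n G p t X i j) k j) =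
      (\<Sum>k\<in>?J. avg (\<lambda>i j. \<Sum>t=1..m. act_out n G p t X i j) i k * F k j)" .
qed

text \<open>Only identity factors are exchanged. The sign is trivial because at a nonzero entry the
  two indices agree beyond \<open>d\<close>, and below that \<open>admissible_fixing\<close>
  applies.\<close>

lemma conj_mperm_lead_transpose:
  assumes t: "t \<in> {Suc d..m}" and i: "i \<in> multi n m" and j: "j \<in> multi n m"
  defines "g \<equiv> (transpose (Suc d) t, {} :: nat set)"
  shows "conj_mperm (w g) g (lead m d a b) i j = lead m d a b i j"
proof -
  have g: "g \<in> mperms m"
    using t by (auto simp: g_def mperms_def intro!: permutes_swap_id)
  have low: "mact g i k = i k" if "k \<in> {1..d}" for i k
    using that t by (auto simp: g_def mact_def transpose_def)
  have image: "transpose (Suc d) t ` {Suc d..m} = {Suc d..m}"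
    using t by (intro permutes_image permutes_swap_id) auto
  have "(\<forall>k\<in>{Suc d..m}. i (transpose (Suc d) t k) = j (transpose (Suc d) t k)) \<longleftrightarrow>
      (\<forall>k\<in>transpose (Suc d) t ` {Suc d..m}. i k = j k)"
    by blast
  then have "(\<forall>k\<in>{Suc d..m}. i (transpose (Suc d) t k) = j (transpose (Suc d) t k)) \<longleftrightarrow>
      (\<forall>k\<in>{Suc d..m}. i k = j k)"
    unfolding image .
  moreover have "{1..m} - {1..d} = {Suc d..m}" by auto
  ultimately have "(\<forall>k\<in>{1..m} - {1..d}. mact g i k = mact g j k) \<longleftrightarrow>
      (\<forall>k\<in>{1..m} - {1..d}. i k = j k)"
    by (simp add: g_def mact_def)
  then have lead: "lead m d a b (mact g i) (mact g j) = lead m d a b i j"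
    by (simp add: lead_def low)
  have "even (w g i) \<longleftrightarrow> even (w g j)" if "lead m d a b i j \<noteq> 0"
    by (rule admissible_fixing[OF g adm[OF g], where d = d])
      (use that i j t in \<open>auto simp: g_def lead_def transpose_def split: if_splits\<close>)
  then have "(-1 :: complex) ^ (w g i + w g j) = 1" if "lead m d a b i j \<noteq> 0"
    using that by simp
  then show ?thesis unfolding conj_mperm_def lead by auto
qed

text \<open>The mark sits on the last occupied position, so no prefix sum of an occupied position
  sees it and no sign arises.\<close>

lemma conj_mperm_lead_bar:
  assumes d: "Suc d \<le> m" and i: "i \<in> multi n m" and j: "j \<in> multi n m"
  defines "g \<equiv> (id, {Suc d})"
  shows "conj_mperm (w g) g (lead m (Suc d) a b) i j =
    lead m (Suc d) (a(Suc d := bar (a (Suc d)))) (b(Suc d := bar (b (Suc d)))) i j"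
proof -
  have g: "g \<in> mperms m"
    using d by (auto simp: g_def mperms_def permutes_id)
  have bar: "bar x = y \<longleftrightarrow> x = bar y" for x y by auto
  have lead: "lead m (Suc d) a b (mact g i) (mact g j) =
      lead m (Suc d) (a(Suc d := bar (a (Suc d)))) (b(Suc d := bar (b (Suc d)))) i j" (is "_ = ?l")
    by (auto simp: lead_def g_def mact_def bar)
  have "even (w g i) \<longleftrightarrow> even (w g j)" if "?l \<noteq> 0"
    by (rule admissible_fixing[OF g adm[OF g], where d = "Suc d"])
      (use that i j d in \<open>auto simp: g_def lead_def split: if_splits\<close>)
  then have "(-1 :: complex) ^ (w g i + w g j) = 1" if "?l \<noteq> 0"
    using that by simp
  then show ?thesis unfolding conj_mperm_def lead by auto
qed

text \<open>Acting on a matrix unit in \<open>d\<close> positions gives a sum over all positions.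
  Those up to \<open>d\<close> are covered by the induction hypothesis; those beyond
  \<open>d\<close> have equal averages, since transpositions of free positions fix the matrix unit.
  What remains is a multiple of the action at position \<open>Suc d\<close>, whose two bar-conjugate
  terms also have equal averages.\<close>

lemma central_lead:
  assumes F: "\<And>p G. p \<in> {0, 1} \<Longrightarrow> queer_matrix n p G \<Longrightarrow> jw_commutes n m G p F"
    and d: "d \<le> m" and b: "\<And>k. k \<in> {1..d} \<Longrightarrow> b k \<in> idxs n"
  shows "central F (lead m d a b)"
  using d b
proof (induction d arbitrary: a b)
  case 0
  \<comment> \<open>\<open>lead m 0 a b\<close> is the identity matrix, which every conjugation
    fixes.\<close>
  have "avg (lead m 0 a b) i j = (if i = j then of_nat (card (mperms m)) else 0)"
    if "i \<in> multi n m" "j \<in> multi n m" for i j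
  proof -
    have "lead m 0 a b (mact h i) (mact h j) = (if i = j then 1 else 0)" if h: "h \<in> mperms m" for h
    proof -
      have "lead m 0 a b (mact h i) (mact h j) = (if mact h i = mact h j then 1 else 0)"
        using multi_eqI[OF mact_in_multi[OF h \<open>i \<in> _\<close>] mact_in_multi[OF h \<open>j \<in> _\<close>]]
        by (auto simp: lead_def)
      then show ?thesis using mact_inj[OF h, of i j] by auto
    qed
    then show ?thesis by (simp add: avg_def conj_mperm_def)
  qed
  then have "(\<Sum>k\<in>multi n m. F i k * avg (lead m 0 a b) k j) =
      (\<Sum>k\<in>multi n m. F i k * (if k = j then of_nat (card (mperms m)) else 0))"
    "(\<Sum>k\<in>multi n m. avg (lead m 0 a b) i k * F k j) =
      (\<Sum>k\<in>multi n m. (if i = k then of_nat (card (mperms m)) else 0) * F k j)"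
    if "i \<in> multi n m" "j \<in> multi n m" for i j
    using that by (auto intro!: sum.cong)
  then show ?case by (simp add: central_def if_distrib if_distribR cong: if_cong)
next
  case (Suc d)
  define x where "x = b (Suc d)"
  define y where "y = a (Suc d)"
  define p where "p = (par x + par y) mod 2"
  define G where "G = (\<lambda>u v. if u = x \<and> v = y \<or> u = bar x \<and> v = bar y then 1 else 0 :: complex)"
  have bar: "bar x = y \<longleftrightarrow> x = bar y" for x y by auto
  have G: "queer_matrix n p G"
    by (auto simp: queer_matrix_def G_def p_def bar mod2_eq_if split: if_splits)
  have p: "p \<in> {0, 1}" by (auto simp: p_def)
  have b: "b k \<in> idxs n" if "k \<in> {1..d}" for k using Suc.prems(2)[of k] that by auto
  have IH: "central F (lead m d a' b')" if "\<And>k. k \<in> {1..d} \<Longrightarrow> b' k \<in> idxs n" for a' b'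
    using Suc.IH[of b' a'] Suc.prems(1) that by auto
  have all: "central F (\<lambda>i j. \<Sum>t=1..m. act_out n G p t (lead m d a b) i j)"
    using central_act_out[OF G F[OF p G] IH[OF b]] .
  have low: "central F (act_out n G p t (lead m d a b))" if t: "t \<in> {1..d}" for t
  proof -
    have "central F (\<lambda>i j. \<Sum>z\<in>idxs n. G z (b t) * (-1) ^ (p * pre b t) * lead m d a (b(t := z)) i j)"
      by (intro central_sum central_scale IH) (use b in auto)
    then show ?thesis
      by (rule central_avg_cong[rotated])
        (use act_out_lead_le[where b = b and n = n and m = m, OF t] b[OF t] Suc.prems(1)
          in \<open>auto intro!: avg_cong\<close>)
  qed
  have high: "avg (act_out n G p t (lead m d a b)) i j = avg (act_out n G p (Suc d) (lead m d a b)) i j"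
    if t: "t \<in> {Suc d..m}" and i: "i \<in> multi n m" and j: "j \<in> multi n m" for t i j
  proof -
    let ?g = "(transpose (Suc d) t, {} :: nat set)"
    have g: "?g \<in> mperms m"
      using t by (auto simp: mperms_def intro!: permutes_swap_id)
    have "avg (act_out n G p t (lead m d a b)) i j =
        avg (conj_mperm (w ?g) ?g (act_out n G p t (lead m d a b))) i j"
      using avg_conj_mperm[OF g i j] by simp
    also have "\<dots> = avg (act_out n G p (Suc d) (lead m d a b)) i j"
    proof (rule avg_cong[OF _ i j])
      fix i j assume i: "i \<in> multi n m" and j: "j \<in> multi n m"
      have "conj_mperm (w ?g) ?g (act_out n G p t (lead m d a b)) i j =
          act_out n G p (Suc d) (conj_mperm (w ?g) ?g (lead m d a b)) i j"
        using conj_mperm_act_out[OF g adm[OF g] G i j, of t] t by simp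
      also have "\<dots> = act_out n G p (Suc d) (lead m d a b) i j"
        by (rule act_out_cong[OF conj_mperm_lead_transpose[OF t] _ i j]) (use t in auto)
      finally show "conj_mperm (w ?g) ?g (act_out n G p t (lead m d a b)) i j =
          act_out n G p (Suc d) (lead m d a b) i j" .
    qed
    finally show ?thesis .
  qed
  let ?X = "act_out n G p (Suc d) (lead m d a b)"
  let ?Y = "\<lambda>i j. (\<Sum>t=1..m. act_out n G p t (lead m d a b) i j) +
    (-1) * (\<Sum>t=1..d. act_out n G p t (lead m d a b) i j)"
  have Y: "central F ?Y"
    by (intro central_add central_scale all central_sum low)
  have avgY: "avg ?Y i j = of_nat (m - d) * avg ?X i j"
    if "i \<in> multi n m" "j \<in> multi n m" for i j
  proof -
    have "{1..m} = {1..d} \<union> {Suc d..m}" "{1..d} \<inter> {Suc d..m} = {}" using Suc.prems(1) by auto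
    then have "(\<Sum>t=1..m. avg (act_out n G p t (lead m d a b)) i j) =
        (\<Sum>t=1..d. avg (act_out n G p t (lead m d a b)) i j) +
        (\<Sum>t=Suc d..m. avg (act_out n G p t (lead m d a b)) i j)"
      by (simp add: sum.union_disjoint)
    moreover have "(\<Sum>t=Suc d..m. avg (act_out n G p t (lead m d a b)) i j) = (\<Sum>t=Suc d..m. avg ?X i j)"
      by (intro sum.cong refl high that)
    ultimately show ?thesis
      unfolding avg_add avg_scale avg_sum by simp
  qed
  \<comment> \<open>There are \<open>m - d\<close> free positions, a nonzero number because
    \<open>Suc d \<le> m\<close>.\<close>
  have "central F (\<lambda>i j. of_nat (m - d) * ?X i j)"
    by (rule central_avg_cong[OF _ Y]) (simp only: avgY avg_scale)
  then have "central F (\<lambda>i j. (1 / of_nat (m - d)) * (of_nat (m - d) * ?X i j))"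
    by (rule central_scale)
  then have "central F ?X"
    by (rule central_avg_cong[rotated], intro avg_cong) (use Suc.prems(1) in auto)
  \<comment> \<open>The sign undoes the prefix sign of \<open>act_out_lead_Suc\<close>; the 2 counts
    the matrix unit and its bar-conjugate.\<close>
  then have "central F (\<lambda>i j. ((-1) ^ (p * pre b (Suc d)) / 2) * ?X i j)"
    by (rule central_scale)
  then show ?case
  proof (rule central_avg_cong[rotated])
    fix i j assume i: "i \<in> multi n m" and j: "j \<in> multi n m"
    let ?g = "(id, {Suc d})"
    let ?L' = "lead m (Suc d) (a(Suc d := bar (a (Suc d)))) (b(Suc d := bar (b (Suc d))))"
    have g: "?g \<in> mperms m"
      using Suc.prems(1) by (auto simp: mperms_def permutes_id)
    have "avg (lead m (Suc d) a b) i j = avg (conj_mperm (w ?g) ?g (lead m (Suc d) a b)) i j"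
      using avg_conj_mperm[OF g i j] by simp
    also have "\<dots> = avg ?L' i j"
      by (rule avg_cong[OF _ i j]) (rule conj_mperm_lead_bar[OF Suc.prems(1)])
    finally have 1: "avg ?L' i j = avg (lead m (Suc d) a b) i j" by simp
    have "avg ?X i j = avg (\<lambda>i j. (-1) ^ (p * pre b (Suc d)) * (lead m (Suc d) a b i j + ?L' i j)) i j"
      using act_out_lead_Suc[OF Suc.prems(1), of _ n _ x y p a b]
      by (intro avg_cong i j) (simp add: G_def x_def y_def)
    also have "\<dots> = (-1) ^ (p * pre b (Suc d)) * (2 * avg (lead m (Suc d) a b) i j)"
      unfolding avg_scale avg_add 1 by simp
    finally show "avg (\<lambda>i j. ((-1) ^ (p * pre b (Suc d)) / 2) * ?X i j) i j = avg (lead m (Suc d) a b) i j"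
      unfolding avg_scale by (simp add: power_add[symmetric])
  qed
qed

section \<open>The signed marked permutations span the commutant\<close>

definition mperm_matrix :: "mperm \<Rightarrow> midx \<Rightarrow> midx \<Rightarrow> complex" where
  "mperm_matrix h i j = (if mact h i = j then (-1) ^ w h i else 0)"

lemma avg_lead:
  assumes "i \<in> multi n m" "j \<in> multi n m" "a \<in> multi n m" "b \<in> multi n m"
  shows "avg (lead m m a b) i j = (\<Sum>h\<in>mperms m. mperm_matrix h i a * mperm_matrix h j b)"
  unfolding avg_def
proof (rule sum.cong[OF refl])
  fix h assume h: "h \<in> mperms m"
  have "lead m m a b (mact h i) (mact h j) = (if mact h i = a \<and> mact h j = b then 1 else 0)"
    using multi_eqI[OF mact_in_multi[OF h assms(1)] assms(3)] multi_eqI[OF mact_in_multi[OF h assms(2)] assms(4)]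
    by (auto simp: lead_def)
  then show "conj_mperm (w h) h (lead m m a b) i j = mperm_matrix h i a * mperm_matrix h j b"
    by (simp add: conj_mperm_def mperm_matrix_def power_add)
qed

text \<open>
  Semisimplicity enters only through the identity \<open>\<Sum>\<^sub>h \<phi>(h) h = id\<close>, where \<open>h\<close> runs over the signed
  marked permutations and \<open>\<phi>\<close> is linear in the matrix of \<open>h\<close>.
\<close>

lemma identity_functional:
  "\<exists>\<phi>. \<forall>k\<in>multi n m. \<forall>a\<in>multi n m.
    (\<Sum>h\<in>mperms m. mperm_matrix h k a * (\<Sum>j\<in>multi n m. \<Sum>b\<in>multi n m. \<phi> j b * mperm_matrix h j b)) =
    (if k = a then 1 else 0)"
proof -
  let ?J = "multi n m"
  let ?e = "(id, {}) :: mperm"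
  define g where "g = (\<lambda>(i, j) h. if mact h i = j then (-1 :: real) ^ w h i else 0)"
  have g: "mperm_matrix h i j = of_real (g (i, j) h)" for h i j
    by (simp add: g_def mperm_matrix_def)
  have e: "?e \<in> mperms m" by (simp add: mperms_def permutes_id)
  \<comment> \<open>The entries of the matrices are regarded as functions of \<open>h\<close>. The
    indicator function of the identity is projected to their span; its pairing with every entry is
    preserved, which gives the matrix of the identity permutation.\<close>
  obtain \<phi> where \<phi>: "\<forall>q\<in>?J \<times> ?J. (\<Sum>h\<in>mperms m. g q h * (\<Sum>q'\<in>?J \<times> ?J. \<phi> q' * g q' h)) =
      (\<Sum>h\<in>mperms m. g q h * (if h = ?e then 1 else 0))"
    using orthogonal_projection_exists[of "?J \<times> ?J" "mperms m" g "\<lambda>h. if h = ?e then 1 else 0"] by auto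
  \<comment> \<open>The identity permutation acts by a constant sign, which need not be 1; \<phi> is
    rescaled by it below.\<close>
  have par_e: "even (w ?e k + w ?e a)" if "k \<in> ?J" "a \<in> ?J" for k a
  proof -
    have "even (w ?e k) \<longleftrightarrow> even (w ?e a)"
      by (rule admissible_fixing[OF e adm[OF e], where d = m]) (use that in auto)
    then show ?thesis by simp
  qed
  show ?thesis
  proof (cases "?J = {}")
    case True
    then show ?thesis by auto
  next
    case False
    then obtain l where l: "l \<in> ?J" by auto
    show ?thesis
    proof (intro exI ballI)
      fix k a assume k: "k \<in> ?J" and a: "a \<in> ?J"
      have "(\<Sum>h\<in>mperms m. g (k, a) h * (\<Sum>q'\<in>?J \<times> ?J. \<phi> q' * g q' h)) = g (k, a) ?e"
        using \<phi> k a e by (simp add: if_distrib cong: if_cong)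
      then have "(\<Sum>h\<in>mperms m. g (k, a) h * (\<Sum>j\<in>?J. \<Sum>b\<in>?J. \<phi> (j, b) * g (j, b) h)) = g (k, a) ?e"
        by (simp add: sum.cartesian_product)
      then have *: "(\<Sum>h\<in>mperms m. mperm_matrix h k a * (\<Sum>j\<in>?J. \<Sum>b\<in>?J. of_real (\<phi> (j, b)) * mperm_matrix h j b)) =
          of_real (g (k, a) ?e)"
        unfolding g of_real_mult[symmetric] of_real_sum[symmetric] by simp
      have "(\<Sum>h\<in>mperms m. mperm_matrix h k a *
          (\<Sum>j\<in>?J. \<Sum>b\<in>?J. ((-1) ^ w ?e l * of_real (\<phi> (j, b))) * mperm_matrix h j b)) =
          (-1) ^ w ?e l * of_real (g (k, a) ?e)"
        unfolding *[symmetric] sum_distrib_left by (simp add: mult_ac)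
      also have "\<dots> = (if k = a then 1 else 0)"
        using par_e[OF l k] by (simp add: g_def mact_def power_add[symmetric])
      finally show "(\<Sum>h\<in>mperms m. mperm_matrix h k a *
          (\<Sum>j\<in>?J. \<Sum>b\<in>?J. ((-1) ^ w ?e l * of_real (\<phi> (j, b))) * mperm_matrix h j b)) =
          (if k = a then 1 else 0)" .
    qed
  qed
qed

text \<open>The averaged matrix unit is a sum of products of an entry at \<open>(i, a)\<close> with
  an entry at \<open>(j, b)\<close>. Contracting \<open>(j, b)\<close> with \<phi> collapses the sum
  over \<open>h\<close> to the identity on one side, while on the other side the entry at
  \<open>(i, a)\<close> remains.\<close>

lemma commutant_spanned:
  assumes F: "\<And>p G. p \<in> {0, 1} \<Longrightarrow> queer_matrix n p G \<Longrightarrow> jw_commutes n m G p F"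
  obtains c where "\<And>i j. i \<in> multi n m \<Longrightarrow> j \<in> multi n m \<Longrightarrow>
    F i j = (\<Sum>h\<in>mperms m. c h * mperm_matrix h i j)"
proof -
  let ?J = "multi n m"
  obtain \<phi> where \<phi>: "\<And>k a. k \<in> ?J \<Longrightarrow> a \<in> ?J \<Longrightarrow>
      (\<Sum>h\<in>mperms m. mperm_matrix h k a * (\<Sum>j\<in>?J. \<Sum>b\<in>?J. \<phi> j b * mperm_matrix h j b)) =
      (if k = a then 1 else 0)"
    using identity_functional by blast
  have comm: "(\<Sum>k\<in>?J. F i k * (\<Sum>h\<in>mperms m. mperm_matrix h k a * mperm_matrix h j b)) =
      (\<Sum>k\<in>?J. (\<Sum>h\<in>mperms m. mperm_matrix h i a * mperm_matrix h k b) * F k j)"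
    if "i \<in> ?J" "j \<in> ?J" "a \<in> ?J" "b \<in> ?J" for i j a b
  proof -
    have "central F (lead m m a b)"
      by (rule central_lead[OF F]) (use that multi_in in auto)
    then show ?thesis using that by (simp add: central_def avg_lead cong: sum.cong)
  qed
  \<comment> \<open>What the contraction leaves on the other side as coefficient of
    \<open>mperm_matrix h i a\<close>.\<close>
  define c where "c = (\<lambda>h. \<Sum>j\<in>?J. \<Sum>b\<in>?J. \<Sum>k\<in>?J. \<phi> j b * mperm_matrix h k b * F k j)"
  show ?thesis
  proof (rule that[of c])
    fix i a assume i: "i \<in> ?J" and a: "a \<in> ?J"
    have "F i a = (\<Sum>k\<in>?J. F i k * (if k = a then 1 else 0))"
      using a by (simp add: if_distrib cong: if_cong)
    also have "\<dots> = (\<Sum>k\<in>?J. F i k * (\<Sum>h\<in>mperms m. mperm_matrix h k a *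
        (\<Sum>j\<in>?J. \<Sum>b\<in>?J. \<phi> j b * mperm_matrix h j b)))"
      using \<phi> a by (intro sum.cong refl) auto
    also have "\<dots> = (\<Sum>k\<in>?J. \<Sum>h\<in>mperms m. \<Sum>j\<in>?J. \<Sum>b\<in>?J. 
        \<phi> j b * (F i k * (mperm_matrix h k a * mperm_matrix h j b)))"
      by (simp add: sum_distrib_left mult_ac)
    also have "\<dots> = (\<Sum>k\<in>?J. \<Sum>j\<in>?J. \<Sum>h\<in>mperms m. \<Sum>b\<in>?J. 
        \<phi> j b * (F i k * (mperm_matrix h k a * mperm_matrix h j b)))"
      by (intro sum.cong refl sum.swap)
    also have "\<dots> = (\<Sum>k\<in>?J. \<Sum>j\<in>?J. \<Sum>b\<in>?J. \<Sum>h\<in>mperms m. 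
        \<phi> j b * (F i k * (mperm_matrix h k a * mperm_matrix h j b)))"
      by (intro sum.cong refl sum.swap)
    also have "\<dots> = (\<Sum>j\<in>?J. \<Sum>k\<in>?J. \<Sum>b\<in>?J. \<Sum>h\<in>mperms m. 
        \<phi> j b * (F i k * (mperm_matrix h k a * mperm_matrix h j b)))"
      by (rule sum.swap)
    also have "\<dots> = (\<Sum>j\<in>?J. \<Sum>b\<in>?J. \<Sum>k\<in>?J. \<Sum>h\<in>mperms m. 
        \<phi> j b * (F i k * (mperm_matrix h k a * mperm_matrix h j b)))"
      by (intro sum.cong refl sum.swap)
    also have "\<dots> = (\<Sum>j\<in>?J. \<Sum>b\<in>?J. \<phi> j b *
        (\<Sum>k\<in>?J. F i k * (\<Sum>h\<in>mperms m. mperm_matrix h k a * mperm_matrix h j b)))"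
      by (simp add: sum_distrib_left)
    also have "\<dots> = (\<Sum>j\<in>?J. \<Sum>b\<in>?J. \<phi> j b *
        (\<Sum>k\<in>?J. (\<Sum>h\<in>mperms m. mperm_matrix h i a * mperm_matrix h k b) * F k j))"
      using comm i a by (intro sum.cong refl) auto
    also have "\<dots> = (\<Sum>j\<in>?J. \<Sum>b\<in>?J. \<Sum>k\<in>?J. \<Sum>h\<in>mperms m. 
        \<phi> j b * mperm_matrix h k b * F k j * mperm_matrix h i a)"
      by (simp add: sum_distrib_left sum_distrib_right mult_ac)
    also have "\<dots> = (\<Sum>j\<in>?J. \<Sum>b\<in>?J. \<Sum>h\<in>mperms m. \<Sum>k\<in>?J. 
        \<phi> j b * mperm_matrix h k b * F k j * mperm_matrix h i a)"
      by (intro sum.cong refl sum.swap)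
    also have "\<dots> = (\<Sum>j\<in>?J. \<Sum>h\<in>mperms m. \<Sum>b\<in>?J. \<Sum>k\<in>?J. 
        \<phi> j b * mperm_matrix h k b * F k j * mperm_matrix h i a)"
      by (intro sum.cong refl sum.swap)
    also have "\<dots> = (\<Sum>h\<in>mperms m. \<Sum>j\<in>?J. \<Sum>b\<in>?J. \<Sum>k\<in>?J. 
        \<phi> j b * mperm_matrix h k b * F k j * mperm_matrix h i a)"
      by (rule sum.swap)
    also have "\<dots> = (\<Sum>h\<in>mperms m. c h * mperm_matrix h i a)"
      by (simp add: c_def sum_distrib_right)
    finally show "F i a = (\<Sum>h\<in>mperms m. c h * mperm_matrix h i a)" .
  qed
qed

end

section \<open>Superdiagrams as marked permutations\<close>

definition vert_b :: "nat \<Rightarrow> nat \<Rightarrow> vertex" where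
  "vert_b r b = (if b \<le> r then Bot b else Top b)"

definition vert_t :: "nat \<Rightarrow> nat \<Rightarrow> vertex" where
  "vert_t r t = (if t \<le> r then Top t else Bot t)"

lemma ends_medge_eq: "ends (medge r b t) = {vert_b r b, vert_t r t}"
  by (auto simp: medge_def vert_b_def vert_t_def)

lemma vert_inject [simp]:
  "vert_b r b = vert_b r b' \<longleftrightarrow> b = b'" "vert_t r t = vert_t r t' \<longleftrightarrow> t = t'"
  "vert_b r b \<noteq> vert_t r t" "vert_t r t \<noteq> vert_b r b"
  by (auto simp: vert_b_def vert_t_def split: if_splits)

lemma vertices_eq: "vertices m = vert_b r ` {1..m} \<union> vert_t r ` {1..m}"
  by (auto simp: vertices_def vert_b_def vert_t_def image_iff)

lemma vert_in_vertices [simp]: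
  "vert_b r b \<in> vertices m \<longleftrightarrow> b \<in> {1..m}" "vert_t r t \<in> vertices m \<longleftrightarrow> t \<in> {1..m}"
  by (auto simp: vertices_def vert_b_def vert_t_def)

text \<open>The wall condition is bipartiteness in disguise: an edge must join a vertex of the first
  kind, \<open>vert_b\<close>, to one of the second kind, \<open>vert_t\<close>.\<close>

lemma wall_ok_iff: "wall_ok r e \<longleftrightarrow> (\<exists>b t. e = medge r b t)"
proof
  assume "wall_ok r e"
  show "\<exists>b t. e = medge r b t"
  proof (cases e)
    case (Vert b t)
    then show ?thesis
      using \<open>wall_ok r e\<close> by (cases "b \<le> r") (auto simp: medge_def intro: exI[of _ b] exI[of _ t])
  next
    case (HBot a c)
    then show ?thesis
      using \<open>wall_ok r e\<close> by (intro exI[of _ a] exI[of _ c]) (auto simp: medge_def)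
  next
    case (HTop a c)
    then show ?thesis
      using \<open>wall_ok r e\<close> by (intro exI[of _ c] exI[of _ a]) (auto simp: medge_def)
  qed
qed (auto simp: medge_def)

lemma dgm_in_superdiagrams:
  assumes h: "h \<in> mperms (r + s)"
  shows "dgm r (r + s) h \<in> superdiagrams r s"
proof -
  let ?S = "{1..r + s}"
  let ?f = "\<lambda>t. medge r (fst h t) t"
  have \<pi>: "fst h permutes ?S" using mperms_fst[OF h] .
  have \<pi>S: "fst h t \<in> ?S" if "t \<in> ?S" for t using permutes_in_image[OF \<pi>] that by blast
  have uniq: "\<exists>!e. e \<in> ?f ` ?S \<and> v \<in> ends e" if v: "v \<in> vertices (r + s)" for v
  proof -
    consider k where "k \<in> ?S" "v = vert_b r k" | k where "k \<in> ?S" "v = vert_t r k"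
      using v unfolding vertices_eq[of _ r] by blast
    then show ?thesis
    proof cases
      case 1
      obtain t where t: "k = fst h t" using permutes_surj[OF \<pi>] by (metis surjD)
      then have "t \<in> ?S" using 1 permutes_in_image[OF \<pi>] by blast
      then show ?thesis
        using 1 t permutes_inj[OF \<pi>]
        by (intro ex1I[of _ "?f t"]) (auto simp: ends_medge_eq inj_eq)
    next
      case 2
      then show ?thesis
        by (intro ex1I[of _ "?f k"]) (auto simp: ends_medge_eq)
    qed
  qed
  have wall: "ends e \<subseteq> vertices (r + s) \<and> wall_ok r e" if "e \<in> ?f ` ?S" for e
    using that \<pi>S by (auto simp: ends_medge_eq wall_ok_iff simp del: atLeastAtMost_iff)
  have "?f ` snd h \<subseteq> ?f ` ?S" using mperms_snd[OF h] by auto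
  then show ?thesis
    unfolding dgm_def superdiagrams_def mem_Collect_eq prod.case
    by (intro conjI ballI uniq wall[THEN conjunct1] wall[THEN conjunct2])
qed

text \<open>A perfect matching of a bipartite graph on two copies of \<open>{1..r + s}\<close> is a
  permutation.\<close>

lemma superdiagrams_eq: "superdiagrams r s = dgm r (r + s) ` mperms (r + s)"
proof (intro equalityI subsetI)
  fix d assume d: "d \<in> superdiagrams r s"
  let ?S = "{1..r + s}"
  obtain E M where EM: "d = (E, M)" by force
  have E: "\<And>e. e \<in> E \<Longrightarrow> ends e \<subseteq> vertices (r + s) \<and> wall_ok r e"
    "\<And>v. v \<in> vertices (r + s) \<Longrightarrow> \<exists>!e. e \<in> E \<and> v \<in> ends e" "M \<subseteq> E"
    using d unfolding EM superdiagrams_def by blast+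
  have shape: "\<exists>b\<in>?S. \<exists>t\<in>?S. e = medge r b t" if "e \<in> E" for e
    using E(1)[OF that] unfolding wall_ok_iff by (auto simp: ends_medge_eq simp del: atLeastAtMost_iff)
  have ext: "\<exists>!b. medge r b t \<in> E" if t: "t \<in> ?S" for t
  proof -
    obtain e where e: "e \<in> E" "vert_t r t \<in> ends e" using E(2)[of "vert_t r t"] t by auto
    then obtain b where b: "medge r b t \<in> E"
      using shape[OF e(1)] by (auto simp: ends_medge_eq)
    have "b' = b" if "medge r b' t \<in> E" for b'
    proof -
      have "\<exists>!e. e \<in> E \<and> vert_t r t \<in> ends e" using E(2) t by simp
      moreover have "vert_t r t \<in> ends (medge r b' t)" "vert_t r t \<in> ends (medge r b t)"
        by (simp_all add: ends_medge_eq)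
      ultimately have "medge r b' t = medge r b t" using that b by blast
      then show ?thesis by simp
    qed
    then show ?thesis using b by blast
  qed
  have uniq: "t = t'" if "medge r b t \<in> E" "medge r b t' \<in> E" for b t t'
  proof -
    have "b \<in> ?S" using shape[OF that(1)] by auto
    then have "\<exists>!e. e \<in> E \<and> vert_b r b \<in> ends e" using E(2) by simp
    moreover have "vert_b r b \<in> ends (medge r b t)" "vert_b r b \<in> ends (medge r b t')"
      by (simp_all add: ends_medge_eq)
    ultimately have "medge r b t = medge r b t'" using that by blast
    then show ?thesis by simp
  qed
  \<comment> \<open>The default value \<open>t\<close> outside \<open>?S\<close> is what
    \<open>permutes\<close> demands.\<close>
  define \<pi> where "\<pi> = (\<lambda>t. if t \<in> ?S then THE b. medge r b t \<in> E else t)"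
  have \<pi>: "medge r (\<pi> t) t \<in> E" if "t \<in> ?S" for t
    using theI'[OF ext[OF that]] that by (simp add: \<pi>_def)
  have "\<pi> ` ?S \<subseteq> ?S" using shape[OF \<pi>] by force
  moreover have "inj_on \<pi> ?S"
    using uniq \<pi> by (intro inj_onI) metis
  ultimately have "bij_betw \<pi> ?S ?S"
    using endo_inj_surj[of ?S \<pi>] by (simp add: bij_betw_def)
  then have perm: "\<pi> permutes ?S"
    by (rule bij_imp_permutes) (auto simp: \<pi>_def)
  have E_eq: "E = (\<lambda>t. medge r (\<pi> t) t) ` ?S"
  proof (intro equalityI subsetI)
    fix e assume e: "e \<in> E"
    then obtain b t where bt: "t \<in> ?S" "e = medge r b t" using shape by blast
    then have "b = \<pi> t" using ext[OF bt(1)] \<pi>[OF bt(1)] e by blast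
    then show "e \<in> (\<lambda>t. medge r (\<pi> t) t) ` ?S" using bt by blast
  qed (use \<pi> in auto)
  define \<mu> where "\<mu> = {t \<in> ?S. medge r (\<pi> t) t \<in> M}"
  have "M = (\<lambda>t. medge r (\<pi> t) t) ` \<mu>"
    using E(3) unfolding E_eq \<mu>_def by blast
  then have "d = dgm r (r + s) (\<pi>, \<mu>)" by (simp add: dgm_def EM E_eq)
  moreover have "(\<pi>, \<mu>) \<in> mperms (r + s)" using perm by (auto simp: mperms_def \<mu>_def)
  ultimately show "d \<in> dgm r (r + s) ` mperms (r + s)" by blast
qed (use dgm_in_superdiagrams in auto)

lemma dgm_inject:
  assumes h: "h \<in> mperms m" "h' \<in> mperms m" and eq: "dgm r m h = dgm r m h'"
  shows "h = h'"
proof (rule prod_eqI)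
  show "fst h = fst h'"
  proof
    fix t
    show "fst h t = fst h' t"
    proof (cases "t \<in> {1..m}")
      case True
      then have "medge r (fst h t) t \<in> (\<lambda>t. medge r (fst h' t) t) ` {1..m}"
        using eq by (auto simp: dgm_def)
      then show ?thesis by auto
    next
      case False
      then show ?thesis using permutes_not_in[OF mperms_fst] h by metis
    qed
  qed
  moreover have "(\<lambda>t. medge r (fst h t) t) ` snd h = (\<lambda>t. medge r (fst h' t) t) ` snd h'"
    using eq by (simp add: dgm_def)
  ultimately have "(\<lambda>t. medge r (fst h t) t) ` snd h = (\<lambda>t. medge r (fst h t) t) ` snd h'"
    by simp
  then show "snd h = snd h'"
    by (rule inj_image_eq_iff[THEN iffD1, rotated]) (simp add: inj_def)
qed

section \<open>Linear maps and their matrices\<close>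

lemma sum_apply: "(\<Sum>a\<in>A. f a) x = (\<Sum>a\<in>A. f a x :: 'c :: comm_monoid_add)"
  by (induction A rule: infinite_finite_induct) auto

lemma bvec_in_fspace [simp]: "b \<in> B \<Longrightarrow> bvec b \<in> fspace B"
  by (auto simp: fspace_def bvec_def)

lemma fspace_0 [simp]: "0 \<in> fspace B"
  by (simp add: fspace_def)

lemma fspace_add: "x \<in> fspace B \<Longrightarrow> y \<in> fspace B \<Longrightarrow> x + y \<in> fspace B"
  by (simp add: fspace_def)

lemma fspace_vscale: "x \<in> fspace B \<Longrightarrow> vscale c x \<in> fspace B"
  by (simp add: fspace_def vscale_def)

lemma fspace_sum: "(\<And>a. a \<in> A \<Longrightarrow> f a \<in> fspace B) \<Longrightarrow> (\<Sum>a\<in>A. f a) \<in> fspace B"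
  by (induction A rule: infinite_finite_induct) (auto simp: fspace_add)

lemma fspace_expand:
  assumes "finite B" "x \<in> fspace B"
  shows "x = (\<Sum>b\<in>B. vscale (x b) (bvec b))"
proof
  fix c
  have "(\<Sum>b\<in>B. vscale (x b) (bvec b)) c = (\<Sum>b\<in>B. if c = b then x b else 0)"
    unfolding sum_apply by (intro sum.cong) (auto simp: vscale_def bvec_def)
  then show "x c = (\<Sum>b\<in>B. vscale (x b) (bvec b)) c"
    using assms by (simp add: fspace_def)
qed

lemma endos_0:
  fixes f :: "('b \<Rightarrow> complex) \<Rightarrow> 'b \<Rightarrow> complex"
  shows "f \<in> endos B \<Longrightarrow> f 0 = 0"
proof -
  assume f: "f \<in> endos B"
  then have "f (vscale 0 0) = vscale 0 (f 0)"
    using fspace_0 unfolding endos_def mem_Collect_eq by metis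
  moreover have "vscale 0 y = 0" for y :: "'b \<Rightarrow> complex"
    by (simp add: vscale_def fun_eq_iff)
  ultimately show ?thesis by (simp only:)
qed

lemma endos_closed: "f \<in> endos B \<Longrightarrow> f x \<in> fspace B"
  by (cases "x \<in> fspace B") (auto simp: endos_def)

lemma endos_apply:
  assumes f: "f \<in> endos B" and B: "finite B" and x: "x \<in> fspace B"
  shows "f x c = (\<Sum>b\<in>B. x b * f (bvec b) c)"
proof -
  have "f (\<Sum>b\<in>A. vscale (x b) (bvec b)) = (\<Sum>b\<in>A. vscale (x b) (f (bvec b)))" if "A \<subseteq> B" for A
    using finite_subset[OF that B] that
  proof (induction A rule: finite_induct)
    case empty
    then show ?case by (simp only: sum.empty endos_0[OF f])
  next
    case (insert a A)
    have a: "bvec a \<in> fspace B" "vscale (x a) (bvec a) \<in> fspace B"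
      using insert.prems by (auto intro!: fspace_vscale)
    have A: "(\<Sum>b\<in>A. vscale (x b) (bvec b)) \<in> fspace B"
      using insert.prems by (intro fspace_sum fspace_vscale) auto
    have "f (vscale (x a) (bvec a) + (\<Sum>b\<in>A. vscale (x b) (bvec b))) =
        vscale (x a) (f (bvec a)) + f (\<Sum>b\<in>A. vscale (x b) (bvec b))"
      using f a A unfolding endos_def by auto
    then show ?case using insert by (simp only: sum.insert insert_subset simp_thms)
  qed
  from this[OF order_refl] show ?thesis
    using fspace_expand[OF B x] by (simp add: sum_apply vscale_def)
qed

lemma endos_eqI:
  assumes f: "f \<in> endos B" and g: "g \<in> endos B" and B: "finite B"
    and eq: "\<And>b c. b \<in> B \<Longrightarrow> c \<in> B \<Longrightarrow> f (bvec b) c = g (bvec b) c"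
  shows "f = g"
proof (intro ext)
  fix x c
  show "f x c = g x c"
  proof (cases "x \<in> fspace B \<and> c \<in> B")
    case True
    then have x: "x \<in> fspace B" and c: "c \<in> B" by auto
    show ?thesis
      unfolding endos_apply[OF f B x] endos_apply[OF g B x]
      by (intro sum.cong refl arg_cong2[where f = "(*)"] eq c)
  next
    case False
    then consider "x \<notin> fspace B" | "c \<notin> B" by blast
    then show ?thesis
    proof cases
      case 1
      then show ?thesis using f g by (auto simp: endos_def)
    next
      case 2
      then show ?thesis using endos_closed[OF f, of x] endos_closed[OF g, of x] by (simp add: fspace_def)
    qed
  qed
qed

lemma lin_ext_apply:
  "x \<in> fspace B \<Longrightarrow> lin_ext B h x c = (\<Sum>b\<in>B. x b * h b c)"
  by (simp add: lin_ext_def sum_apply vscale_def)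

lemma lin_ext_bvec:
  assumes "finite B" "b \<in> B"
  shows "lin_ext B h (bvec b) = h b"
proof
  fix c
  have "lin_ext B h (bvec b) c = (\<Sum>b'\<in>B. if b' = b then h b' c else 0)"
    unfolding lin_ext_apply[OF bvec_in_fspace[OF assms(2)]] by (intro sum.cong) (auto simp: bvec_def)
  then show "lin_ext B h (bvec b) c = h b c" using assms by simp
qed

lemma lin_ext_in_endos:
  assumes h: "\<And>b. b \<in> B \<Longrightarrow> h b \<in> fspace B"
  shows "lin_ext B h \<in> endos B"
  unfolding endos_def
proof (intro CollectI conjI ballI allI impI)
  fix x assume "x \<in> fspace B"
  then show "lin_ext B h x \<in> fspace B"
    unfolding lin_ext_def by (simp add: fspace_sum fspace_vscale h)
next
  fix x y assume "x \<in> fspace B" "y \<in> fspace B"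
  then show "lin_ext B h (x + y) = lin_ext B h x + lin_ext B h y"
    by (intro ext) (simp add: lin_ext_apply fspace_add distrib_right sum.distrib)
next
  fix c x assume "x \<in> fspace B"
  then show "lin_ext B h (vscale c x) = vscale c (lin_ext B h x)"
    by (intro ext, simp add: lin_ext_apply fspace_vscale)
      (simp add: vscale_def lin_ext_apply sum_distrib_left mult.assoc)
qed (auto simp: lin_ext_def)

lemma endos_comp: "f \<in> endos B \<Longrightarrow> g \<in> endos B \<Longrightarrow> f \<circ> g \<in> endos B"
  using endos_0[of f B] by (auto simp: endos_def)

lemma endos_mscale: "f \<in> endos B \<Longrightarrow> mscale c f \<in> endos B"
  by (auto simp: endos_def mscale_def vscale_def fspace_def fun_eq_iff algebra_simps)

lemma endos_add: "f \<in> endos B \<Longrightarrow> g \<in> endos B \<Longrightarrow> f + g \<in> endos B"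
  by (auto simp: endos_def vscale_def fspace_def fun_eq_iff algebra_simps)

lemma homogeneous_iff:
  fixes pr :: "'b \<Rightarrow> nat"
  assumes f: "f \<in> endos B" and B: "finite B" and pr: "\<And>b. b \<in> B \<Longrightarrow> pr b \<in> {0, 1}"
  shows "homogeneous B pr p f \<longleftrightarrow>
    (\<forall>b\<in>B. \<forall>c\<in>B. f (bvec b) c \<noteq> 0 \<longrightarrow> pr c = (p + pr b) mod 2)"
proof
  assume h: "homogeneous B pr p f"
  show "\<forall>b\<in>B. \<forall>c\<in>B. f (bvec b) c \<noteq> 0 \<longrightarrow> pr c = (p + pr b) mod 2"
  proof (intro ballI impI)
    fix b c assume b: "b \<in> B" and c: "c \<in> B" and ne: "f (bvec b) c \<noteq> 0"
    have "hproj pr (pr b) (bvec b) = bvec b" by (auto simp: hproj_def bvec_def)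
    then have "hproj pr ((p + pr b) mod 2) (f (bvec b)) = f (bvec b)"
      using h b pr[OF b] unfolding homogeneous_def by (metis bvec_in_fspace)
    then have "hproj pr ((p + pr b) mod 2) (f (bvec b)) c = f (bvec b) c" by simp
    then show "pr c = (p + pr b) mod 2" using ne by (auto simp: hproj_def split: if_splits)
  qed
next
  assume h: "\<forall>b\<in>B. \<forall>c\<in>B. f (bvec b) c \<noteq> 0 \<longrightarrow> pr c = (p + pr b) mod 2"
  show "homogeneous B pr p f"
    unfolding homogeneous_def
  proof (intro ballI impI ext)
    fix q x c assume q: "q \<in> {0, 1 :: nat}" and x: "x \<in> fspace B" and hx: "hproj pr q x = x"
    have xb: "x b = 0" if "pr b \<noteq> q" for b
      using fun_cong[OF hx, of b] that by (simp add: hproj_def)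
    have "f x c = 0" if c: "pr c \<noteq> (p + q) mod 2"
    proof (cases "c \<in> B")
      case True
      have "x b * f (bvec b) c = 0" if "b \<in> B" for b
        using h that True c xb[of b] by (cases "pr b = q") auto
      then show ?thesis unfolding endos_apply[OF f B x] by (intro sum.neutral) auto
    next
      case False
      then show ?thesis using endos_closed[OF f, of x] by (simp add: fspace_def)
    qed
    then show "hproj pr ((p + q) mod 2) (f x) c = f x c" by (auto simp: hproj_def)
  qed
qed

section \<open>The queer superalgebra in coordinates\<close>

lemma hproj_hproj:
  fixes pr :: "'b \<Rightarrow> nat"
  shows "hproj pr a (hproj pr b x) = (if a = b then hproj pr b x else 0)"
  by (auto simp: hproj_def fun_eq_iff)

lemma hproj_in_fspace:
  fixes pr :: "'b \<Rightarrow> nat"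
  shows "x \<in> fspace B \<Longrightarrow> hproj pr q x \<in> fspace B"
  by (auto simp: fspace_def hproj_def)

lemma hcomp_homogeneous:
  fixes pr :: "'b \<Rightarrow> nat"
  assumes f: "f \<in> endos B" "homogeneous B pr p f" and pr: "\<And>b. b \<in> B \<Longrightarrow> pr b \<in> {0, 1}"
    and p: "p \<in> {0, 1}" and q: "q \<in> {0, 1}"
  shows "hcomp B pr q f = (if q = p then f else 0)"
proof
  fix x
  show "hcomp B pr q f x = (if q = p then f else 0) x"
  proof (cases "x \<in> fspace B")
    case False
    then show ?thesis using f(1) by (auto simp: hcomp_def endos_def)
  next
    case True
    have comp: "f (hproj pr c x) = hproj pr ((p + c) mod 2) (f (hproj pr c x))" if "c \<in> {0, 1}" for c
      using f(2) that hproj_in_fspace[OF True] hproj_hproj[of pr c c x]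
      unfolding homogeneous_def by metis
    have "x b = (hproj pr 0 x + hproj pr 1 x) b" for b
      using True pr[of b] by (cases "b \<in> B") (auto simp: hproj_def fspace_def)
    then have x: "x = hproj pr 0 x + hproj pr 1 x" by blast
    have sum: "f (hproj pr 0 x) + f (hproj pr 1 x) = f x"
      using f(1) hproj_in_fspace[OF True] x unfolding endos_def mem_Collect_eq by metis
    have "hproj pr ((q + c) mod 2) (f (hproj pr c x)) = (if q = p then f (hproj pr c x) else 0)"
      if c: "c \<in> {0, 1}" for c
    proof -
      have "(q + c) mod 2 = (p + c) mod 2 \<longleftrightarrow> q = p" using p q by auto presburger+
      then show ?thesis using comp[OF c] hproj_hproj[of pr "(q + c) mod 2" "(p + c) mod 2" "f (hproj pr c x)"]
        by auto
    qed
    then show ?thesis using True sum by (simp add: hcomp_def)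
  qed
qed

lemma superbracket_homogeneous:
  fixes pr :: "'b \<Rightarrow> nat"
  assumes f: "f \<in> endos B" "homogeneous B pr p f" and g: "g \<in> endos B" "homogeneous B pr q g"
    and pr: "\<And>b. b \<in> B \<Longrightarrow> pr b \<in> {0, 1}" and p: "p \<in> {0, 1}" and q: "q \<in> {0, 1}"
  shows "superbracket B pr f g x = f (g x) - vscale ((-1) ^ (p * q)) (g (f x))"
proof -
  have hf: "hcomp B pr c f = (if c = p then f else 0)" if "c \<in> {0, 1}" for c
    using hcomp_homogeneous[OF f pr p that] .
  have hg: "hcomp B pr c g = (if c = q then g else 0)" if "c \<in> {0, 1}" for c
    using hcomp_homogeneous[OF g pr q that] .
  have 0: "f 0 = 0" "g 0 = 0" using endos_0 f g by auto
  have v: "vscale c 0 = 0" for c :: complex by (simp add: vscale_def fun_eq_iff)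
  show ?thesis
    unfolding superbracket_def using p q
    by (auto simp: hf hg 0[unfolded zero_fun_def] v[unfolded zero_fun_def] 0 v)
qed

lemma Pop_in_endos: "Pop n \<in> endos (idxs n)"
  unfolding Pop_def by (intro lin_ext_in_endos fspace_vscale bvec_in_fspace) simp

lemma Pop_bvec: "y \<in> idxs n \<Longrightarrow> Pop n (bvec y) = vscale ((-1) ^ (par y + 1)) (bvec (bar y))"
  unfolding Pop_def by (rule lin_ext_bvec) simp_all

lemma par_in: "par y \<in> {0, 1}"
  by (cases y) auto

lemma par_bar: "par (bar y) = 1 - par y"
  by (cases y) auto

lemma Pop_entry: "y \<in> idxs n \<Longrightarrow> Pop n (bvec y) x = (if x = bar y then (-1) ^ (par y + 1) else 0)"
  unfolding Pop_bvec by (simp add: vscale_def bvec_def)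

lemma Pop_homogeneous: "homogeneous (idxs n) par 1 (Pop n)"
  unfolding homogeneous_iff[OF Pop_in_endos finite_idxs par_in]
proof -
  have "1 - par b = (1 + par b) mod 2" for b by (cases b) auto
  then show "\<forall>b\<in>idxs n. \<forall>c\<in>idxs n. Pop n (bvec b) c \<noteq> 0 \<longrightarrow> par c = (1 + par b) mod 2"
    by (simp add: Pop_entry par_bar)
qed

text \<open>Entries of the wrong parity vanish on both sides by homogeneity. At the others, the sign
  of \<open>P\<close> on the input cancels against its sign on the output together with the
  supersign, so the condition itself is free of signs.\<close>

lemma queer_iff:
  assumes g: "g \<in> endos (idxs n)" "homogeneous (idxs n) par p g" and p: "p \<in> {0, 1}"
  shows "g \<in> queer n \<longleftrightarrow> (\<forall>x\<in>idxs n. \<forall>y\<in>idxs n. g (bvec (bar y)) x = g (bvec y) (bar x))"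
proof -
  let ?c = "(-1) ^ (p * 1) :: complex"
  have "g \<in> queer n \<longleftrightarrow> (\<forall>x. g (Pop n x) - vscale ?c (Pop n (g x)) = 0)"
    using g(1) superbracket_homogeneous[OF g Pop_in_endos Pop_homogeneous par_in p]
    by (auto simp: queer_def fun_eq_iff)
  also have "\<dots> \<longleftrightarrow> g \<circ> Pop n = mscale ?c (Pop n \<circ> g)"
    by (simp add: fun_eq_iff mscale_def)
  also have "\<dots> \<longleftrightarrow> (\<forall>x\<in>idxs n. \<forall>y\<in>idxs n.
      (g \<circ> Pop n) (bvec y) x = mscale ?c (Pop n \<circ> g) (bvec y) x)" (is "?l \<longleftrightarrow> ?r")
  proof
    assume ?r
    then show ?l
      by (intro endos_eqI[where B = "idxs n"] endos_comp endos_mscale g Pop_in_endos finite_idxs) auto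
  qed simp
  also have "\<dots> \<longleftrightarrow> (\<forall>x\<in>idxs n. \<forall>y\<in>idxs n. g (bvec (bar y)) x = g (bvec y) (bar x))"
  proof (intro ball_cong refl)
    fix x y assume x: "x \<in> idxs n" and y: "y \<in> idxs n"
    have 1: "(g \<circ> Pop n) (bvec y) x = (-1) ^ (par y + 1) * g (bvec (bar y)) x"
    proof -
      have "g (vscale ((-1) ^ (par y + 1)) (bvec (bar y))) = vscale ((-1) ^ (par y + 1)) (g (bvec (bar y)))"
        using g(1) y bvec_in_fspace[of "bar y" "idxs n"] unfolding endos_def by simp
      then show ?thesis by (simp add: Pop_bvec[OF y]) (simp add: vscale_def)
    qed
    have gy: "g (bvec y) \<in> fspace (idxs n)" using endos_closed[OF g(1)] .
    have "Pop n (g (bvec y)) x = (\<Sum>k\<in>idxs n. g (bvec y) k * Pop n (bvec k) x)"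
      by (rule endos_apply[OF Pop_in_endos finite_idxs gy])
    also have "\<dots> = (\<Sum>k\<in>idxs n. if k = bar x then g (bvec y) k * (-1) ^ (par k + 1) else 0)"
      by (intro sum.cong) (auto simp: Pop_entry)
    also have "\<dots> = g (bvec y) (bar x) * (-1) ^ (par (bar x) + 1)"
      using x by simp
    finally have 2: "mscale ?c (Pop n \<circ> g) (bvec y) x =
        (-1) ^ (p + (par (bar x) + 1)) * g (bvec y) (bar x)"
      by (simp add: mscale_def vscale_def power_add)
    have h: "\<And>a b. a \<in> idxs n \<Longrightarrow> b \<in> idxs n \<Longrightarrow> g (bvec a) b \<noteq> 0 \<Longrightarrow> par b = (p + par a) mod 2"
      using g(2) unfolding homogeneous_iff[OF g(1) finite_idxs par_in] by blast
    show "(g \<circ> Pop n) (bvec y) x = mscale ?c (Pop n \<circ> g) (bvec y) x \<longleftrightarrow>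
        g (bvec (bar y)) x = g (bvec y) (bar x)"
    proof (cases "par x = (p + par (bar y)) mod 2")
      case True
      then have "even (par y + 1 + (p + (par (bar x) + 1)))"
        using p par_in[of x] par_in[of y] unfolding par_bar by auto
      then have "(-1 :: complex) ^ (par y + 1) = (-1) ^ (p + (par (bar x) + 1))"
        by (rule minus_one_power_cong)
      then show ?thesis unfolding 1 2 by (simp del: power_Suc power_add)
    next
      case False
      then have "par (bar x) \<noteq> (p + par y) mod 2"
        using p par_in[of x] par_in[of y] unfolding par_bar by auto
      then have "g (bvec (bar y)) x = 0" "g (bvec y) (bar x) = 0"
        using False h[of "bar y" x] h[of y "bar x"] x y by auto
      then show ?thesis unfolding 1 2 by simp
    qed
  qed
  finally show ?thesis .
qed

lemma queer_matrix_of_queer: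
  assumes g: "g \<in> queer n" "homogeneous (idxs n) par p g" and p: "p \<in> {0, 1}"
  shows "queer_matrix n p (\<lambda>x y. g (bvec y) x)"
proof -
  have e: "g \<in> endos (idxs n)" using g(1) by (simp add: queer_def)
  have "g (bvec (bar y)) (bar x) = g (bvec y) x" if "x \<in> idxs n" "y \<in> idxs n" for x y
    using queer_iff[OF e g(2) p] g(1) that by (metis bar_bar bar_in_idxs)
  moreover have "even (par x + par y + p)" if "x \<in> idxs n" "y \<in> idxs n" "g (bvec y) x \<noteq> 0" for x y
    using g(2) that unfolding homogeneous_iff[OF e finite_idxs par_in] by fastforce
  ultimately show ?thesis by (simp add: queer_matrix_def)
qed

lemma queer_of_queer_matrix:
  assumes G: "queer_matrix n p G" and p: "p \<in> {0, 1}"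
  obtains g where "g \<in> queer n" "homogeneous (idxs n) par p g"
    "\<And>x y. x \<in> idxs n \<Longrightarrow> y \<in> idxs n \<Longrightarrow> g (bvec y) x = G x y"
proof -
  define g where "g = lin_ext (idxs n) (\<lambda>y x. if x \<in> idxs n then G x y else 0)"
  have e: "g \<in> endos (idxs n)"
    unfolding g_def by (rule lin_ext_in_endos) (simp add: fspace_def)
  have gG: "g (bvec y) x = G x y" if "x \<in> idxs n" "y \<in> idxs n" for x y
    using that by (simp add: g_def lin_ext_bvec)
  have h: "homogeneous (idxs n) par p g"
    unfolding homogeneous_iff[OF e finite_idxs par_in]
  proof (intro ballI impI)
    fix y x assume "y \<in> idxs n" "x \<in> idxs n" "g (bvec y) x \<noteq> 0"
    then have "even (par x + par y + p)" using G gG by (auto simp: queer_matrix_def)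
    then show "par x = (p + par y) mod 2" using par_in[of x] by auto presburger+
  qed
  have "g (bvec (bar y)) x = g (bvec y) (bar x)" if "x \<in> idxs n" "y \<in> idxs n" for x y
    using G that by (simp add: gG queer_matrix_def) (metis bar_bar bar_in_idxs)
  then have "g \<in> queer n" using queer_iff[OF e h p] by blast
  then show ?thesis using that h gG by blast
qed

section \<open>The action on the mixed tensor space in coordinates\<close>

definition factor_mat :: "nat \<Rightarrow> nat \<Rightarrow> (idx \<Rightarrow> idx \<Rightarrow> complex) \<Rightarrow> nat \<Rightarrow> idx \<Rightarrow> idx \<Rightarrow> complex" where
  "factor_mat r p G k z y = (if k \<le> r then G y z else - ((-1) ^ (p * par z)) * G z y)"

lemma factor_act_eq: "factor_act r p g k z y = factor_mat r p (\<lambda>x y. g (bvec y) x) k z y"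
  by (simp add: factor_act_def factor_mat_def dual_act_def wvec_def)

lemma rho_in_endos: "rho n r s p g \<in> endos (multi n (r + s))"
  unfolding rho_def
  by (intro lin_ext_in_endos fspace_sum fspace_vscale) (simp add: fspace_def pure_def)

lemma rho_entry:
  assumes i: "i \<in> multi n (r + s)" and j: "j \<in> multi n (r + s)"
  shows "rho n r s p g (bvec i) j = (\<Sum>l=1..r + s. (-1) ^ (p * pre i l) *
    (if \<forall>l'\<in>{1..r + s} - {l}. i l' = j l' then factor_mat r p (\<lambda>x y. g (bvec y) x) l (i l) (j l) else 0))"
proof -
  have "pure n (r + s) (\<lambda>l'. if l' = l then factor_act r p g l (i l) else bvec (i l')) j =
      (if \<forall>l'\<in>{1..r + s} - {l}. i l' = j l' then factor_mat r p (\<lambda>x y. g (bvec y) x) l (i l) (j l) else 0)"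
    if l: "l \<in> {1..r + s}" for l
  proof -
    have "pure n (r + s) (\<lambda>l'. if l' = l then factor_act r p g l (i l) else bvec (i l')) j =
        factor_act r p g l (i l) (j l) * (\<Prod>l'\<in>{1..r + s} - {l}. bvec (i l') (j l'))"
      using j prod.remove[OF _ l, of "\<lambda>l'. (if l' = l then factor_act r p g l (i l) else bvec (i l')) (j l')"]
      by (simp add: pure_def)
    also have "(\<Prod>l'\<in>{1..r + s} - {l}. bvec (i l') (j l')) = (\<Prod>l'\<in>{1..r + s} - {l}. of_bool (i l' = j l'))"
      by (intro prod.cong) (auto simp: bvec_def)
    also have "\<dots> = of_bool (\<forall>l'\<in>{1..r + s} - {l}. i l' = j l')"
      by (rule prod_of_bool) simp
    finally show ?thesis by (simp add: factor_act_eq)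
  qed
  then show ?thesis
    unfolding rho_def lin_ext_bvec[OF finite_multi i] sum_apply
    by (intro sum.cong refl) (simp add: vscale_def pre_def)
qed

lemma sum_agree_off:
  assumes l: "l \<in> {1..m}" and j: "j \<in> multi n m"
  shows "(\<Sum>k\<in>multi n m. if \<forall>l'\<in>{1..m} - {l}. k l' = j l' then Q k else 0) =
    (\<Sum>z\<in>idxs n. Q (j(l := z)) :: complex)"
proof -
  have "{k \<in> multi n m. \<forall>l'\<in>{1..m} - {l}. k l' = j l'} = (\<lambda>z. j(l := z)) ` idxs n"
  proof (intro equalityI subsetI)
    fix k assume k: "k \<in> {k \<in> multi n m. \<forall>l'\<in>{1..m} - {l}. k l' = j l'}"
    then have kl: "k l \<in> idxs n" using multi_in l by auto
    have "k = j(l := k l)"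
      by (rule multi_eqI[OF _ multi_upd[OF j l kl]]) (use k in auto)
    then show "k \<in> (\<lambda>z. j(l := z)) ` idxs n" using kl by blast
  qed (use multi_upd[OF j l] in \<open>auto split: if_splits\<close>)
  moreover have "inj_on (\<lambda>z. j(l := z)) (idxs n)"
    by (intro inj_onI) (metis fun_upd_same)
  ultimately show ?thesis
    by (simp add: sum.inter_filter[symmetric] sum.reindex)
qed

section \<open>Supercommutation in coordinates\<close>

definition super_commutes ::
  "nat \<Rightarrow> nat \<Rightarrow> nat \<Rightarrow> (idx \<Rightarrow> idx \<Rightarrow> complex) \<Rightarrow> nat \<Rightarrow> nat \<Rightarrow> (midx \<Rightarrow> midx \<Rightarrow> complex) \<Rightarrow> bool" where
  "super_commutes n r m G p q F \<longleftrightarrow> (\<forall>i\<in>multi n m. \<forall>j\<in>multi n m.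
     (\<Sum>l=1..m. \<Sum>z\<in>idxs n. (-1) ^ (p * pre j l) * factor_mat r p G l z (j l) * F i (j(l := z))) =
     (-1) ^ (p * q) *
     (\<Sum>l=1..m. \<Sum>z\<in>idxs n. (-1) ^ (p * pre i l) * factor_mat r p G l (i l) z * F (i(l := z)) j))"

lemma rho_commutes_iff:
  assumes f: "f \<in> endos (multi n (r + s))"
  shows "rho n r s p g \<circ> f = mscale ((-1) ^ (p * q)) (f \<circ> rho n r s p g) \<longleftrightarrow>
    super_commutes n r (r + s) (\<lambda>x y. g (bvec y) x) p q (\<lambda>i j. f (bvec i) j)"
proof -
  let ?m = "r + s" and ?J = "multi n (r + s)" and ?R = "rho n r s p g"
  let ?c = "(-1) ^ (p * q) :: complex"
  let ?G = "\<lambda>x y. g (bvec y) x"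
  note R = rho_in_endos[of n r s p g]
  have "?R \<circ> f = mscale ?c (f \<circ> ?R) \<longleftrightarrow>
      (\<forall>i\<in>?J. \<forall>j\<in>?J. (?R \<circ> f) (bvec i) j = mscale ?c (f \<circ> ?R) (bvec i) j)" (is "?l \<longleftrightarrow> ?r")
  proof
    assume ?r
    then show ?l
      by (intro endos_eqI[where B = ?J] endos_comp endos_mscale f R finite_multi) auto
  qed simp
  also have "\<dots> \<longleftrightarrow> super_commutes n r ?m ?G p q (\<lambda>i j. f (bvec i) j)"
    unfolding super_commutes_def
  proof (intro ball_cong refl)
    fix i j assume i: "i \<in> ?J" and j: "j \<in> ?J"
    have "(?R \<circ> f) (bvec i) j = (\<Sum>k\<in>?J. f (bvec i) k * ?R (bvec k) j)"
      unfolding comp_def by (rule endos_apply[OF R finite_multi endos_closed[OF f]])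
    also have "\<dots> = (\<Sum>k\<in>?J. \<Sum>l=1..?m. if \<forall>l'\<in>{1..?m} - {l}. k l' = j l'
        then (-1) ^ (p * pre k l) * factor_mat r p ?G l (k l) (j l) * f (bvec i) k else 0)"
      by (intro sum.cong refl) (simp add: rho_entry j sum_distrib_left if_distrib mult_ac cong: if_cong)
    also have "\<dots> = (\<Sum>l=1..?m. \<Sum>z\<in>idxs n. (-1) ^ (p * pre j l) * factor_mat r p ?G l z (j l) * f (bvec i) (j(l := z)))"
      by (subst sum.swap, rule sum.cong[OF refl], subst sum_agree_off[OF _ j]) auto
    finally have 1: "(?R \<circ> f) (bvec i) j = \<dots>" .
    have "(f \<circ> ?R) (bvec i) j = (\<Sum>k\<in>?J. ?R (bvec i) k * f (bvec k) j)"
      unfolding comp_def by (rule endos_apply[OF f finite_multi endos_closed[OF R]])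
    also have "\<dots> = (\<Sum>k\<in>?J. \<Sum>l=1..?m. if \<forall>l'\<in>{1..?m} - {l}. k l' = i l'
        then (-1) ^ (p * pre i l) * factor_mat r p ?G l (i l) (k l) * f (bvec k) j else 0)"
      by (intro sum.cong refl)
        (simp add: rho_entry[OF i] sum_distrib_right if_distrib if_distribR eq_commute[of "i _"] cong: if_cong)
    also have "\<dots> = (\<Sum>l=1..?m. \<Sum>z\<in>idxs n. (-1) ^ (p * pre i l) * factor_mat r p ?G l (i l) z * f (bvec (i(l := z))) j)"
      by (subst sum.swap, rule sum.cong[OF refl], subst sum_agree_off[OF _ i]) auto
    finally have 2: "(f \<circ> ?R) (bvec i) j = \<dots>" .
    show "((?R \<circ> f) (bvec i) j = mscale ?c (f \<circ> ?R) (bvec i) j) \<longleftrightarrow>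
       ((\<Sum>l=1..?m. \<Sum>z\<in>idxs n. (-1) ^ (p * pre j l) * factor_mat r p ?G l z (j l) * f (bvec i) (j(l := z))) =
        ?c * (\<Sum>l=1..?m. \<Sum>z\<in>idxs n. (-1) ^ (p * pre i l) * factor_mat r p ?G l (i l) z * f (bvec (i(l := z))) j))"
      unfolding mscale_def vscale_def 1 2 ..
  qed
  finally show ?thesis .
qed

section \<open>Partial transposition\<close>

text \<open>The summand with \<open>q\<close> composes an odd operator with the parity operator; a
  label change of parity \<open>p\<close> on the input side then produces the supersign
  \<open>(-1) ^ (p * q)\<close>.\<close>

definition transpose_exp :: "nat \<Rightarrow> nat \<Rightarrow> nat \<Rightarrow> midx \<Rightarrow> midx \<Rightarrow> nat" where
  "transpose_exp r m q x y = twist_exp r m (par \<circ> x) (par \<circ> y) + q * (\<Sum>l=1..m. par (x l))"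

definition transposed :: "nat \<Rightarrow> nat \<Rightarrow> nat \<Rightarrow> (midx \<Rightarrow> midx \<Rightarrow> complex) \<Rightarrow> midx \<Rightarrow> midx \<Rightarrow> complex" where
  "transposed r m q F x y = (-1) ^ transpose_exp r m q x y * F (merge r x y) (merge r y x)"

definition has_parity :: "nat \<Rightarrow> nat \<Rightarrow> nat \<Rightarrow> (midx \<Rightarrow> midx \<Rightarrow> complex) \<Rightarrow> bool" where
  "has_parity n m q F \<longleftrightarrow> (\<forall>i\<in>multi n m. \<forall>j\<in>multi n m.
     F i j \<noteq> 0 \<longrightarrow> even ((\<Sum>l=1..m. par (i l)) + (\<Sum>l=1..m. par (j l)) + q))"

lemma merge_in_multi: "x \<in> multi n m \<Longrightarrow> y \<in> multi n m \<Longrightarrow> merge r x y \<in> multi n m"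
  by (auto simp: merge_def multi_def PiE_def Pi_def extensional_def)

lemma merge_merge [simp]: "merge r (merge r x y) (merge r y x) = x"
  by (auto simp: merge_def)

lemma sum_par_merge:
  "(\<Sum>l=1..m. par (merge r x y l)) + (\<Sum>l=1..m. par (merge r y x l)) =
    (\<Sum>l=1..m. par (x l)) + (\<Sum>l=1..m. par (y l))"
  unfolding sum.distrib[symmetric] by (intro sum.cong) (auto simp: merge_def)

lemma merge_upd:
  "l \<le> r \<Longrightarrow> merge r (x(l := z)) y = (merge r x y)(l := z)"
  "l \<le> r \<Longrightarrow> merge r y (x(l := z)) = merge r y x"
  "r < l \<Longrightarrow> merge r y (x(l := z)) = (merge r y x)(l := z)"
  "r < l \<Longrightarrow> merge r (x(l := z)) y = merge r x y"
  by (auto simp: merge_def)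

lemma sum_par_upd:
  fixes l m :: nat and x :: midx
  assumes "l \<in> {1..m}" "even (par (x l) + par z + p)"
  shows "even ((\<Sum>k=1..m. par ((x(l := z)) k)) + (\<Sum>k=1..m. par (x k)) + p)"
proof -
  have "(\<Sum>k\<in>{1..m} - {l}. par ((x(l := z)) k)) = (\<Sum>k\<in>{1..m} - {l}. par (x k))"
    by (intro sum.cong) auto
  then show ?thesis
    using assms sum.remove[OF finite_atLeastAtMost assms(1), of "\<lambda>k. par ((x(l := z)) k)"]
      sum.remove[OF finite_atLeastAtMost assms(1), of "\<lambda>k. par (x k)"]
    by simp argo
qed

lemma par_comp_upd_same: "par z = par (x l) \<Longrightarrow> par \<circ> x(l := z) = par \<circ> x"
  by auto

lemma pre_split:
  assumes "r < l"
  shows "pre i l = (\<Sum>k=1..r. par (i k)) + (\<Sum>k=Suc r..<l. par (i k))"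
proof -
  have "{1..<l} = {1..r} \<union> {Suc r..<l}" "{1..r} \<inter> {Suc r..<l} = {}" using assms by auto
  then show ?thesis by (simp add: pre_def sum.union_disjoint)
qed

lemma sum_par_split:
  assumes "r \<le> m"
  shows "(\<Sum>k=1..m. par (i k)) = (\<Sum>k=1..r. par (i k)) + tail_sum r m (par \<circ> i)"
proof -
  have "{1..m} = {1..r} \<union> {Suc r..m}" "{1..r} \<inter> {Suc r..m} = {}" using assms by auto
  then show ?thesis by (simp add: tail_sum_def sum.union_disjoint)
qed

lemma pre_merge_le: "l \<le> r \<Longrightarrow> pre (merge r x y) l = pre x l"
  unfolding pre_def by (intro sum.cong) (auto simp: merge_def)

lemma pre_merge_parity:
  assumes "r < l"
  shows "even (pre (merge r x y) l + pre y l + (\<Sum>k=1..r. par (x k)) + (\<Sum>k=1..r. par (y k)))"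
proof -
  have "(\<Sum>k=1..r. par (merge r x y k)) = (\<Sum>k=1..r. par (x k))"
    "(\<Sum>k=Suc r..<l. par (merge r x y k)) = (\<Sum>k=Suc r..<l. par (y k))"
    by (auto intro!: sum.cong simp: merge_def)
  then show ?thesis unfolding pre_split[OF assms] by (simp only: even_add) argo
qed

lemma twist_exp_upd_fst:
  assumes l: "l \<in> {1..m}" and z: "even (par (x l) + par z + p)"
  shows "even (twist_exp r m (par \<circ> x(l := z)) Y + twist_exp r m (par \<circ> x) Y +
    of_bool (r < l) * (p * (par (x l) + tail_sum r m (par \<circ> x) + tail_sum r m Y)))"
proof (cases "even p \<or> l \<le> r")
  case True
  have "twist_exp r m (par \<circ> x(l := z)) Y = twist_exp r m (par \<circ> x) Y"
  proof (cases "l \<le> r")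
    case True
    then have "tail_sum r m (par \<circ> x(l := z)) = tail_sum r m (par \<circ> x)"
      by (intro tail_sum_same[of l]) auto
    then show ?thesis by (simp add: twist_exp_def)
  next
    case False
    then have "par z = par (x l)" using True z par_in[of z] par_in[of "x l"] by auto
    then show ?thesis by (simp add: par_comp_upd_same)
  qed
  then show ?thesis using True by auto
next
  case False
  have "even (twist_exp r m (par \<circ> x(l := z)) Y + twist_exp r m (par \<circ> x) Y + (par \<circ> x) l +
      tail_sum r m (par \<circ> x) + tail_sum r m Y)"
    by (rule twist_exp_change_fst[where k = l]) (use l z False par_le_1 in auto)
  then show ?thesis using False by (simp add: even_mult_iff) argo
qed

lemma twist_exp_upd_snd:
  assumes l: "l \<in> {1..m}" and z: "even (par (y l) + par z + p)"
  shows "even (twist_exp r m X (par \<circ> y(l := z)) + twist_exp r m X (par \<circ> y) +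
    of_bool (r < l) * (p * (par (y l) + tail_sum r m X + tail_sum r m (par \<circ> y) + 1)))"
proof (cases "even p \<or> l \<le> r")
  case True
  have "twist_exp r m X (par \<circ> y(l := z)) = twist_exp r m X (par \<circ> y)"
  proof (cases "l \<le> r")
    case True
    then have "tail_sum r m (par \<circ> y(l := z)) = tail_sum r m (par \<circ> y)"
      by (intro tail_sum_same[of l]) auto
    then show ?thesis by (simp add: twist_exp_def)
  next
    case False
    then have "par z = par (y l)" using True z par_in[of z] par_in[of "y l"] by auto
    then show ?thesis by (simp add: par_comp_upd_same)
  qed
  then show ?thesis using True by auto
next
  case False
  have "even (twist_exp r m X (par \<circ> y(l := z)) + twist_exp r m X (par \<circ> y) + (par \<circ> y) l +
      tail_sum r m X + tail_sum r m (par \<circ> y) + 1)"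
    by (rule twist_exp_change_snd[where k = l]) (use l z False par_le_1 in auto)
  then show ?thesis using False by (simp add: even_mult_iff) argo
qed

lemma signed_term_eq:
  fixes u v c d :: complex
  assumes "d \<noteq> 0 \<Longrightarrow> v \<noteq> 0 \<Longrightarrow> even (a + a' + b)"
  shows "d * (-1) ^ a * ((-1) ^ a' * v) = (-1) ^ b * (d * v)"
proof (cases "d = 0 \<or> v = 0")
  case False
  then have "even (a + a' + b)" using assms by blast
  then have "(-1 :: complex) ^ (a + a') = (-1) ^ b" by (rule minus_one_power_cong)
  then show ?thesis by (simp add: power_add mult_ac)
qed auto

context
  fixes n r m p q :: nat and G :: "idx \<Rightarrow> idx \<Rightarrow> complex" and F :: "midx \<Rightarrow> midx \<Rightarrow> complex" and x y :: midx
  assumes r: "r \<le> m" and G: "queer_matrix n p G" and F: "has_parity n m q F"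
    and x: "x \<in> multi n m" and y: "y \<in> multi n m"
begin

text \<open>Left of the wall the sides are kept, and neither the twist nor the prefix sums notice
  the transposition.\<close>

lemma transposed_out_le:
  assumes l: "l \<in> {1..m}" "l \<le> r"
  shows "act_out n G p l (transposed r m q F) x y = (-1) ^ transpose_exp r m q x y *
    (\<Sum>z\<in>idxs n. (-1) ^ (p * pre (merge r y x) l) * factor_mat r p G l z (merge r y x l) *
      F (merge r x y) ((merge r y x)(l := z)))"
  unfolding act_out_def sum_distrib_left
proof (rule sum.cong[OF refl])
  fix z assume z: "z \<in> idxs n"
  have t: "transposed r m q F x (y(l := z)) = (-1) ^ transpose_exp r m q x (y(l := z)) *
      F (merge r x y) ((merge r y x)(l := z))"
    using l(2) by (simp add: transposed_def merge_upd)
  have f: "factor_mat r p G l z (merge r y x l) = G (y l) z"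
    using l(2) by (simp add: factor_mat_def merge_def)
  have yl: "y l \<in> idxs n" using multi_in[OF y l(1)] .
  have "even (p * pre y l + transpose_exp r m q x (y(l := z)) + (transpose_exp r m q x y + p * pre y l))"
    if "G (y l) z \<noteq> 0"
  proof -
    have e: "even (par (y l) + par z + p)" using G yl z that by (simp add: queer_matrix_def)
    show ?thesis
      using twist_exp_upd_snd[of l m y z p r "par \<circ> x", OF l(1) e] l(2) by (simp add: transpose_exp_def) argo
  qed
  then have "G (y l) z * (-1) ^ (p * pre y l) * transposed r m q F x (y(l := z)) =
      (-1) ^ (transpose_exp r m q x y + p * pre y l) * (G (y l) z * F (merge r x y) ((merge r y x)(l := z)))"
    unfolding t by (rule signed_term_eq)
  then show "G (y l) z * (-1) ^ (p * pre y l) * transposed r m q F x (y(l := z)) =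
      (-1) ^ transpose_exp r m q x y * ((-1) ^ (p * pre (merge r y x) l) *
        factor_mat r p G l z (merge r y x l) * F (merge r x y) ((merge r y x)(l := z)))"
    unfolding f pre_merge_le[OF l(2)] by (simp add: power_add mult_ac)
qed

lemma transposed_in_le:
  assumes l: "l \<in> {1..m}" "l \<le> r"
  shows "act_in n G p l (transposed r m q F) x y = (-1) ^ (transpose_exp r m q x y + p * q) *
    (\<Sum>z\<in>idxs n. (-1) ^ (p * pre (merge r x y) l) * factor_mat r p G l (merge r x y l) z *
      F ((merge r x y)(l := z)) (merge r y x))"
  unfolding act_in_def sum_distrib_left
proof (rule sum.cong[OF refl])
  fix z assume z: "z \<in> idxs n"
  have t: "transposed r m q F (x(l := z)) y = (-1) ^ transpose_exp r m q (x(l := z)) y *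
      F ((merge r x y)(l := z)) (merge r y x)"
    using l(2) by (simp add: transposed_def merge_upd)
  have f: "factor_mat r p G l (merge r x y l) z = G z (x l)"
    using l(2) by (simp add: factor_mat_def merge_def)
  have xl: "x l \<in> idxs n" using multi_in[OF x l(1)] .
  have "even (p * pre x l + transpose_exp r m q (x(l := z)) y + (transpose_exp r m q x y + p * q + p * pre x l))"
    if "G z (x l) \<noteq> 0"
  proof -
    have e: "even (par (x l) + par z + p)" using G xl z that by (auto simp: queer_matrix_def)
    have "even (twist_exp r m (par \<circ> x(l := z)) (par \<circ> y) + twist_exp r m (par \<circ> x) (par \<circ> y))"
      using twist_exp_upd_fst[of l m x z p r "par \<circ> y", OF l(1) e] l(2) by simp
    then show ?thesis
      using sum_par_upd[of l m x z p, OF l(1) e]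
      unfolding transpose_exp_def by (simp only: even_add even_mult_iff) argo
  qed
  then have "G z (x l) * (-1) ^ (p * pre x l) * transposed r m q F (x(l := z)) y =
      (-1) ^ (transpose_exp r m q x y + p * q + p * pre x l) * (G z (x l) * F ((merge r x y)(l := z)) (merge r y x))"
    unfolding t by (rule signed_term_eq)
  then show "G z (x l) * (-1) ^ (p * pre x l) * transposed r m q F (x(l := z)) y =
      (-1) ^ (transpose_exp r m q x y + p * q) * ((-1) ^ (p * pre (merge r x y) l) *
        factor_mat r p G l (merge r x y l) z * F ((merge r x y)(l := z)) (merge r y x))"
    unfolding f pre_merge_le[OF l(2)] by (simp add: power_add mult_ac)
qed

text \<open>Right of the wall the output side of the transposed operator is the input side of
  \<open>F\<close>. The minus sign is that of the dual action, and the increment of the twist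
  repairs the prefix sums.\<close>

lemma transposed_out_gt:
  assumes l: "l \<in> {1..m}" "r < l"
  shows "act_out n G p l (transposed r m q F) x y = - ((-1) ^ (transpose_exp r m q x y + p * q) *
    (\<Sum>z\<in>idxs n. (-1) ^ (p * pre (merge r x y) l) * factor_mat r p G l (merge r x y l) z *
      F ((merge r x y)(l := z)) (merge r y x)))"
  unfolding act_out_def sum_distrib_left sum_negf[symmetric]
proof (rule sum.cong[OF refl])
  fix z assume z: "z \<in> idxs n"
  have t: "transposed r m q F x (y(l := z)) = (-1) ^ transpose_exp r m q x (y(l := z)) *
      F ((merge r x y)(l := z)) (merge r y x)"
    using l(2) by (simp add: transposed_def merge_upd)
  have f: "factor_mat r p G l (merge r x y l) z = - ((-1) ^ (p * par (y l))) * G (y l) z"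
    using l(2) by (simp add: factor_mat_def merge_def)
  have yl: "y l \<in> idxs n" using multi_in[OF y l(1)] .
  let ?e = "transpose_exp r m q x y + p * q + p * pre (merge r x y) l + p * par (y l)"
  have "even (p * pre y l + transpose_exp r m q x (y(l := z)) + ?e)"
    if "G (y l) z \<noteq> 0" "F ((merge r x y)(l := z)) (merge r y x) \<noteq> 0"
  proof -
    have e: "even (par (y l) + par z + p)" using G yl z that by (simp add: queer_matrix_def)
    then have e': "even (par (merge r x y l) + par z + p)" using l(2) by (simp add: merge_def)
    have "even ((\<Sum>k=1..m. par (((merge r x y)(l := z)) k)) + (\<Sum>k=1..m. par (merge r y x k)) + q)"
      using F that(2) multi_upd[OF merge_in_multi[OF x y] l(1) z] merge_in_multi[OF y x]
      unfolding has_parity_def by blast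
    then have "even ((\<Sum>k=1..m. par (merge r x y k)) + (\<Sum>k=1..m. par (merge r y x k)) + p + q)"
      using sum_par_upd[of l m "merge r x y" z p, OF l(1) e'] by (simp only: even_add) argo
    \<comment> \<open>The parity of \<open>F\<close> makes the prefix sums up to the wall and the
      tail sums behind it agree up to \<open>p + q\<close>; this converts the increment of the twist
      into prefix sums.\<close>
    then have q: "even ((\<Sum>k=1..r. par (x k)) + tail_sum r m (par \<circ> x) +
        ((\<Sum>k=1..r. par (y k)) + tail_sum r m (par \<circ> y)) + p + q)"
      unfolding sum_par_merge unfolding sum_par_split[OF r] .
    have "even (twist_exp r m (par \<circ> x) (par \<circ> y(l := z)) + twist_exp r m (par \<circ> x) (par \<circ> y) +
        p * (par (y l) + tail_sum r m (par \<circ> x) + tail_sum r m (par \<circ> y) + 1))"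
      using twist_exp_upd_snd[of l m y z p r "par \<circ> x", OF l(1) e] l(2) by simp
    then show ?thesis
      using q pre_merge_parity[OF l(2), of x y]
      unfolding transpose_exp_def by (simp only: even_add even_mult_iff odd_one) argo
  qed
  then have "G (y l) z * (-1) ^ (p * pre y l) * transposed r m q F x (y(l := z)) =
      (-1) ^ ?e * (G (y l) z * F ((merge r x y)(l := z)) (merge r y x))"
    unfolding t by (rule signed_term_eq)
  then show "G (y l) z * (-1) ^ (p * pre y l) * transposed r m q F x (y(l := z)) =
      - ((-1) ^ (transpose_exp r m q x y + p * q) * ((-1) ^ (p * pre (merge r x y) l) *
        factor_mat r p G l (merge r x y l) z * F ((merge r x y)(l := z)) (merge r y x)))"
    unfolding f by (simp add: power_add mult_ac)
qed

lemma transposed_in_gt: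
  assumes l: "l \<in> {1..m}" "r < l"
  shows "act_in n G p l (transposed r m q F) x y = - ((-1) ^ transpose_exp r m q x y *
    (\<Sum>z\<in>idxs n. (-1) ^ (p * pre (merge r y x) l) * factor_mat r p G l z (merge r y x l) *
      F (merge r x y) ((merge r y x)(l := z))))"
  unfolding act_in_def sum_distrib_left sum_negf[symmetric]
proof (rule sum.cong[OF refl])
  fix z assume z: "z \<in> idxs n"
  have t: "transposed r m q F (x(l := z)) y = (-1) ^ transpose_exp r m q (x(l := z)) y *
      F (merge r x y) ((merge r y x)(l := z))"
    using l(2) by (simp add: transposed_def merge_upd)
  have f: "factor_mat r p G l z (merge r y x l) = - ((-1) ^ (p * par z)) * G z (x l)"
    using l(2) by (simp add: factor_mat_def merge_def)
  have xl: "x l \<in> idxs n" using multi_in[OF x l(1)] .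
  let ?e = "transpose_exp r m q x y + p * pre (merge r y x) l + p * par z"
  have "even (p * pre x l + transpose_exp r m q (x(l := z)) y + ?e)"
    if "G z (x l) \<noteq> 0" "F (merge r x y) ((merge r y x)(l := z)) \<noteq> 0"
  proof -
    have e: "even (par (x l) + par z + p)" using G xl z that by (auto simp: queer_matrix_def)
    then have e': "even (par (merge r y x l) + par z + p)" using l(2) by (simp add: merge_def)
    have "even ((\<Sum>k=1..m. par (merge r x y k)) + (\<Sum>k=1..m. par (((merge r y x)(l := z)) k)) + q)"
      using F that(2) multi_upd[OF merge_in_multi[OF y x] l(1) z] merge_in_multi[OF x y]
      unfolding has_parity_def by blast
    then have "even ((\<Sum>k=1..m. par (merge r x y k)) + (\<Sum>k=1..m. par (merge r y x k)) + p + q)"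
      using sum_par_upd[of l m "merge r y x" z p, OF l(1) e'] by (simp only: even_add) argo
    then have q: "even ((\<Sum>k=1..r. par (x k)) + tail_sum r m (par \<circ> x) +
        ((\<Sum>k=1..r. par (y k)) + tail_sum r m (par \<circ> y)) + p + q)"
      unfolding sum_par_merge unfolding sum_par_split[OF r] .
    have "even (twist_exp r m (par \<circ> x(l := z)) (par \<circ> y) + twist_exp r m (par \<circ> x) (par \<circ> y) +
        p * (par (x l) + tail_sum r m (par \<circ> x) + tail_sum r m (par \<circ> y)))"
      using twist_exp_upd_fst[of l m x z p r "par \<circ> y", OF l(1) e] l(2) by simp
    then show ?thesis
      using q e pre_merge_parity[OF l(2), of y x] sum_par_upd[of l m x z p, OF l(1) e]
      unfolding transpose_exp_def by (simp only: even_add even_mult_iff odd_one) argo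
  qed
  then have "G z (x l) * (-1) ^ (p * pre x l) * transposed r m q F (x(l := z)) y =
      (-1) ^ ?e * (G z (x l) * F (merge r x y) ((merge r y x)(l := z)))"
    unfolding t by (rule signed_term_eq)
  then show "G z (x l) * (-1) ^ (p * pre x l) * transposed r m q F (x(l := z)) y =
      - ((-1) ^ transpose_exp r m q x y * ((-1) ^ (p * pre (merge r y x) l) *
        factor_mat r p G l z (merge r y x l) * F (merge r x y) ((merge r y x)(l := z))))"
    unfolding f by (simp add: power_add mult_ac)
qed

text \<open>Behind the wall both the sides and the signs are exchanged, so the difference of the two
  sides keeps its form at every position and with a common factor.\<close>

lemma transposed_equation:
  "(\<Sum>l=1..m. act_out n G p l (transposed r m q F) x y) - (\<Sum>l=1..m. act_in n G p l (transposed r m q F) x y) =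
    (-1) ^ transpose_exp r m q x y *
    ((\<Sum>l=1..m. \<Sum>z\<in>idxs n. (-1) ^ (p * pre (merge r y x) l) * factor_mat r p G l z (merge r y x l) *
        F (merge r x y) ((merge r y x)(l := z))) -
     (-1) ^ (p * q) * (\<Sum>l=1..m. \<Sum>z\<in>idxs n. (-1) ^ (p * pre (merge r x y) l) *
        factor_mat r p G l (merge r x y l) z * F ((merge r x y)(l := z)) (merge r y x)))"
  unfolding sum_subtractf[symmetric] sum_distrib_left[of _ _ "{1..m}"]
proof (rule sum.cong[OF refl])
  fix l assume l: "l \<in> {1..m}"
  show "act_out n G p l (transposed r m q F) x y - act_in n G p l (transposed r m q F) x y =
    (-1) ^ transpose_exp r m q x y *
    ((\<Sum>z\<in>idxs n. (-1) ^ (p * pre (merge r y x) l) * factor_mat r p G l z (merge r y x l) *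
        F (merge r x y) ((merge r y x)(l := z))) -
     (-1) ^ (p * q) * (\<Sum>z\<in>idxs n. (-1) ^ (p * pre (merge r x y) l) *
        factor_mat r p G l (merge r x y l) z * F ((merge r x y)(l := z)) (merge r y x)))"
  proof (cases "l \<le> r")
    case True
    then show ?thesis
      unfolding transposed_out_le[OF l True] transposed_in_le[OF l True] by (simp add: power_add algebra_simps)
  next
    case False
    then have "r < l" by simp
    then show ?thesis
      unfolding transposed_out_gt[OF l \<open>r < l\<close>] transposed_in_gt[OF l \<open>r < l\<close>]
      by (simp add: power_add algebra_simps)
  qed
qed

end

lemma super_commutes_iff_jw_commutes:
  assumes "r \<le> m" "queer_matrix n p G" "has_parity n m q F"
  shows "super_commutes n r m G p q F \<longleftrightarrow> jw_commutes n m G p (transposed r m q F)"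
proof -
  let ?eq = "\<lambda>i j. (\<Sum>l=1..m. \<Sum>z\<in>idxs n. (-1) ^ (p * pre j l) * factor_mat r p G l z (j l) * F i (j(l := z))) =
     (-1) ^ (p * q) *
     (\<Sum>l=1..m. \<Sum>z\<in>idxs n. (-1) ^ (p * pre i l) * factor_mat r p G l (i l) z * F (i(l := z)) j)"
  have eq: "(\<Sum>l=1..m. act_out n G p l (transposed r m q F) x y) = (\<Sum>l=1..m. act_in n G p l (transposed r m q F) x y)
      \<longleftrightarrow> ?eq (merge r x y) (merge r y x)" if "x \<in> multi n m" "y \<in> multi n m" for x y
    using transposed_equation[OF assms that]
    by (metis (no_types, lifting) eq_iff_diff_eq_0 mult_eq_0_iff power_not_zero neg_equal_0_iff_equal one_neq_zero)
  show ?thesis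
  proof
    assume "super_commutes n r m G p q F"
    then show "jw_commutes n m G p (transposed r m q F)"
      unfolding jw_commutes_def super_commutes_def using eq merge_in_multi by blast
  next
    assume jw: "jw_commutes n m G p (transposed r m q F)"
    show "super_commutes n r m G p q F"
      unfolding super_commutes_def
    proof (intro ballI)
      fix i j assume ij: "i \<in> multi n m" "j \<in> multi n m"
      \<comment> \<open>\<open>merge\<close> is an involution on pairs, so every pair
        \<open>(i, j)\<close> arises from a pair of renamed labels.\<close>
      then have "?eq (merge r (merge r i j) (merge r j i)) (merge r (merge r j i) (merge r i j))"
        using jw eq[OF merge_in_multi[OF ij] merge_in_multi[OF ij(2,1)]] merge_in_multi
        unfolding jw_commutes_def by blast
      then show "?eq i j" unfolding merge_merge .
    qed
  qed
qed

section \<open>Surjectivity and bijectivity\<close>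

lemma jw_commutes_cong:
  assumes F: "\<And>i j. i \<in> multi n m \<Longrightarrow> j \<in> multi n m \<Longrightarrow> F i j = F' i j"
    and G: "\<And>u v. u \<in> idxs n \<Longrightarrow> v \<in> idxs n \<Longrightarrow> G u v = G' u v"
  shows "jw_commutes n m G p F \<longleftrightarrow> jw_commutes n m G' p F'"
proof -
  have "act_out n G p t F i j = act_out n G' p t F' i j" "act_in n G p t F i j = act_in n G' p t F' i j"
    if i: "i \<in> multi n m" and j: "j \<in> multi n m" and t: "t \<in> {1..m}" for i j t
    unfolding act_out_def act_in_def
    using F[OF i multi_upd[OF j t]] F[OF multi_upd[OF i t] j] G[OF multi_in[OF j t]] G[OF _ multi_in[OF i t]]
    by (auto intro!: sum.cong)
  then have "(\<Sum>t=1..m. act_out n G p t F i j) = (\<Sum>t=1..m. act_out n G' p t F' i j)"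
    "(\<Sum>t=1..m. act_in n G p t F i j) = (\<Sum>t=1..m. act_in n G' p t F' i j)"
    if "i \<in> multi n m" "j \<in> multi n m" for i j
    using that by (intro sum.cong refl; blast)+
  then show ?thesis unfolding jw_commutes_def by simp
qed

text \<open>Commutation holds position by position: the action on the output at \<open>t\<close>
  equals the action on the input at \<open>fst h t\<close>. The signs match by admissibility, the
  entries by the invariance of \<open>G\<close> under bars.\<close>

lemma (in sign_system) jw_commutes_mperm_matrix:
  assumes h: "h \<in> mperms m" and G: "queer_matrix n p G"
  shows "jw_commutes n m G p (mperm_matrix h)"
  unfolding jw_commutes_def
proof (intro ballI)
  fix x y assume x: "x \<in> multi n m" and y: "y \<in> multi n m"
  have "act_out n G p t (mperm_matrix h) x y = act_in n G p (fst h t) (mperm_matrix h) x y"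
    if t: "t \<in> {1..m}" for t
  proof -
    define b where "b = fst h t"
    define \<beta> where "\<beta> = (\<lambda>z. if t \<in> snd h then bar z else z)"
    define C where "C \<longleftrightarrow> (\<forall>l. l \<noteq> t \<longrightarrow> mact h x l = y l)"
    have \<beta>\<beta>: "\<beta> (\<beta> z) = z" for z by (simp add: \<beta>_def)
    have \<beta>_in: "\<beta> z \<in> idxs n \<longleftrightarrow> z \<in> idxs n" for z by (simp add: \<beta>_def)
    have b: "b \<in> {1..m}" using mperms_in[OF h] t by (simp add: b_def)
    have yt: "y t \<in> idxs n" and xb: "x b \<in> idxs n" using multi_in x y t b by auto
    have "G (\<beta> u) (\<beta> v) = G u v" if "u \<in> idxs n" "v \<in> idxs n" for u v
      using G that by (auto simp: queer_matrix_def \<beta>_def)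
    from this[of "y t" "\<beta> (x b)"] have G': "G (y t) (\<beta> (x b)) = G (\<beta> (y t)) (x b)"
      using yt xb by (simp add: \<beta>\<beta> \<beta>_in)
    have hx: "mact h x t = \<beta> (x b)" by (simp add: mact_def \<beta>_def b_def)
    have out: "mact h x = y(t := z) \<longleftrightarrow> C \<and> z = \<beta> (x b)" for z
      unfolding C_def hx[symmetric] by (auto simp: fun_eq_iff)
    have "mact h (x(b := z)) = (mact h x)(t := \<beta> z)" for z
      unfolding b_def \<beta>_def by (rule mact_upd[OF h])
    then have "mact h (x(b := z)) = y \<longleftrightarrow> C \<and> \<beta> z = y t" for z
      unfolding C_def by (auto simp: fun_eq_iff)
    then have in': "mact h (x(b := z)) = y \<longleftrightarrow> C \<and> z = \<beta> (y t)" for z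
      using \<beta>\<beta> by metis
    have "act_out n G p t (mperm_matrix h) x y =
        (\<Sum>z\<in>idxs n. if z = \<beta> (x b) then (if C then G (y t) z * (-1) ^ (p * pre y t) * (-1) ^ w h x else 0) else 0)"
      unfolding act_out_def mperm_matrix_def out by (intro sum.cong) auto
    also have "\<dots> = (if C then G (y t) (\<beta> (x b)) * (-1) ^ (p * pre y t) * (-1) ^ w h x else 0)"
      using xb \<beta>_in by (simp add: sum.delta')
    also have "\<dots> = (if C then G (\<beta> (y t)) (x b) * (-1) ^ (p * pre x b) * (-1) ^ w h (x(b := \<beta> (y t))) else 0)"
    proof (cases "C \<and> G (\<beta> (y t)) (x b) \<noteq> 0")
      case True
      have "pre (mact h x) t = pre y t"
        using True unfolding pre_def C_def by (intro sum.cong) auto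
      moreover have "even (w h (x(b := \<beta> (y t))) + w h x +
          (par (x b) + par (\<beta> (y t))) * (pre x b + pre (mact h x) t))"
        using adm[OF h] x t yt \<beta>_in unfolding admissible_def b_def by blast
      moreover have "even (par (\<beta> (y t)) + par (x b) + p)"
        using G True xb yt \<beta>_in unfolding queer_matrix_def by blast
      ultimately have "(-1 :: complex) ^ (p * pre y t + w h x) = (-1) ^ (p * pre x b + w h (x(b := \<beta> (y t))))"
        by (intro minus_one_power_cong) (simp only: even_add even_mult_iff, argo)
      then show ?thesis using True G' by (simp add: power_add mult.assoc)
    next
      case False
      then show ?thesis using G' by auto
    qed
    also have "\<dots> = (\<Sum>z\<in>idxs n. if z = \<beta> (y t) then (if C then G z (x b) * (-1) ^ (p * pre x b) * (-1) ^ w h (x(b := z)) else 0) else 0)"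
      using yt \<beta>_in by (simp add: sum.delta')
    also have "\<dots> = act_in n G p b (mperm_matrix h) x y"
      unfolding act_in_def mperm_matrix_def in' by (intro sum.cong) auto
    finally show ?thesis by (simp add: b_def)
  qed
  then have "(\<Sum>t=1..m. act_out n G p t (mperm_matrix h) x y) = (\<Sum>t=1..m. act_in n G p (fst h t) (mperm_matrix h) x y)"
    by (intro sum.cong) auto
  also have "\<dots> = (\<Sum>t=1..m. act_in n G p t (mperm_matrix h) x y)"
    using sum.permute[OF mperms_fst[OF h], of "\<lambda>t. act_in n G p t (mperm_matrix h) x y"] by (simp add: o_def)
  finally show "(\<Sum>t=1..m. act_out n G p t (mperm_matrix h) x y) = (\<Sum>t=1..m. act_in n G p t (mperm_matrix h) x y)" .
qed

lemma transposed_wt: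
  assumes h: "h \<in> mperms (r + s)" and x: "x \<in> multi n (r + s)" and y: "y \<in> multi n (r + s)"
    and q: "even (q + card (snd h))"
  shows "transposed r (r + s) q (wt r s (dgm r (r + s) h)) x y =
    (if mact h x = y then (-1) ^ dgm_exp r (r + s) h x else 0)"
proof (cases "mact h x = y")
  case True
  have "even (transpose_exp r (r + s) q x y +
      (wt_exp r (r + s) (fst h) (snd h) (par \<circ> x) (par \<circ> y) + dgm_const r (r + s) h) + dgm_exp r (r + s) h x)"
    using q unfolding transpose_exp_def dgm_exp_def True by (simp only: even_add even_mult_iff) argo
  then have "(-1 :: complex) ^ (transpose_exp r (r + s) q x y +
      (wt_exp r (r + s) (fst h) (snd h) (par \<circ> x) (par \<circ> y) + dgm_const r (r + s) h)) = (-1) ^ dgm_exp r (r + s) h x"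
    by (rule minus_one_power_cong)
  then show ?thesis
    using True by (simp add: transposed_def wt_dgm[OF h x y] power_add)
next
  case False
  then show ?thesis by (simp add: transposed_def wt_dgm[OF h x y])
qed

text \<open>Labels are only permuted, except that each mark switches the parity of one of them;
  merging leaves the total parity of both rows unchanged.\<close>

lemma has_parity_wt:
  assumes h: "h \<in> mperms (r + s)" and q: "even (q + card (snd h))"
  shows "has_parity n (r + s) q (wt r s (dgm r (r + s) h))"
  unfolding has_parity_def
proof (intro ballI impI)
  let ?m = "r + s"
  fix i j assume ij: "i \<in> multi n ?m" "j \<in> multi n ?m" and ne: "wt r s (dgm r ?m h) i j \<noteq> 0"
  define x where "x = merge r i j"
  define y where "y = merge r j i"
  have xy: "x \<in> multi n ?m" "y \<in> multi n ?m" using ij merge_in_multi by (auto simp: x_def y_def)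
  have eq: "merge r x y = i" "merge r y x = j" by (simp_all add: x_def y_def)
  have y: "y = mact h x"
    using ne wt_dgm[OF h xy] unfolding eq by (auto split: if_splits)
  have "even ((\<Sum>t=1..?m. par (y t)) + (\<Sum>t=1..?m. par (x (fst h t))) + (\<Sum>t=1..?m. of_bool (t \<in> snd h)))"
    unfolding y sum.distrib[symmetric] by (intro dvd_sum) (auto simp: mact_def)
  moreover have "(\<Sum>t=1..?m. par (x (fst h t))) = (\<Sum>t=1..?m. par (x t))"
    using sum.permute[OF mperms_fst[OF h], of "\<lambda>t. par (x t)"] by (simp add: o_def)
  moreover have "(\<Sum>t=1..?m. of_bool (t \<in> snd h)) = card (snd h)"
    using mperms_snd[OF h] by (simp add: Int_absorb1)
  ultimately have "even ((\<Sum>t=1..?m. par (x t)) + (\<Sum>t=1..?m. par (y t)) + q)"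
    using q by simp argo
  then show "even ((\<Sum>l=1..?m. par (i l)) + (\<Sum>l=1..?m. par (j l)) + q)"
    unfolding sum_par_merge[of r x y, unfolded eq, symmetric] .
qed

lemma homogeneous_mpar_iff:
  assumes "f \<in> endos (multi n m)"
  shows "homogeneous (multi n m) (mpar m) q f \<longleftrightarrow> has_parity n m q (\<lambda>i j. f (bvec i) j)"
proof -
  have "mpar m b \<in> {0, 1}" for b by (auto simp: mpar_def)
  moreover have "mpar m j = (q + mpar m i) mod 2 \<longleftrightarrow>
      even ((\<Sum>l=1..m. par (i l)) + (\<Sum>l=1..m. par (j l)) + q)" for i j
    unfolding mpar_def by presburger
  ultimately show ?thesis
    using homogeneous_iff[OF assms finite_multi, of "mpar m" q] by (simp add: has_parity_def)
qed

lemma Psi_diagram_in_endos: "Psi_diagram n r s d \<in> endos (multi n (r + s))"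
  unfolding Psi_diagram_def by (intro lin_ext_in_endos fspace_sum fspace_vscale bvec_in_fspace)

lemma Psi_diagram_entry:
  assumes "i \<in> multi n (r + s)" "j \<in> multi n (r + s)"
  shows "Psi_diagram n r s d (bvec i) j = wt r s d i j"
proof -
  have "(\<Sum>k\<in>multi n (r + s). vscale (wt r s d i k) (bvec k)) j =
      (\<Sum>k\<in>multi n (r + s). if j = k then wt r s d i k else 0)"
    unfolding sum_apply by (intro sum.cong) (auto simp: vscale_def bvec_def)
  then show ?thesis
    using assms by (simp add: Psi_diagram_def lin_ext_bvec)
qed

lemma Psi_in_endos: "Psi n r s x \<in> endos (multi n (r + s))"
proof -
  have "(\<Sum>d\<in>A. mscale (x d) (Psi_diagram n r s d)) \<in> endos (multi n (r + s))" for A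
  proof (induction A rule: infinite_finite_induct)
    case (insert a A)
    show ?case
      unfolding sum.insert[OF insert.hyps]
      by (intro endos_add endos_mscale Psi_diagram_in_endos insert.IH)
  qed (simp_all add: endos_def vscale_def fspace_def fun_eq_iff)
  then show ?thesis by (simp add: Psi_def)
qed

lemma Psi_entry:
  assumes "i \<in> multi n (r + s)" "j \<in> multi n (r + s)"
  shows "Psi n r s x (bvec i) j = (\<Sum>d\<in>superdiagrams r s. x d * wt r s d i j)"
  unfolding Psi_def sum_apply
  by (intro sum.cong refl) (simp add: mscale_def vscale_def Psi_diagram_entry[OF assms])

lemma Psi_entry_mperms:
  assumes "i \<in> multi n (r + s)" "j \<in> multi n (r + s)"
  shows "Psi n r s x (bvec i) j =
    (\<Sum>h\<in>mperms (r + s). x (dgm r (r + s) h) * wt r s (dgm r (r + s) h) i j)"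
proof -
  have "inj_on (dgm r (r + s)) (mperms (r + s))"
    using dgm_inject by (intro inj_onI)
  then show ?thesis unfolding Psi_entry[OF assms] superdiagrams_eq by (simp add: sum.reindex)
qed

section \<open>The image and the kernel of the map from superdiagrams\<close>

definition supercentralizer :: "nat \<Rightarrow> nat \<Rightarrow> nat \<Rightarrow> nat \<Rightarrow> (tens \<Rightarrow> tens) set" where
  "supercentralizer n r s q = {f \<in> endos (multi n (r + s)). homogeneous (multi n (r + s)) (mpar (r + s)) q f \<and>
     (\<forall>p \<in> {0, 1}. \<forall>g \<in> queer n. homogeneous (idxs n) par p g \<longrightarrow>
        rho n r s p g \<circ> f = mscale ((-1) ^ (p * q)) (f \<circ> rho n r s p g))}"

lemma End_queer_eq: "End_queer n r s = maps.span (\<Union>q\<in>{0, 1}. supercentralizer n r s q)"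
  unfolding End_queer_def supercentralizer_def by (rule arg_cong[where f = maps.span]) blast

lemma Psi_diagram_supercentral:
  assumes d: "d \<in> superdiagrams r s"
  shows "\<exists>q\<in>{0, 1}. Psi_diagram n r s d \<in> supercentralizer n r s q"
proof -
  let ?m = "r + s"
  obtain h where h: "h \<in> mperms ?m" and d_eq: "d = dgm r ?m h"
    using d by (auto simp: superdiagrams_eq)
  define q where "q = card (snd h) mod 2"
  have q: "even (q + card (snd h))" by (simp add: q_def)
  interpret sign_system n ?m "dgm_exp r ?m"
    by unfold_locales (rule admissible_dgm_exp)
  let ?F = "\<lambda>i j. Psi_diagram n r s d (bvec i) j"
  have F: "?F i j = wt r s (dgm r ?m h) i j" if "i \<in> multi n ?m" "j \<in> multi n ?m" for i j
    using that by (simp add: Psi_diagram_entry d_eq)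
  have par: "has_parity n ?m q ?F"
    using has_parity_wt[OF h q, of n] F by (simp add: has_parity_def)
  have "transposed r ?m q ?F x y = mperm_matrix h x y" if "x \<in> multi n ?m" "y \<in> multi n ?m" for x y
    using transposed_wt[OF h that q] F[OF merge_in_multi[OF that] merge_in_multi[OF that(2,1)]]
    by (simp add: transposed_def mperm_matrix_def)
  then have jw: "jw_commutes n ?m G p (transposed r ?m q ?F)" if "queer_matrix n p G" for G p
    using jw_commutes_mperm_matrix[OF h that]
      jw_commutes_cong[of n ?m "transposed r ?m q ?F" "mperm_matrix h" G G p] by blast
  have "rho n r s p g \<circ> Psi_diagram n r s d = mscale ((-1) ^ (p * q)) (Psi_diagram n r s d \<circ> rho n r s p g)"
    if "p \<in> {0, 1}" "g \<in> queer n" "homogeneous (idxs n) par p g" for p g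
    using queer_matrix_of_queer[OF that(2,3,1)] jw
    by (simp add: rho_commutes_iff[OF Psi_diagram_in_endos] super_commutes_iff_jw_commutes[OF _ _ par])
  then have "Psi_diagram n r s d \<in> supercentralizer n r s q"
    using par unfolding supercentralizer_def
    by (simp add: Psi_diagram_in_endos homogeneous_mpar_iff)
  moreover have "q \<in> {0, 1}" by (auto simp: q_def)
  ultimately show ?thesis by blast
qed

lemma supercentralizer_in_image:
  assumes f: "f \<in> supercentralizer n r s q"
  shows "f \<in> Psi n r s ` superdiagram_space r s"
proof -
  let ?m = "r + s" and ?F = "\<lambda>i j. f (bvec i) j"
  interpret sign_system n ?m "dgm_exp r ?m"
    by unfold_locales (rule admissible_dgm_exp)
  have fe: "f \<in> endos (multi n ?m)" and par: "has_parity n ?m q ?F"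
    using f homogeneous_mpar_iff[of f n ?m q] by (auto simp: supercentralizer_def)
  have jw: "jw_commutes n ?m G p (transposed r ?m q ?F)" if p: "p \<in> {0, 1}" and G: "queer_matrix n p G" for p G
  proof -
    obtain g where g: "g \<in> queer n" "homogeneous (idxs n) par p g"
      "\<And>x y. x \<in> idxs n \<Longrightarrow> y \<in> idxs n \<Longrightarrow> g (bvec y) x = G x y"
      using queer_of_queer_matrix[OF G p] by metis
    have "rho n r s p g \<circ> f = mscale ((-1) ^ (p * q)) (f \<circ> rho n r s p g)"
      using f g(1,2) p unfolding supercentralizer_def by blast
    then have "jw_commutes n ?m (\<lambda>x y. g (bvec y) x) p (transposed r ?m q ?F)"
      unfolding rho_commutes_iff[OF fe]
      using super_commutes_iff_jw_commutes[OF _ queer_matrix_of_queer[OF g(1,2) p] par] by simp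
    then show ?thesis
      using jw_commutes_cong[of n ?m "transposed r ?m q ?F" "transposed r ?m q ?F" "\<lambda>x y. g (bvec y) x" G p] g(3)
      by blast
  qed
  obtain c where c: "\<And>x y. x \<in> multi n ?m \<Longrightarrow> y \<in> multi n ?m \<Longrightarrow>
      transposed r ?m q ?F x y = (\<Sum>h\<in>mperms ?m. c h * mperm_matrix h x y)"
    using commutant_spanned[OF jw] by blast
  \<comment> \<open>Diagrams of the wrong parity are dropped. They vanish at the entries where
    \<open>f\<close> may be nonzero, but would contribute at the entries where homogeneity forces
    \<open>f\<close> to vanish.\<close>
  define u where "u = (\<lambda>d. if d \<in> superdiagrams r s
    then let h = the_inv_into (mperms ?m) (dgm r ?m) d in c h * of_bool (even (q + card (snd h))) else 0)"
  have u: "u (dgm r ?m h) = c h * of_bool (even (q + card (snd h)))" if "h \<in> mperms ?m" for h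
  proof -
    have "inj_on (dgm r ?m) (mperms ?m)" using dgm_inject by (intro inj_onI)
    then show ?thesis using that by (simp add: u_def superdiagrams_eq the_inv_into_f_f)
  qed
  have "Psi n r s u = f"
  proof (rule endos_eqI[OF Psi_in_endos fe finite_multi])
    fix i j assume ij: "i \<in> multi n ?m" "j \<in> multi n ?m"
    define x where "x = merge r i j"
    define y where "y = merge r j i"
    have xy: "x \<in> multi n ?m" "y \<in> multi n ?m" using ij merge_in_multi by (auto simp: x_def y_def)
    have eq: "merge r x y = i" "merge r y x = j" by (simp_all add: x_def y_def)
    let ?W = "\<lambda>h. wt r s (dgm r ?m h) i j"
    have sum: "Psi n r s u (bvec i) j = (\<Sum>h\<in>mperms ?m. c h * of_bool (even (q + card (snd h))) * ?W h)"
      unfolding Psi_entry_mperms[OF ij] by (simp add: u cong: sum.cong)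
    have even_W: "even ((\<Sum>l=1..?m. par (i l)) + (\<Sum>l=1..?m. par (j l)) + card (snd h))"
      if "h \<in> mperms ?m" "?W h \<noteq> 0" for h
      using has_parity_wt[OF that(1), of "card (snd h)" n] that(2) ij unfolding has_parity_def by simp
    show "Psi n r s u (bvec i) j = f (bvec i) j"
    proof (cases "even ((\<Sum>l=1..?m. par (i l)) + (\<Sum>l=1..?m. par (j l)) + q)")
      case False
      then have "f (bvec i) j = 0" using par ij unfolding has_parity_def by blast
      moreover have "c h * of_bool (even (q + card (snd h))) * ?W h = 0" if "h \<in> mperms ?m" for h
        using False even_W[OF that] by auto
      ultimately show ?thesis unfolding sum by (simp add: sum.neutral)
    next
      case True
      \<comment> \<open>The same sign for every diagram of parity \<open>q\<close>, since it depends
        on the labels only.\<close>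
      let ?e = "(-1 :: complex) ^ transpose_exp r ?m q x y"
      have "c h * mperm_matrix h x y = ?e * (c h * of_bool (even (q + card (snd h))) * ?W h)"
        if h: "h \<in> mperms ?m" for h
      proof (cases "?W h = 0")
        case True
        then show ?thesis using wt_dgm[OF h xy] unfolding eq by (auto simp: mperm_matrix_def split: if_splits)
      next
        case False
        then have e: "even (q + card (snd h))" using even_W[OF h] \<open>even (_ + q)\<close> by simp
        then show ?thesis
          using transposed_wt[OF h xy e] by (simp add: mperm_matrix_def transposed_def eq)
      qed
      then have "transposed r ?m q ?F x y = ?e * Psi n r s u (bvec i) j"
        unfolding c[OF xy] sum sum_distrib_left by (intro sum.cong) auto
      then show ?thesis by (simp add: transposed_def eq)
    qed
  qed
  moreover have "u \<in> superdiagram_space r s"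
    by (simp add: superdiagram_space_def fspace_def u_def)
  ultimately show ?thesis by blast
qed

lemma Psi_image: "Psi n r s ` superdiagram_space r s = End_queer n r s"
proof
  show "Psi n r s ` superdiagram_space r s \<subseteq> End_queer n r s"
  proof (intro image_subsetI)
    fix x
    show "Psi n r s x \<in> End_queer n r s"
      unfolding Psi_def End_queer_eq
      by (intro maps.span_sum maps.span_scale maps.span_base) (use Psi_diagram_supercentral in blast)
  qed
next
  have "maps.subspace (Psi n r s ` superdiagram_space r s)"
  proof (rule maps.subspaceI)
    have "Psi n r s 0 = 0"
      by (intro ext) (simp add: Psi_def mscale_def vscale_def sum_apply)
    then show "0 \<in> Psi n r s ` superdiagram_space r s"
      unfolding superdiagram_space_def using fspace_0 by (metis imageI)
  next
    fix f g assume "f \<in> Psi n r s ` superdiagram_space r s" "g \<in> Psi n r s ` superdiagram_space r s"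
    then obtain x y where xy: "x \<in> superdiagram_space r s" "y \<in> superdiagram_space r s"
      "f = Psi n r s x" "g = Psi n r s y" by blast
    have "Psi n r s (x + y) = f + g"
      unfolding xy(3,4) Psi_def sum.distrib[symmetric]
      by (intro sum.cong) (auto simp: mscale_def vscale_def fun_eq_iff distrib_right)
    moreover have "x + y \<in> superdiagram_space r s"
      using xy(1,2) fspace_add unfolding superdiagram_space_def by blast
    ultimately show "f + g \<in> Psi n r s ` superdiagram_space r s" by (metis imageI)
  next
    fix a f assume "f \<in> Psi n r s ` superdiagram_space r s"
    then obtain x where x: "x \<in> superdiagram_space r s" "f = Psi n r s x" by blast
    have "Psi n r s (vscale a x) = mscale a f"
      unfolding x(2) Psi_def maps.scale_sum_right
      by (intro sum.cong) (auto simp: mscale_def vscale_def fun_eq_iff)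
    moreover have "vscale a x \<in> superdiagram_space r s"
      using x(1) fspace_vscale unfolding superdiagram_space_def by blast
    ultimately show "mscale a f \<in> Psi n r s ` superdiagram_space r s" by (metis imageI)
  qed
  then show "End_queer n r s \<subseteq> Psi n r s ` superdiagram_space r s"
    unfolding End_queer_eq using supercentralizer_in_image by (intro maps.span_minimal) auto
qed

lemma Psi_inj:
  assumes n: "r + s \<le> n"
  shows "inj_on (Psi n r s) (superdiagram_space r s)"
proof (intro inj_onI ext)
  let ?m = "r + s"
  fix u v d assume uv: "u \<in> superdiagram_space r s" "v \<in> superdiagram_space r s"
    and eq: "Psi n r s u = Psi n r s v"
  show "u d = v d"
  proof (cases "d \<in> superdiagrams r s")
    case False
    then have "u d = 0" "v d = 0"
      using uv unfolding superdiagram_space_def fspace_def by blast+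
    then show ?thesis by simp
  next
    case True
    then obtain h where h: "h \<in> mperms ?m" and d: "d = dgm r ?m h" by (auto simp: superdiagrams_eq)
    \<comment> \<open>All labels differ, even up to bars, so the image of \<open>x\<close>
      determines permutation and marks. These labels exist because \<open>n\<close> is at least
      \<open>r + s\<close>.\<close>
    define x where "x = (\<lambda>k. if k \<in> {1..?m} then Pl k else undefined)"
    define y where "y = mact h x"
    have x: "x \<in> multi n ?m" using n by (auto simp: x_def multi_def idxs_def)
    have y: "y \<in> multi n ?m" unfolding y_def using mact_in_multi[OF h x] .
    have uniq: "g = h" if g: "g \<in> mperms ?m" and gx: "mact g x = y" for g
    proof -
      have t: "fst g t = fst h t \<and> (t \<in> snd g \<longleftrightarrow> t \<in> snd h)" if "t \<in> {1..?m}" for t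
        using fun_cong[OF gx[unfolded y_def], of t] that mperms_in[OF g, of t] mperms_in[OF h, of t]
        by (simp add: mact_def x_def split: if_splits)
      have out: "fst g t = fst h t" if "t \<notin> {1..?m}" for t
        using permutes_not_in[OF mperms_fst[OF g] that] permutes_not_in[OF mperms_fst[OF h] that] by simp
      show ?thesis
      proof (rule prod_eqI)
        show "fst g = fst h" using t out by blast
        show "snd g = snd h" using t mperms_snd[OF g] mperms_snd[OF h] by blast
      qed
    qed
    \<comment> \<open>This matrix entry reads off the coefficient of \<open>d\<close> alone, up to a
      nonzero factor.\<close>
    have "Psi n r s w (bvec (merge r x y)) (merge r y x) = w d * wt r s d (merge r x y) (merge r y x)" for w
    proof -
      have "Psi n r s w (bvec (merge r x y)) (merge r y x) =
          (\<Sum>g\<in>mperms ?m. if g = h then w d * wt r s d (merge r x y) (merge r y x) else 0)"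
        unfolding Psi_entry_mperms[OF merge_in_multi[OF x y] merge_in_multi[OF y x]]
      proof (rule sum.cong[OF refl])
        fix g assume g: "g \<in> mperms ?m"
        have "wt r s (dgm r ?m g) (merge r x y) (merge r y x) = 0" if "g \<noteq> h"
          using uniq[OF g] that unfolding wt_dgm[OF g x y] by auto
        then show "w (dgm r ?m g) * wt r s (dgm r ?m g) (merge r x y) (merge r y x) =
            (if g = h then w d * wt r s d (merge r x y) (merge r y x) else 0)"
          by (simp add: d)
      qed
      then show ?thesis using h by simp
    qed
    moreover have "wt r s d (merge r x y) (merge r y x) \<noteq> 0"
      unfolding d wt_dgm[OF h x y] by (simp add: y_def)
    ultimately show ?thesis using eq by (metis mult_right_cancel)
  qed
qed

theorem theorem3p5:
  fixes n r s :: nat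
  assumes "n \<ge> 1" and "r + s > 0"
  shows "Psi n r s ` superdiagram_space r s = End_queer n r s \<and>
    (n \<ge> r + s \<longrightarrow> bij_betw (Psi n r s) (superdiagram_space r s) (End_queer n r s))"
  using Psi_image Psi_inj by (auto simp: bij_betw_def)

end
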